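(* For fixed $m\ge1$ and $\delta>-m$, the largest connected component in the $\pi$-percolated preferential attachment model (d) with $n$ vertices has size at least $O\big(n^{1-\chi+\pi\chi+o(1)}\big)$ (that is, at least of this order) for any percolation probability $\pi\in(0,1]$, where $\chi=\frac{m+\delta}{2m+\delta}$. For preferential attachment trees ($m=1$), the size of the largest connected component is of the order $\mathcal W\,n^{1-\chi+\pi\chi+o(1)}$, where $\mathcal W$ is a finite, almost surely positive, random variable.
   Context: **Model (d)** with parameters $m$ and $\delta$. Start from any finite graph on the two vertices $\{1,2\}$ with finitely many edges between them (self-loops allowed), with degrees $a_1,a_2$, and let $a_{[2]}=a_1+a_2$. Vertices $v=3,4,\dots$ arrive successively, each with $m$ edges, attached one at a time. Given the current graph, the $j$-th edge of $v$ ($j=1,\dots,m$) attaches to $u<v$ with probability $$\frac{d_u(v,j-1)+\delta}{a_{[2]}+2\delta+(2m+\delta)(v-3)+(j-1)},$$ where $d_u(v,j-1)$ is the degree of $u$ after the first $j-1$ edges of $v$ have been attached. The $\pi$-percolated graph retains each edge independently with probability $\pi$ and removes it otherwise, independently of the structure of the graph. Asymptotics are as the number of vertices $n\to\infty$. *)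

theory Defs
  imports "HOL-Probability.Probability"
begin

text \<open>
  The initial multigraph on the vertices 1, 2 is the list E of its edges, given by their end
  points; an entry (u, u) is a self-loop and contributes 2 to the degree of u.
\<close>

definition init_degree :: "(nat \<times> nat) list \<Rightarrow> nat \<Rightarrow> nat" where
  "init_degree E u = count_list (map fst E) u + count_list (map snd E) u"

text \<open>The pair (v, j) stands for the j-th edge of the arriving vertex v.\<close>

definition new_edges :: "nat \<Rightarrow> (nat \<times> nat) set" where
  "new_edges m = {(v, j). 3 \<le> v \<and> 1 \<le> j \<and> j \<le> m}"

definition edges_before :: "nat \<Rightarrow> nat \<Rightarrow> nat \<Rightarrow> (nat \<times> nat) set" where
  "edges_before m v j = {(w, i) \<in> new_edges m. w < v \<or> (w = v \<and> i < j)}"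

text \<open>
  Degree of u in the graph consisting of the initial edges and the new edges in F, where the new
  edge (w, i) joins w and x (w, i).
\<close>

definition degree_in :: "(nat \<times> nat) list \<Rightarrow> (nat \<times> nat \<Rightarrow> nat) \<Rightarrow> (nat \<times> nat) set \<Rightarrow> nat \<Rightarrow> nat" where
  "degree_in E x F u =
     init_degree E u + (\<Sum>e\<in>F. of_bool (fst e = u) + of_bool (x e = u))"

definition attach_prob ::
  "(nat \<times> nat) list \<Rightarrow> nat \<Rightarrow> real \<Rightarrow> (nat \<times> nat \<Rightarrow> nat) \<Rightarrow> nat \<Rightarrow> nat \<Rightarrow> nat \<Rightarrow> real" where
  "attach_prob E m \<delta> x v j u =
     (real (degree_in E x (edges_before m v j) u) + \<delta>) /
     (real (init_degree E 1 + init_degree E 2) + 2 * \<delta> + (2 * real m + \<delta>) * (real v - 3)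
        + (real j - 1))"

datatype edge = Initial nat | Attached "nat \<times> nat"

definition edges :: "(nat \<times> nat) list \<Rightarrow> nat \<Rightarrow> edge set" where
  "edges E m = Initial ` {..<length E} \<union> Attached ` new_edges m"

definition edges_upto :: "(nat \<times> nat) list \<Rightarrow> nat \<Rightarrow> nat \<Rightarrow> edge set" where
  "edges_upto E m n = Initial ` {..<length E} \<union> Attached ` {(v, j) \<in> new_edges m. v \<le> n}"

fun end_points :: "(nat \<times> nat) list \<Rightarrow> (nat \<times> nat \<Rightarrow> nat) \<Rightarrow> edge \<Rightarrow> nat \<times> nat" where
  "end_points E x (Initial i) = E ! i"
| "end_points E x (Attached e) = (fst e, x e)"

text \<open>
  X (v, j) is the vertex to which the j-th edge of v attaches, and B e tells whether the edge e is
  retained; all graph sizes n are realised on one probability space, each edge being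
  retained or removed once and for all.  Conditioning on the current graph is conditioning on
  all attachments made so far.  The assumptions on the initial degrees say that the
  attachment weights are nonnegative and not all zero, as needed for attach_prob to be a
  probability; for later vertices this follows from \<delta> > - m.
\<close>

locale percolated_pa = prob_space M
  for M :: "'w measure" and E :: "(nat \<times> nat) list" and m :: nat and \<delta> \<pi> :: real
    and X :: "nat \<times> nat \<Rightarrow> 'w \<Rightarrow> nat" and B :: "edge \<Rightarrow> 'w \<Rightarrow> bool" +
  assumes init_graph: "set E \<subseteq> {1, 2} \<times> {1, 2}"
    and init_weight_nonneg: "\<And>u. u \<in> {1, 2} \<Longrightarrow> real (init_degree E u) + \<delta> \<ge> 0"
    and init_weight_pos: "real (init_degree E 1 + init_degree E 2) + 2 * \<delta> > 0"
    and attach_measurable: "\<And>e. e \<in> new_edges m \<Longrightarrow> X e \<in> M \<rightarrow>\<^sub>M count_space UNIV"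
    and attach: "\<And>v j u x. (v, j) \<in> new_edges m \<Longrightarrow> 1 \<le> u \<Longrightarrow> u < v \<Longrightarrow>
        \<P>(\<omega> in M. \<forall>e\<in>edges_before m v j. X e \<omega> = x e) > 0 \<Longrightarrow>
        \<P>(\<omega> in M. X (v, j) \<omega> = u \<bar> \<forall>e\<in>edges_before m v j. X e \<omega> = x e)
          = attach_prob E m \<delta> x v j u"
    and retain_prob: "\<And>e. e \<in> edges E m \<Longrightarrow> \<P>(\<omega> in M. B e \<omega>) = \<pi>"
    and retain_indep: "indep_vars (\<lambda>_. count_space UNIV) B (edges E m)"
    and retain_indep_graph: "indep_set
        {(\<lambda>\<omega>. \<lambda>e\<in>new_edges m. X e \<omega>) -` S \<inter> space M | S.
           S \<in> sets (Pi\<^sub>M (new_edges m) (\<lambda>_. count_space UNIV))}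
        {(\<lambda>\<omega>. \<lambda>e\<in>edges E m. B e \<omega>) -` S \<inter> space M | S.
           S \<in> sets (Pi\<^sub>M (edges E m) (\<lambda>_. count_space UNIV))}"

text \<open>Here x and b are realisations of X and B.\<close>

definition perc_adj ::
  "(nat \<times> nat) list \<Rightarrow> nat \<Rightarrow> (nat \<times> nat \<Rightarrow> nat) \<Rightarrow> (edge \<Rightarrow> bool) \<Rightarrow> nat \<Rightarrow> (nat \<times> nat) set" where
  "perc_adj E m x b n = end_points E x ` {e \<in> edges_upto E m n. b e}"

definition perc_component ::
  "(nat \<times> nat) list \<Rightarrow> nat \<Rightarrow> (nat \<times> nat \<Rightarrow> nat) \<Rightarrow> (edge \<Rightarrow> bool) \<Rightarrow> nat \<Rightarrow> nat \<Rightarrow> nat set" where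
  "perc_component E m x b n u =
     {w \<in> {1..n}. (u, w) \<in> (perc_adj E m x b n \<union> (perc_adj E m x b n)\<inverse>)\<^sup>*}"

definition largest_component ::
  "(nat \<times> nat) list \<Rightarrow> nat \<Rightarrow> (nat \<times> nat \<Rightarrow> nat) \<Rightarrow> (edge \<Rightarrow> bool) \<Rightarrow> nat \<Rightarrow> nat" where
  "largest_component E m x b n = Max ((\<lambda>u. card (perc_component E m x b n u)) ` {1..n})"

definition chi :: "nat \<Rightarrow> real \<Rightarrow> real" where
  "chi m \<delta> = (real m + \<delta>) / (2 * real m + \<delta>)"

end

theory Submission
  imports Defs
begin

text \<open>
  Follow the first edges only: the cluster of a root consists of the later vertices whose first
  edge is retained and leads into the cluster.  If \<open>W\<close> is the sum of \<open>d + \<delta>\<close> over a cluster, then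
  each arriving vertex raises \<open>W\<close> on average at least by the factor \<open>1 + \<beta> / T\<close> (exactly if \<open>m = 1\<close>), where
  \<open>\<beta> = m + \<pi> (m + \<delta>)\<close> and \<open>T\<close> is the total weight, about \<open>(2 m + \<delta>) n\<close>; this gives growth of order
  \<open>n\<close> to the power \<open>\<beta> / (2 m + \<delta>) = 1 - \<chi> + \<pi> \<chi>\<close>.

  With \<open>s = 2 m + \<delta>\<close>, the largest possible jump of \<open>W\<close>, and with \<open>c n\<close> the product of the growth
  factors, \<open>(c n / (W - k s))^k\<close> is a supermartingale once \<open>W > k s\<close>, and for \<open>m = 1\<close> so is \<open>((W + k s) / c n)^k\<close>.
  The maximal inequality with \<open>k\<close> large shows that \<open>W / c n\<close> eventually stays within a factor 2 of
  a positive random value, so that no martingale convergence theorem is needed.  A further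
  supermartingale, \<open>exp (b W - a Z)\<close>, bounds the size \<open>Z\<close> of the cluster from below by a
  multiple of \<open>W\<close>.

  For \<open>m = 1\<close> every component is contained in one cluster, and the \<open>k\<close>-th moment bound
  is summable over the roots, so by Borel-Cantelli the largest component is comparable with the
  largest of finitely many clusters.
\<close>

section \<open>Clusters of retained first edges\<close>

text \<open>Each of the \<open>m\<close> edges of a new vertex ends in a cluster of weight
  \<open>W\<close> with probability about \<open>W / T\<close> and then adds 1; with the extra
  probability \<pi> of keeping the first edge, the new vertex brings its own m + \<delta>. This is
  the origin of \<beta>.

  Plain powers of \<open>W\<close> fail to be supermartingales because of the higher order terms in
  the jump. Since a jump is at most \<open>s\<close>, moving the base by \<open>k s\<close> absorbs
  them, but then the estimates start well only once \<open>W\<close> exceeds a multiple of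
  \<open>k s\<close>. A cruder supermartingale, a power \<open>q\<close> < 1 of \<open>c n\<close>
  divided by \<open>W\<close>, shows that \<open>W\<close> becomes that large with probability
  tending to 1. The maximal inequality then leaves an error of order (2/3)^k uniformly in the
  starting time, and \<open>k\<close> is free.

  A large \<open>W\<close> could come from many edges ending at few vertices, which is why the size
  needs its own supermartingale.

  The constants of the conclusion are nonrandom while the limiting weight is random. So the
  constants comparing size and weight must not depend on the root, and for trees the random factor
  is a liminf, measurable without any convergence.\<close>

text \<open>
  A path \<open>(x, b)\<close> records the attachments and, as \<open>b w\<close>, whether the first edge of \<open>w\<close> is
  retained.
\<close>

type_synonym path = "(nat \<times> nat \<Rightarrow> nat) \<times> (nat \<Rightarrow> bool)"

text \<open>
  The index 2 stands for the cluster started from both initial vertices.  Its initial weight is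
  positive, which may fail for a single initial vertex; in exchange it need not be connected, but
  it meets at most two components.
\<close>

definition root :: "nat \<Rightarrow> nat set" where
  "root u = (if u = 2 then {1, 2} else {u})"

text \<open>Recursion on time makes the cluster at time \<open>n\<close> depend only on the arrivals
  up to \<open>n\<close>. A root \<open>u\<close> \<ge> 3 starts a cluster even if its own first
  edge is retained; that cluster may then lie inside an older one, see
  \<open>cluster_trans\<close>.\<close>

primrec cluster :: "path \<Rightarrow> nat \<Rightarrow> nat \<Rightarrow> nat set" where
  "cluster p u 0 = {}"
| "cluster p u (Suc n) = (if Suc n = u then root u
     else cluster p u n \<union> {w. w = Suc n \<and> fst p (w, 1) \<in> cluster p u n \<and> snd p w})"

lemma finite_root [simp]: "finite (root u)"
  and self_in_root [simp]: "u \<in> root u"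
  by (auto simp: root_def)

lemma cluster_before: "n < u \<Longrightarrow> cluster p u n = {}"
  by (induction n) auto

lemma cluster_start: "2 \<le> u \<Longrightarrow> cluster p u u = root u"
  by (cases u) auto

lemma finite_cluster [simp]: "finite (cluster p u n)"
  by (induction n) auto

lemma cluster_subset: "2 \<le> u \<Longrightarrow> cluster p u n \<subseteq> {1..n}"
  by (induction n) (auto simp: root_def split: if_splits)

lemma cluster_Suc: "u \<le> n \<Longrightarrow> cluster p u (Suc n) =
    (if fst p (Suc n, 1) \<in> cluster p u n \<and> snd p (Suc n)
     then insert (Suc n) (cluster p u n) else cluster p u n)"
  by auto

declare cluster.simps(2) [simp del]

lemma cluster_mono: 
  assumes "n \<le> n'" shows "cluster p u n \<subseteq> cluster p u n'"
  using assms
proof (induction n' rule: dec_induct)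
  case (step k)
  then show ?case by (cases "u \<le> k") (auto simp: cluster_Suc cluster_before)
qed simp

text \<open>Only the arriving vertex can enter at each step, so the membership of a vertex is
  settled at its arrival.\<close>

lemma cluster_restrict:
  assumes "2 \<le> u" "u \<le> n" "n \<le> n'" shows "cluster p u n' \<inter> {..n} = cluster p u n"
  using assms(3)
proof (induction n' rule: dec_induct)
  case base
  then show ?case using cluster_subset[OF assms(1), of p n] by auto
next
  case (step k)
  then show ?case using assms by (auto simp: cluster_Suc)
qed

lemma cluster_ge:
  assumes "3 \<le> u" "w \<in> cluster p u n" shows "u \<le> w"
  using assms(2)
proof (induction n)
  case (Suc n)
  consider "Suc n < u" | "Suc n = u" | "u \<le> n" by linarith
  then show ?case
  proof cases
    case 2
    have "cluster p u u = {u}" using assms cluster_start[of u p] by (simp add: root_def)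
    then show ?thesis using Suc.prems 2 by simp
  qed (use Suc assms in \<open>auto simp: cluster_before cluster_Suc split: if_splits\<close>)
qed simp

text \<open>From time \<open>u\<close> on both clusters grow by the same rule, so the inclusion of
  the single root \<open>u\<close> at time \<open>u\<close> propagates.\<close>

lemma cluster_trans:
  assumes "2 \<le> u'" "3 \<le> u" "u \<le> n" "u \<in> cluster p u' n"
  shows "cluster p u n \<subseteq> cluster p u' n"
proof -
  have *: "u' \<le> u"
  proof (cases "u' = 2")
    case False
    then show ?thesis using cluster_ge[of u' u p n] assms by auto
  qed (use assms in auto)
  have u: "u \<in> cluster p u' u"
    using cluster_restrict[of u' u n p] * assms by auto
  show ?thesis using \<open>u \<le> n\<close>
  proof (induction n rule: dec_induct)
    case base
    then show ?case using u cluster_start[of u p] assms by (simp add: root_def)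
  next
    case (step k)
    then show ?case using * by (auto simp: cluster_Suc)
  qed
qed

lemma perc_component_subset: "perc_component E m x b n u \<subseteq> {1..n}"
  by (auto simp: perc_component_def)

lemma card_component_le_largest:
  "u \<in> {1..n} \<Longrightarrow> card (perc_component E m x b n u) \<le> largest_component E m x b n"
  unfolding largest_component_def by (rule Max_ge) auto

text \<open>\<open>N\<close> is kept apart from \<open>n\<close> so that the induction on
  \<open>n\<close> traces paths in one fixed graph.\<close>

lemma cluster_connected:
  assumes "1 \<le> m" "2 \<le> u" "n \<le> N" "w \<in> cluster (x, \<lambda>w. b (Attached (w, 1))) u n"
  shows "\<exists>r\<in>root u. (r, w) \<in> (perc_adj E m x b N \<union> (perc_adj E m x b N)\<inverse>)\<^sup>*"
  using assms(3,4)
proof (induction n arbitrary: w)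
  case (Suc n)
  let ?p = "(x, \<lambda>w. b (Attached (w, 1)))"
  consider "Suc n < u" | "Suc n = u" | "u \<le> n" by linarith
  then show ?case
  proof cases
    case 2
    then have "w \<in> root u" using Suc.prems cluster_start[of u ?p] assms by auto
    then show ?thesis by auto
  next
    case 3
    show ?thesis
    proof (cases "w \<in> cluster ?p u n")
      case True
      then show ?thesis using Suc by auto
    next
      case False
      then have w: "w = Suc n" "x (w, 1) \<in> cluster ?p u n" "b (Attached (w, 1))"
        using Suc.prems 3 by (auto simp: cluster_Suc split: if_splits)
      then obtain r where r: "r \<in> root u"
        "(r, x (w, 1)) \<in> (perc_adj E m x b N \<union> (perc_adj E m x b N)\<inverse>)\<^sup>*"
        using Suc by auto
      have "Attached (w, 1) \<in> edges_upto E m N"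
        using w Suc.prems assms 3 by (auto simp: edges_upto_def new_edges_def)
      then have "(w, x (w, 1)) \<in> perc_adj E m x b N"
        unfolding perc_adj_def using w(3) by (intro image_eqI[of _ _ "Attached (w, 1)"]) auto
      then have "(x (w, 1), w) \<in> (perc_adj E m x b N \<union> (perc_adj E m x b N)\<inverse>)\<^sup>*" by auto
      then show ?thesis using r by (meson rtrancl_trans)
    qed
  qed (use Suc in \<open>auto simp: cluster_before\<close>)
qed simp

text \<open>The factor 2 is due to \<open>root 2\<close>, whose two vertices may lie in different
  components.\<close>

lemma card_cluster_le_largest:
  assumes "1 \<le> m" "2 \<le> u" "u \<le> n"
  shows "card (cluster (x, \<lambda>w. b (Attached (w, 1))) u n) \<le> 2 * largest_component E m x b n"
proof -
  let ?C = "\<lambda>r. perc_component E m x b n r"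
  have "cluster (x, \<lambda>w. b (Attached (w, 1))) u n \<subseteq> (\<Union>r\<in>root u. ?C r)"
    using cluster_connected[OF assms(1,2) order.refl, of _ x b n E] cluster_subset[OF assms(2)]
    unfolding perc_component_def by fastforce
  moreover have fin: "finite (?C r)" for r
    by (rule finite_subset[OF perc_component_subset]) simp
  ultimately have "card (cluster (x, \<lambda>w. b (Attached (w, 1))) u n) \<le> card (\<Union>r\<in>root u. ?C r)"
    by (intro card_mono) auto
  also have "\<dots> \<le> (\<Sum>r\<in>root u. card (?C r))" by (rule card_UN_le) simp
  also have "\<dots> \<le> (\<Sum>r\<in>root u. largest_component E m x b n)"
    using assms by (intro sum_mono card_component_le_largest) (auto simp: root_def split: if_splits)
  also have "\<dots> \<le> 2 * largest_component E m x b n" by (simp add: root_def card_insert_if)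
  finally show ?thesis .
qed

text \<open>With \<open>m = 1\<close> every new edge is a first edge. Take the smallest index
  \<open>u\<close> whose cluster contains \<open>r\<close>: if \<open>u\<close> \<ge> 3, minimality
  forces the first edge of \<open>u\<close> to be removed, and then no percolated edge leaves the
  cluster.\<close>

lemma component_subset_cluster:
  assumes E: "set E \<subseteq> {1, 2} \<times> {1, 2}" and good: "\<And>v. 3 \<le> v \<Longrightarrow> v \<le> n \<Longrightarrow> 1 \<le> x (v, 1) \<and> x (v, 1) < v"
    and r: "r \<in> {1..n}" and n: "2 \<le> n"
  shows "\<exists>u\<in>{2..n}. perc_component E 1 x b n r \<subseteq> cluster (x, \<lambda>w. b (Attached (w, 1))) u n"
proof -
  let ?p = "(x, \<lambda>w. b (Attached (w, 1)))"
  define P where "P u \<longleftrightarrow> u \<in> {2..n} \<and> r \<in> cluster ?p u n" for u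
  have "\<exists>u. P u"
  proof (cases "r \<le> 2")
    case True
    then have "r \<in> root 2" using r by (auto simp: root_def)
    then show ?thesis unfolding P_def
      using cluster_start[of 2 ?p] cluster_mono[of 2 n ?p 2] n by (intro exI[of _ 2]) auto
  next
    case False
    then show ?thesis unfolding P_def
      using cluster_start[of r ?p] cluster_mono[of r n ?p r] r
      by (intro exI[of _ r]) auto
  qed
  then obtain u where Pu: "P u" and min: "\<And>u'. u' < u \<Longrightarrow> \<not> P u'"
    using exists_least_iff[of P] by auto
  have u: "u \<in> {2..n}" "r \<in> cluster ?p u n" using Pu by (auto simp: P_def)
  have root_edge: "\<not> b (Attached (u, 1))" if "3 \<le> u"
  proof
    assume b: "b (Attached (u, 1))"
    \<comment> \<open>The vertices 1 and 2 share the index 2, hence the maximum.\<close>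
    define u' where "u' = max (x (u, 1)) 2"
    have xu: "1 \<le> x (u, 1)" "x (u, 1) < u" using good[of u] that u by auto
    have u': "2 \<le> u'" "u' < u" using xu that by (auto simp: u'_def)
    have "x (u, 1) \<in> root u'" using xu by (auto simp: u'_def root_def max_def)
    then have "x (u, 1) \<in> cluster ?p u' (u - 1)"
      using cluster_start[of u' ?p] cluster_mono[of u' "u - 1" ?p u'] u' by (auto simp: le_diff_conv2)
    then have "u \<in> cluster ?p u' (Suc (u - 1))"
      using b u' by (subst cluster_Suc) auto
    then have "u \<in> cluster ?p u' n"
      using cluster_mono[of u n ?p u'] u that by auto
    from cluster_trans[OF _ that _ this] u' u have "r \<in> cluster ?p u' n" by auto
    then show False using min[of u'] u' u by (auto simp: P_def)
  qed
  \<comment> \<open>Initial edges stay inside \<open>{1, 2}\<close>, which lies in the cluster or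
    misses it. For the edge of a later vertex \<open>y\<close>: both ends are outside if
    \<open>y < u\<close>, the edge is removed if \<open>y = u\<close>, and for \<open>u < y\<close>
    the recursion puts both ends into the cluster or neither.\<close>
  have closed: "y \<in> cluster ?p u n \<longleftrightarrow> y' \<in> cluster ?p u n" if adj: "(y, y') \<in> perc_adj E 1 x b n" for y y'
  proof -
    obtain e where e: "e \<in> edges_upto E 1 n" "b e" "(y, y') = end_points E x e"
      using adj by (auto simp: perc_adj_def)
    show ?thesis
    proof (cases e)
      case (Initial i)
      then have "(y, y') \<in> set E" using e by (auto simp: edges_upto_def)
      then have "(y, y') \<in> {1, 2} \<times> {1, 2}" using E by blast
      moreover have "{1, 2} \<subseteq> cluster ?p u n" if "u = 2"
        using that cluster_start[of 2 ?p] cluster_mono[of 2 n ?p 2] n by (simp add: root_def)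
      moreover have "{1, 2} \<inter> cluster ?p u n = {}" if "u \<noteq> 2"
        using that u cluster_ge[of u _ ?p n] by fastforce
      ultimately show ?thesis by (cases "u = 2") auto
    next
      case (Attached a)
      then have a: "a = (y, 1)" "3 \<le> y" "y \<le> n" "y' = x (y, 1)"
        using e by (auto simp: edges_upto_def new_edges_def)
      have xy: "1 \<le> y'" "y' < y" using good[of y] a by auto
      have bb: "b (Attached (y, 1))" using e a Attached by simp
      consider "y < u" | "y = u" | "u < y" by linarith
      then show ?thesis
      proof cases
        case 1
        then have "3 \<le> u" using a by simp
        then show ?thesis using cluster_ge[of u _ ?p n] 1 xy by fastforce
      next
        case 2
        then show ?thesis using root_edge bb a by simp
      next
        case 3
        have "y \<in> cluster ?p u n \<longleftrightarrow> y \<in> cluster ?p u (Suc (y - 1))"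
          using cluster_restrict[of u y n ?p] u a 3 by auto
        also have "\<dots> \<longleftrightarrow> y' \<in> cluster ?p u (y - 1)"
        proof -
          have "y \<notin> cluster ?p u (y - 1)"
            using cluster_subset[of u ?p "y - 1"] u a by fastforce
          moreover have "Suc (y - 1) = y" "u \<le> y - 1" using 3 by auto
          ultimately show ?thesis using cluster_Suc[of u "y - 1" ?p] bb a by auto
        qed
        also have "\<dots> \<longleftrightarrow> y' \<in> cluster ?p u n"
        proof -
          have "u \<le> y - 1" "y - 1 \<le> n" "y' \<le> y - 1" using 3 xy a by auto
          then show ?thesis using cluster_restrict[of u "y - 1" n ?p] u
            by (metis IntD1 IntI atLeastAtMost_iff atMost_iff)
        qed
        finally show ?thesis .
      qed
    qed
  qed
  have "w \<in> cluster ?p u n" if "(r, w) \<in> (perc_adj E 1 x b n \<union> (perc_adj E 1 x b n)\<inverse>)\<^sup>*" for w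
    using that by (induction rule: rtrancl_induct) (use u closed in auto)
  then show ?thesis using u by (intro bexI[of _ u]) (auto simp: perc_component_def)
qed

lemma largest_le_cluster:
  assumes "set E \<subseteq> {1, 2} \<times> {1, 2}" "\<And>v. 3 \<le> v \<Longrightarrow> v \<le> n \<Longrightarrow> 1 \<le> x (v, 1) \<and> x (v, 1) < v" "2 \<le> n"
  shows "\<exists>u\<in>{2..n}. largest_component E 1 x b n \<le> card (cluster (x, \<lambda>w. b (Attached (w, 1))) u n)"
proof -
  have "largest_component E 1 x b n \<in> (\<lambda>u. card (perc_component E 1 x b n u)) ` {1..n}"
    unfolding largest_component_def by (rule Max_in) (use assms(3) in auto)
  then obtain r where r: "r \<in> {1..n}" "largest_component E 1 x b n = card (perc_component E 1 x b n r)"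
    by auto
  obtain u where "u \<in> {2..n}" "perc_component E 1 x b n r \<subseteq> cluster (x, \<lambda>w. b (Attached (w, 1))) u n"
    using component_subset_cluster[OF assms(1,2) r(1) assms(3)] by blast
  then show ?thesis using r by (intro bexI[of _ u]) (auto intro: card_mono)
qed

section \<open>Histories and attachment probabilities\<close>

text \<open>Such paths carry the same information just before the \<open>j\<close>-th edge of
  \<open>v\<close>. The retention of the first edge of \<open>v\<close> itself is left out even when
  \<open>j > 1\<close>, so that it stays independent of this information.\<close>

definition agree :: "nat \<Rightarrow> nat \<Rightarrow> nat \<Rightarrow> path \<Rightarrow> path \<Rightarrow> bool" where
  "agree m v j p q \<longleftrightarrow> (\<forall>e\<in>edges_before m v j. fst p e = fst q e) \<and> (\<forall>w\<in>{3..<v}. snd p w = snd q w)"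

text \<open>Adaptedness, stated pathwise. As there are only countably many histories, it already
  yields measurability (\<open>determined_measurable\<close>), and no filtration has to be
  built.\<close>

definition determined :: "nat \<Rightarrow> nat \<Rightarrow> nat \<Rightarrow> (path \<Rightarrow> 'a) \<Rightarrow> bool" where
  "determined m v j f \<longleftrightarrow> (\<forall>p q. agree m v j p q \<longrightarrow> f p = f q)"

lemma determinedD: "determined m v j f \<Longrightarrow> agree m v j p q \<Longrightarrow> f p = f q"
  unfolding determined_def by blast

lemma determined_const [simp]: "determined m v j (\<lambda>p. c)"
  by (simp add: determined_def)

lemma finite_edges_before [simp]: "finite (edges_before m v j)"
  by (rule finite_subset[of _ "{..v} \<times> {..m}"]) (auto simp: edges_before_def new_edges_def)

lemma edges_before_subset: "edges_before m v j \<subseteq> new_edges m"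
  by (auto simp: edges_before_def)

lemma restrict_eq_iff: "g \<in> A \<rightarrow>\<^sub>E UNIV \<Longrightarrow> restrict f A = g \<longleftrightarrow> (\<forall>a\<in>A. f a = g a)"
  by (auto simp: fun_eq_iff PiE_def extensional_def restrict_def)

text \<open>Replaces conditional expectation given a countably valued \<open>Y\<close> by a sum over
  its atoms.\<close>

lemma (in sigma_finite_measure) nn_integral_split_countable:
  assumes I: "countable I" and Y: "Y \<in> M \<rightarrow>\<^sub>M count_space I" and g [measurable]: "g \<in> borel_measurable M"
  shows "(\<integral>\<^sup>+\<omega>. g \<omega> \<partial>M) =
    (\<integral>\<^sup>+y. (\<integral>\<^sup>+\<omega>. g \<omega> * indicator (Y -` {y} \<inter> space M) \<omega> \<partial>M) \<partial>count_space I)"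
proof -
  have [measurable]: "Y -` {y} \<inter> space M \<in> sets M" if "y \<in> I" for y
    using that by (intro measurable_sets[OF Y]) auto
  have "(\<integral>\<^sup>+y. (\<integral>\<^sup>+\<omega>. g \<omega> * indicator (Y -` {y} \<inter> space M) \<omega> \<partial>M) \<partial>count_space I)
      = (\<integral>\<^sup>+\<omega>. (\<integral>\<^sup>+y. g \<omega> * indicator (Y -` {y} \<inter> space M) \<omega> \<partial>count_space I) \<partial>M)"
    by (rule nn_integral_count_space_nn_integral[symmetric]) (use I in auto)
  also have "\<dots> = (\<integral>\<^sup>+\<omega>. g \<omega> \<partial>M)"
  proof (rule nn_integral_cong)
    fix \<omega> assume \<omega>: "\<omega> \<in> space M"
    then have "Y \<omega> \<in> I" using measurable_space[OF Y] by auto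
    then have "(\<integral>\<^sup>+y. g \<omega> * indicator (Y -` {y} \<inter> space M) \<omega> \<partial>count_space I)
      = (\<Sum>y\<in>{Y \<omega>}. g \<omega> * indicator (Y -` {y} \<inter> space M) \<omega>)"
      by (intro nn_integral_count_space') (auto simp: indicator_def)
    then show "(\<integral>\<^sup>+y. g \<omega> * indicator (Y -` {y} \<inter> space M) \<omega> \<partial>count_space I) = g \<omega>"
      using \<omega> by simp
  qed
  finally show ?thesis ..
qed

locale pa_setting = percolated_pa M E m \<delta> \<pi> X B
  for M :: "'w measure" and E :: "(nat \<times> nat) list" and m :: nat and \<delta> \<pi> :: real
    and X :: "nat \<times> nat \<Rightarrow> 'w \<Rightarrow> nat" and B :: "edge \<Rightarrow> 'w \<Rightarrow> bool" +
  assumes m_pos: "1 \<le> m" and delta: "- real m < \<delta>" and pi_pos: "0 < \<pi>" and pi_le: "\<pi> \<le> 1"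
begin

definition sample :: "'w \<Rightarrow> path" where
  "sample \<omega> = (\<lambda>e. X e \<omega>, \<lambda>w. B (Attached (w, 1)) \<omega>)"

lemma B_measurable: "e \<in> edges E m \<Longrightarrow> B e \<in> M \<rightarrow>\<^sub>M count_space UNIV"
  using retain_indep by (simp add: indep_vars_def)

lemma Attached_in_edges: "3 \<le> w \<Longrightarrow> Attached (w, 1) \<in> edges E m"
    "3 \<le> w \<Longrightarrow> Attached (w, Suc 0) \<in> edges E m"
  using m_pos by (auto simp: edges_def new_edges_def)

lemma X_event [measurable]: "e \<in> new_edges m \<Longrightarrow> Measurable.pred M (\<lambda>\<omega>. P (X e \<omega>))"
  by (rule measurable_compose[OF attach_measurable]) auto

lemma B_event [measurable]: "e \<in> edges E m \<Longrightarrow> Measurable.pred M (\<lambda>\<omega>. P (B e \<omega>))"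
  by (rule measurable_compose[OF B_measurable]) auto

lemma prob_retained_prod:
  assumes "finite J" "J \<subseteq> edges E m"
  shows "prob {\<omega>\<in>space M. \<forall>e\<in>J. B e \<omega> \<in> K e} = (\<Prod>e\<in>J. prob {\<omega>\<in>space M. B e \<omega> \<in> K e})"
proof (cases "J = {}")
  case False
  have "prob (\<Inter>e\<in>J. B e -` K e \<inter> space M) = (\<Prod>e\<in>J. prob (B e -` K e \<inter> space M))"
    by (rule indep_varsD[OF retain_indep False assms]) auto
  moreover have "(\<Inter>e\<in>J. B e -` K e \<inter> space M) = {\<omega>\<in>space M. \<forall>e\<in>J. B e \<omega> \<in> K e}"
    using False by auto
  moreover have "B e -` K e \<inter> space M = {\<omega>\<in>space M. B e \<omega> \<in> K e}" for e by auto
  ultimately show ?thesis by simp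
qed (simp add: prob_space)

text \<open>Brings the assumed independence of two families of infinite product events down to
  events about finitely many coordinates.\<close>

lemma prob_graph_retained:
  assumes "finite F" "F \<subseteq> new_edges m" "finite J" "J \<subseteq> edges E m"
  shows "prob {\<omega>\<in>space M. (\<forall>e\<in>F. X e \<omega> = x e) \<and> (\<forall>e\<in>J. B e \<omega> \<in> K e)} =
    prob {\<omega>\<in>space M. \<forall>e\<in>F. X e \<omega> = x e} * prob {\<omega>\<in>space M. \<forall>e\<in>J. B e \<omega> \<in> K e}"
proof -
  let ?N1 = "Pi\<^sub>M (new_edges m) (\<lambda>_. count_space UNIV) :: (nat \<times> nat \<Rightarrow> nat) measure"
  let ?N2 = "Pi\<^sub>M (edges E m) (\<lambda>_. count_space UNIV) :: (edge \<Rightarrow> bool) measure"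
  let ?S1 = "{f\<in>space ?N1. \<forall>e\<in>F. f e = x e}" and ?S2 = "{f\<in>space ?N2. \<forall>e\<in>J. f e \<in> K e}"
  have s1: "?S1 \<in> sets ?N1"
  proof (rule sets.sets_Collect_finite_All[OF _ assms(1)])
    fix e assume "e \<in> F"
    then have "(\<lambda>f. f e) \<in> ?N1 \<rightarrow>\<^sub>M count_space UNIV"
      using assms by (intro measurable_component_singleton) auto
    from measurable_sets[OF this, of "{x e}"] show "{f\<in>space ?N1. f e = x e} \<in> sets ?N1"
      by (simp add: vimage_def Int_def conj_commute)
  qed
  have s2: "?S2 \<in> sets ?N2"
  proof (rule sets.sets_Collect_finite_All[OF _ assms(3)])
    fix e assume "e \<in> J"
    then have "(\<lambda>f. f e) \<in> ?N2 \<rightarrow>\<^sub>M count_space UNIV"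
      using assms by (intro measurable_component_singleton) auto
    from measurable_sets[OF this, of "K e"] show "{f\<in>space ?N2. f e \<in> K e} \<in> sets ?N2"
      by (simp add: vimage_def Int_def conj_commute)
  qed
  have indep: "prob (((\<lambda>\<omega>. \<lambda>e\<in>new_edges m. X e \<omega>) -` ?S1 \<inter> space M) \<inter> ((\<lambda>\<omega>. \<lambda>e\<in>edges E m. B e \<omega>) -` ?S2 \<inter> space M))
     = prob ((\<lambda>\<omega>. \<lambda>e\<in>new_edges m. X e \<omega>) -` ?S1 \<inter> space M) * prob ((\<lambda>\<omega>. \<lambda>e\<in>edges E m. B e \<omega>) -` ?S2 \<inter> space M)"
    using retain_indep_graph[unfolded indep_sets2_eq] s1 s2 by blast
  have X: "(\<lambda>\<omega>. \<lambda>e\<in>new_edges m. X e \<omega>) -` ?S1 \<inter> space M = {\<omega>\<in>space M. \<forall>e\<in>F. X e \<omega> = x e}"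
    using assms by (auto simp: space_PiM)
  have B: "(\<lambda>\<omega>. \<lambda>e\<in>edges E m. B e \<omega>) -` ?S2 \<inter> space M = {\<omega>\<in>space M. \<forall>e\<in>J. B e \<omega> \<in> K e}"
    using assms by (auto simp: space_PiM)
  have "{\<omega>\<in>space M. \<forall>e\<in>F. X e \<omega> = x e} \<inter> {\<omega>\<in>space M. \<forall>e\<in>J. B e \<omega> \<in> K e} =
      {\<omega>\<in>space M. (\<forall>e\<in>F. X e \<omega> = x e) \<and> (\<forall>e\<in>J. B e \<omega> \<in> K e)}"
    by auto
  then show ?thesis using indep unfolding X B by simp
qed

definition history :: "nat \<Rightarrow> nat \<Rightarrow> 'w \<Rightarrow> path" where
  "history v j \<omega> = (restrict (fst (sample \<omega>)) (edges_before m v j), restrict (snd (sample \<omega>)) {3..<v})"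

definition histories :: "nat \<Rightarrow> nat \<Rightarrow> path set" where
  "histories v j = (edges_before m v j \<rightarrow>\<^sub>E UNIV) \<times> ({3..<v} \<rightarrow>\<^sub>E UNIV)"

lemma countable_histories: "countable (histories v j)"
  unfolding histories_def by (intro countable_SIGMA countable_PiE) auto

lemma agree_history: "agree m v j (sample \<omega>) (history v j \<omega>)"
  by (simp add: agree_def history_def)

lemma determined_history: "determined m v j f \<Longrightarrow> f (sample \<omega>) = f (history v j \<omega>)"
  by (rule determinedD[OF _ agree_history])

text \<open>The retention flags are indexed by edges rather than vertices, to match
  \<open>prob_graph_retained\<close>; the \<open>THE\<close> term recovers \<open>w\<close> from
  \<open>Attached (w, 1)\<close>.\<close>

lemma history_eq_iff:
  assumes "y \<in> histories v j"
  shows "history v j \<omega> = y \<longleftrightarrow> (\<forall>e\<in>edges_before m v j. X e \<omega> = fst y e) \<and>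
    (\<forall>e\<in>(\<lambda>w. Attached (w, 1)) ` {3..<v}. B e \<omega> \<in> {snd y (fst (THE a. e = Attached a))})"
  using assms by (cases y) (auto simp: history_def histories_def sample_def restrict_eq_iff)

lemma history_measurable: "history v j \<in> M \<rightarrow>\<^sub>M count_space (histories v j)"
proof (subst measurable_count_space_eq_countable[OF countable_histories], intro conjI ballI)
  show "history v j \<in> space M \<rightarrow> histories v j"
    by (auto simp: history_def histories_def)
  fix y assume y: "y \<in> histories v j"
  have [measurable]: "e \<in> edges_before m v j \<Longrightarrow> e \<in> new_edges m" for e
    using edges_before_subset by auto
  have "{\<omega>\<in>space M. (\<forall>e\<in>edges_before m v j. X e \<omega> = fst y e) \<and>
    (\<forall>e\<in>(\<lambda>w. Attached (w, 1)) ` {3..<v}. B e \<omega> \<in> {snd y (fst (THE a. e = Attached a))})} \<in> sets M"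
    by (intro sets.sets_Collect_conj sets.sets_Collect_finite_All predE X_event B_event)
       (use Attached_in_edges edges_before_subset in auto)
  then show "history v j -` {y} \<inter> space M \<in> sets M"
    using history_eq_iff[OF y] by (simp add: vimage_def Int_def conj_commute)
qed

lemma determined_measurable:
  assumes "determined m v j f" "\<And>p. f p \<in> space N"
  shows "(\<lambda>\<omega>. f (sample \<omega>)) \<in> M \<rightarrow>\<^sub>M N"
proof -
  have "(\<lambda>\<omega>. f (history v j \<omega>)) \<in> M \<rightarrow>\<^sub>M N"
    by (rule measurable_compose[OF history_measurable]) (use assms in auto)
  then show ?thesis by (simp add: determined_history[OF assms(1)])
qed

text \<open>The attachment rule conditions on past attachments only. Independence of graph and flags
  splits the probability into a graph factor, to which the rule applies, and a product over the
  flags; so conditioning on the past flags as well changes nothing.\<close>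

lemma prob_step:
  assumes vj: "(v, j) \<in> new_edges m" and u: "1 \<le> u" "u < v" and y: "y \<in> histories v j"
  shows "prob {\<omega>\<in>space M. history v j \<omega> = y \<and> X (v, j) \<omega> = u \<and> B (Attached (v, 1)) \<omega> \<in> K} =
    attach_prob E m \<delta> (fst y) v j u * prob {\<omega>\<in>space M. B (Attached (v, 1)) \<omega> \<in> K}
      * prob {\<omega>\<in>space M. history v j \<omega> = y}"
proof -
  let ?F = "edges_before m v j" and ?J = "(\<lambda>w. Attached (w, 1)) ` {3..<v}"
  let ?k = "\<lambda>e. {snd y (fst (THE a. e = Attached a))}" and ?e = "Attached (v, 1)"
  have v: "3 \<le> v" using vj by (simp add: new_edges_def)
  have J: "finite ?J" "?J \<subseteq> edges E m" "?e \<notin> ?J" "?e \<in> edges E m"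
    using v by (auto intro: Attached_in_edges)
  have F: "finite ?F" "?F \<subseteq> new_edges m" "(v, j) \<notin> ?F"
    by simp (auto simp: edges_before_def)
  let ?x = "(fst y)((v, j) := u)" and ?k' = "?k(?e := K)"
  have X': "(\<forall>e\<in>insert (v, j) ?F. X e \<omega> = ?x e) \<longleftrightarrow> (\<forall>e\<in>?F. X e \<omega> = fst y e) \<and> X (v, j) \<omega> = u" for \<omega>
    using F(3) by auto
  have B': "(\<forall>e\<in>insert ?e ?J. B e \<omega> \<in> ?k' e) \<longleftrightarrow> (\<forall>e\<in>?J. B e \<omega> \<in> ?k e) \<and> B ?e \<omega> \<in> K" for \<omega>
    using J(3) by auto
  have "prob {\<omega>\<in>space M. history v j \<omega> = y \<and> X (v, j) \<omega> = u \<and> B ?e \<omega> \<in> K} =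
    prob {\<omega>\<in>space M. (\<forall>e\<in>insert (v, j) ?F. X e \<omega> = ?x e) \<and> (\<forall>e\<in>insert ?e ?J. B e \<omega> \<in> ?k' e)}"
    unfolding X' B' history_eq_iff[OF y] by (intro arg_cong[where f = prob]) blast
  also have "\<dots> = prob {\<omega>\<in>space M. \<forall>e\<in>insert (v, j) ?F. X e \<omega> = ?x e} *
      prob {\<omega>\<in>space M. \<forall>e\<in>insert ?e ?J. B e \<omega> \<in> ?k' e}"
    by (rule prob_graph_retained) (use F J vj in auto)
  also have "prob {\<omega>\<in>space M. \<forall>e\<in>insert ?e ?J. B e \<omega> \<in> ?k' e} =
      (\<Prod>e\<in>insert ?e ?J. prob {\<omega>\<in>space M. B e \<omega> \<in> ?k' e})"
    by (rule prob_retained_prod) (use J in auto)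
  also have "\<dots> = prob {\<omega>\<in>space M. B ?e \<omega> \<in> K} * (\<Prod>e\<in>?J. prob {\<omega>\<in>space M. B e \<omega> \<in> ?k e})"
    using J by (subst prod.insert) (auto intro!: prod.cong)
  also have "(\<Prod>e\<in>?J. prob {\<omega>\<in>space M. B e \<omega> \<in> ?k e}) = prob {\<omega>\<in>space M. \<forall>e\<in>?J. B e \<omega> \<in> ?k e}"
    by (rule prob_retained_prod[symmetric]) (use J in auto)
  also have "prob {\<omega>\<in>space M. \<forall>e\<in>insert (v, j) ?F. X e \<omega> = ?x e} =
      attach_prob E m \<delta> (fst y) v j u * prob {\<omega>\<in>space M. \<forall>e\<in>?F. X e \<omega> = fst y e}"
  proof (cases "prob {\<omega>\<in>space M. \<forall>e\<in>?F. X e \<omega> = fst y e} = 0")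
    \<comment> \<open>The rule says nothing about a null conditioning event, but then both sides
      vanish.\<close>
    case True
    have ev: "{\<omega>\<in>space M. \<forall>e\<in>?F. X e \<omega> = fst y e} \<in> events"
      by (intro sets.sets_Collect_finite_All predE X_event) (use F in auto)
    have "prob {\<omega>\<in>space M. \<forall>e\<in>insert (v, j) ?F. X e \<omega> = ?x e} \<le> prob {\<omega>\<in>space M. \<forall>e\<in>?F. X e \<omega> = fst y e}"
      unfolding X' by (rule finite_measure_mono[OF _ ev]) auto
    then show ?thesis using True by (simp add: measure_le_0_iff)
  next
    case False
    then have pos: "prob {\<omega>\<in>space M. \<forall>e\<in>?F. X e \<omega> = fst y e} > 0"
      by (simp add: zero_less_measure_iff)
    have "attach_prob E m \<delta> (fst y) v j u =
        prob {\<omega>\<in>space M. X (v, j) \<omega> = u \<and> (\<forall>e\<in>?F. X e \<omega> = fst y e)} / prob {\<omega>\<in>space M. \<forall>e\<in>?F. X e \<omega> = fst y e}"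
      using attach[OF vj u pos] by (simp add: cond_prob_def)
    then show ?thesis using False unfolding X' by (simp add: conj_commute)
  qed
  finally have *: "prob {\<omega>\<in>space M. history v j \<omega> = y \<and> X (v, j) \<omega> = u \<and> B ?e \<omega> \<in> K} =
    attach_prob E m \<delta> (fst y) v j u * prob {\<omega>\<in>space M. B ?e \<omega> \<in> K} *
     (prob {\<omega>\<in>space M. \<forall>e\<in>?F. X e \<omega> = fst y e} * prob {\<omega>\<in>space M. \<forall>e\<in>?J. B e \<omega> \<in> ?k e})"
    by (simp add: mult_ac)
  have "prob {\<omega>\<in>space M. \<forall>e\<in>?F. X e \<omega> = fst y e} * prob {\<omega>\<in>space M. \<forall>e\<in>?J. B e \<omega> \<in> ?k e} =
     prob {\<omega>\<in>space M. history v j \<omega> = y}"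
    unfolding history_eq_iff[OF y] by (rule prob_graph_retained[symmetric]) (use F J in auto)
  with * show ?thesis by simp
qed

text \<open>For \<open>u\<close> \<ge> 3 all \<open>m\<close> edges of \<open>u\<close> precede
  those of \<open>v\<close>, so its degree is at least \<open>m\<close>, and m + \<delta> is
  positive; the initial vertices are covered by assumption.\<close>

lemma attach_prob_nonneg:
  assumes vj: "(v, j) \<in> new_edges m" and u: "1 \<le> u" "u < v"
  shows "0 \<le> attach_prob E m \<delta> x v j u"
proof -
  have "0 \<le> real (degree_in E x (edges_before m v j) u) + \<delta>"
  proof (cases "u \<le> 2")
    case True
    then have "u \<in> {1, 2}" using u by auto
    moreover have "real (init_degree E u) \<le> real (degree_in E x (edges_before m v j) u)"
      unfolding of_nat_le_iff degree_in_def by simp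
    ultimately show ?thesis using init_weight_nonneg[of u] by linarith
  next
    case False
    have "m = (\<Sum>e\<in>{u} \<times> {1..m}. 1)" by simp
    also have "\<dots> \<le> (\<Sum>e\<in>{u} \<times> {1..m}. of_bool (fst e = u) + of_bool (x e = u))"
      by (intro sum_mono) auto
    also have "\<dots> \<le> (\<Sum>e\<in>edges_before m v j. of_bool (fst e = u) + of_bool (x e = u))"
      using False u vj by (intro sum_mono2[OF finite_edges_before]) (auto simp: edges_before_def new_edges_def)
    finally have "m \<le> degree_in E x (edges_before m v j) u" by (simp add: degree_in_def)
    then have "real m \<le> real (degree_in E x (edges_before m v j) u)" by simp
    then show ?thesis using delta by linarith
  qed
  moreover have "0 \<le> (2 * real m + \<delta>) * (real v - 3)"
    using vj delta by (intro mult_nonneg_nonneg) (auto simp: new_edges_def)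
  ultimately show ?thesis unfolding attach_prob_def using init_weight_pos vj
    by (intro divide_nonneg_nonneg) (auto simp: new_edges_def)
qed

text \<open>The tower property for one attachment: on each history \<open>f\<close> and
  \<open>S\<close> are constant and \<open>prob_step\<close> applies. \<open>K = UNIV\<close>
  ignores the retention of the first edge of \<open>v\<close>, \<open>K = {True}\<close> demands
  it.\<close>

lemma expectation_attach:
  fixes f :: "path \<Rightarrow> real"
  assumes vj: "(v, j) \<in> new_edges m" and f: "determined m v j f" "\<And>p. 0 \<le> f p"
    and S: "determined m v j S" "\<And>p. S p \<subseteq> {1..<v}"
  shows "expectation (\<lambda>\<omega>. f (sample \<omega>) *
      of_bool (X (v, j) \<omega> \<in> S (sample \<omega>) \<and> B (Attached (v, 1)) \<omega> \<in> K)) =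
    prob {\<omega>\<in>space M. B (Attached (v, 1)) \<omega> \<in> K} *
      expectation (\<lambda>\<omega>. f (sample \<omega>) * (\<Sum>u\<in>S (sample \<omega>). attach_prob E m \<delta> (\<lambda>e. X e \<omega>) v j u))"
proof -
  let ?k = "prob {\<omega>\<in>space M. B (Attached (v, 1)) \<omega> \<in> K}"
  define g where "g p = f p * (\<Sum>u\<in>S p. attach_prob E m \<delta> (fst p) v j u)" for p
  have eB: "Attached (v, 1) \<in> edges E m" using vj by (intro Attached_in_edges) (simp add: new_edges_def)
  note [measurable] = determined_measurable[OF f(1), of borel, simplified] X_event[OF vj] B_event[OF eB]
  have finS: "finite (S p)" for p by (rule finite_subset[OF S(2)]) simp
  have g_nn: "0 \<le> g p" for p
    unfolding g_def using f(2) S(2) by (intro mult_nonneg_nonneg sum_nonneg attach_prob_nonneg[OF vj]) fastforce+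
  have g_det: "determined m v j g"
  proof (unfold determined_def, intro allI impI)
    fix p q assume a: "agree m v j p q"
    have "degree_in E (fst p) (edges_before m v j) u = degree_in E (fst q) (edges_before m v j) u" for u
      using a by (simp add: degree_in_def agree_def)
    then show "g p = g q" unfolding g_def attach_prob_def
      using determinedD[OF f(1) a] determinedD[OF S(1) a] by simp
  qed
  note [measurable] = determined_measurable[OF g_det, of borel, simplified]
  let ?A = "\<lambda>\<omega>. X (v, j) \<omega> \<in> S (sample \<omega>) \<and> B (Attached (v, 1)) \<omega> \<in> K"
  have mA[measurable]: "Measurable.pred M ?A"
  proof -
    have A_eq: "?A = (\<lambda>\<omega>. (\<exists>u\<in>{1..<v}. X (v, j) \<omega> = u \<and> u \<in> S (sample \<omega>)) \<and> B (Attached (v, 1)) \<omega> \<in> K)"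
    proof
      fix \<omega> show "?A \<omega> = ((\<exists>u\<in>{1..<v}. X (v, j) \<omega> = u \<and> u \<in> S (sample \<omega>)) \<and> B (Attached (v, 1)) \<omega> \<in> K)"
        using S(2)[of "sample \<omega>"] by auto
    qed
    have [measurable]: "Measurable.pred M (\<lambda>\<omega>. u \<in> S (sample \<omega>))" for u
      by (rule determined_measurable[of v j "\<lambda>p. u \<in> S p"]) (use S(1) in \<open>auto simp: determined_def\<close>)
    show ?thesis unfolding A_eq by measurable
  qed
  let ?Y = "\<lambda>y. history v j -` {y} \<inter> space M"
  have "(\<integral>\<^sup>+\<omega>. ennreal (f (sample \<omega>) * of_bool (?A \<omega>)) \<partial>M) =
    (\<integral>\<^sup>+y. (\<integral>\<^sup>+\<omega>. ennreal (f (sample \<omega>) * of_bool (?A \<omega>)) * indicator (?Y y) \<omega> \<partial>M) \<partial>count_space (histories v j))"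
    by (rule nn_integral_split_countable[OF countable_histories history_measurable]) measurable
  also have "\<dots> = (\<integral>\<^sup>+y. (\<integral>\<^sup>+\<omega>. ennreal (?k * g (sample \<omega>)) * indicator (?Y y) \<omega> \<partial>M) \<partial>count_space (histories v j))"
  proof (rule nn_integral_cong)
    fix y assume "y \<in> space (count_space (histories v j))"
    then have y: "y \<in> histories v j" by simp
    have [measurable]: "?Y y \<in> sets M" using y by (intro measurable_sets[OF history_measurable]) auto
    define Z where "Z u = {\<omega>\<in>space M. history v j \<omega> = y \<and> X (v, j) \<omega> = u \<and> B (Attached (v, 1)) \<omega> \<in> K}" for u
    have Zm[measurable]: "Z u \<in> sets M" for u
    proof -
      have "Z u = ?Y y \<inter> {\<omega>\<in>space M. X (v, j) \<omega> = u} \<inter> {\<omega>\<in>space M. B (Attached (v, 1)) \<omega> \<in> K}"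
        by (auto simp: Z_def)
      then show ?thesis by (simp only:) measurable
    qed
    have "(\<integral>\<^sup>+\<omega>. ennreal (f (sample \<omega>) * of_bool (?A \<omega>)) * indicator (?Y y) \<omega> \<partial>M) =
      (\<integral>\<^sup>+\<omega>. ennreal (f y) * indicator (\<Union>u\<in>S y. Z u) \<omega> \<partial>M)"
      by (intro nn_integral_cong)
        (auto simp: indicator_def Z_def determined_history[OF f(1)] determined_history[OF S(1)])
    also have "\<dots> = ennreal (f y) * emeasure M (\<Union>u\<in>S y. Z u)"
      using finS by (intro nn_integral_cmult_indicator) (auto intro!: sets.finite_UN)
    also have "emeasure M (\<Union>u\<in>S y. Z u) = ennreal (prob (\<Union>u\<in>S y. Z u))"
      by (rule emeasure_eq_measure)
    also have "prob (\<Union>u\<in>S y. Z u) = (\<Sum>u\<in>S y. prob (Z u))"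
      using finS by (intro finite_measure_finite_Union) (auto simp: disjoint_family_on_def Z_def[symmetric], auto simp: Z_def)
    also have "\<dots> = (\<Sum>u\<in>S y. attach_prob E m \<delta> (fst y) v j u * ?k * prob (?Y y))"
    proof (rule sum.cong[OF refl])
      fix u assume "u \<in> S y"
      then have u: "1 \<le> u" "u < v" using S(2)[of y] by auto
      have "?Y y = {\<omega>\<in>space M. history v j \<omega> = y}" by auto
      then show "prob (Z u) = attach_prob E m \<delta> (fst y) v j u * ?k * prob (?Y y)"
        unfolding Z_def using prob_step[OF vj u y] by simp
    qed
    also have "ennreal (f y) * ennreal (\<Sum>u\<in>S y. attach_prob E m \<delta> (fst y) v j u * ?k * prob (?Y y)) = ennreal (?k * g y) * emeasure M (?Y y)"
      unfolding emeasure_eq_measure using f(2) g_nn by (simp add: ennreal_mult'[symmetric] g_def sum_distrib_left sum_distrib_right mult_ac)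
    also have "\<dots> = (\<integral>\<^sup>+\<omega>. ennreal (?k * g y) * indicator (?Y y) \<omega> \<partial>M)"
      by (rule nn_integral_cmult_indicator[symmetric]) measurable
    also have "\<dots> = (\<integral>\<^sup>+\<omega>. ennreal (?k * g (sample \<omega>)) * indicator (?Y y) \<omega> \<partial>M)"
      by (intro nn_integral_cong) (auto simp: indicator_def determined_history[OF g_det])
    finally show "(\<integral>\<^sup>+\<omega>. ennreal (f (sample \<omega>) * of_bool (?A \<omega>)) * indicator (?Y y) \<omega> \<partial>M) =
      (\<integral>\<^sup>+\<omega>. ennreal (?k * g (sample \<omega>)) * indicator (?Y y) \<omega> \<partial>M)" .
  qed
  also have "\<dots> = (\<integral>\<^sup>+\<omega>. ennreal (?k * g (sample \<omega>)) \<partial>M)"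
    by (rule nn_integral_split_countable[OF countable_histories history_measurable, symmetric]) measurable
  finally have nn: "(\<integral>\<^sup>+\<omega>. ennreal (f (sample \<omega>) * of_bool (?A \<omega>)) \<partial>M) =
    (\<integral>\<^sup>+\<omega>. ennreal (?k * g (sample \<omega>)) \<partial>M)" .
  have "expectation (\<lambda>\<omega>. f (sample \<omega>) * of_bool (?A \<omega>)) =
      enn2real (\<integral>\<^sup>+\<omega>. ennreal (f (sample \<omega>) * of_bool (?A \<omega>)) \<partial>M)"
    by (rule integral_eq_nn_integral, measurable) (simp add: f(2))
  also have "\<dots> = expectation (\<lambda>\<omega>. ?k * g (sample \<omega>))"
    unfolding nn by (rule integral_eq_nn_integral[symmetric], measurable) (simp add: g_nn)
  also have "\<dots> = ?k * expectation (\<lambda>\<omega>. g (sample \<omega>))" by simp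
  finally show ?thesis by (simp add: g_def sample_def)
qed

end

section \<open>Weights of clusters\<close>

definition graph_weight ::
  "(nat \<times> nat) list \<Rightarrow> nat \<Rightarrow> real \<Rightarrow> (nat \<times> nat \<Rightarrow> nat) \<Rightarrow> nat \<Rightarrow> nat \<Rightarrow> nat set \<Rightarrow> real" where
  "graph_weight E m \<delta> x v j S = (\<Sum>u\<in>S. real (degree_in E x (edges_before m v j) u) + \<delta>)"

text \<open>\<open>v\<close> lies outside \<open>S\<close>, so its edges count only through their
  targets.\<close>

lemma graph_weight_extend:
  assumes "finite S" "S \<subseteq> {1..<v}" "3 \<le> v" "j \<le> Suc m"
  shows "graph_weight E m \<delta> x v j S =
    graph_weight E m \<delta> x v 1 S + (\<Sum>i\<in>{1..<j}. of_bool (x (v, i) \<in> S))"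
proof -
  have "degree_in E x (edges_before m v j) u =
      degree_in E x (edges_before m v 1) u + (\<Sum>i\<in>{1..<j}. of_bool (x (v, i) = u))" if "u \<in> S" for u
  proof -
    have F: "edges_before m v j = edges_before m v 1 \<union> {v} \<times> {1..<j}"
      using assms by (auto simp: edges_before_def new_edges_def)
    have "(\<Sum>e\<in>edges_before m v j. of_bool (fst e = u) + of_bool (x e = u)) =
       (\<Sum>e\<in>edges_before m v 1. of_bool (fst e = u) + of_bool (x e = u)) +
       (\<Sum>e\<in>{v} \<times> {1..<j}. of_bool (fst e = u) + of_bool (x e = u) :: nat)"
      unfolding F by (rule sum.union_disjoint) (simp, simp, auto simp: edges_before_def)
    also have "(\<Sum>e\<in>{v} \<times> {1..<j}. of_bool (fst e = u) + of_bool (x e = u)) = (\<Sum>i\<in>{1..<j}. of_bool (x (v, i) = u) :: nat)"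
      using that assms
      by (intro sum.reindex_bij_witness[of _ "Pair v" snd]) auto
    finally show ?thesis by (simp add: degree_in_def)
  qed
  then have "graph_weight E m \<delta> x v j S =
      (\<Sum>u\<in>S. (real (degree_in E x (edges_before m v 1) u) + \<delta>) + (\<Sum>i\<in>{1..<j}. of_bool (x (v, i) = u)))"
    unfolding graph_weight_def by (intro sum.cong) auto
  also have "\<dots> = graph_weight E m \<delta> x v 1 S + (\<Sum>u\<in>S. \<Sum>i\<in>{1..<j}. of_bool (x (v, i) = u))"
    unfolding graph_weight_def by (rule sum.distrib)
  also have "(\<Sum>u\<in>S. \<Sum>i\<in>{1..<j}. of_bool (x (v, i) = u) :: real) = (\<Sum>i\<in>{1..<j}. of_bool (x (v, i) \<in> S) :: real)"
  proof (subst sum.swap, rule sum.cong[OF refl])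
    fix i show "(\<Sum>u\<in>S. of_bool (x (v, i) = u)) = (of_bool (x (v, i) \<in> S) :: real)"
      using assms(1) by (simp add: of_bool_def sum.delta')
  qed
  finally show ?thesis .
qed

text \<open>
  The attachment rule does not say that \<open>X (v, j)\<close> is a vertex below \<open>v\<close>; this only
  follows almost surely, because the attachment probabilities sum to 1.
\<close>

definition valid :: "nat \<Rightarrow> nat \<Rightarrow> nat \<Rightarrow> (nat \<times> nat \<Rightarrow> nat) \<Rightarrow> bool" where
  "valid m v j x \<longleftrightarrow> (\<forall>e\<in>edges_before m v j. 1 \<le> x e \<and> x e < fst e)"

lemma valid_mono: "valid m v j x \<Longrightarrow> v' < v \<or> v' = v \<and> j' \<le> j \<Longrightarrow> valid m v' j' x"
  by (auto simp: valid_def edges_before_def)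

definition total_weight :: "(nat \<times> nat) list \<Rightarrow> nat \<Rightarrow> real \<Rightarrow> nat \<Rightarrow> nat \<Rightarrow> real" where
  "total_weight E m \<delta> v j = real (init_degree E 1 + init_degree E 2) + 2 * \<delta>
     + (2 * real m + \<delta>) * (real v - 3) + (real j - 1)"

lemma sum_attach_prob:
  "(\<Sum>u\<in>S. attach_prob E m \<delta> x v j u) = graph_weight E m \<delta> x v j S / total_weight E m \<delta> v j"
  by (simp add: attach_prob_def graph_weight_def total_weight_def sum_divide_distrib)

lemma init_degree_eq_0:
  assumes "set E \<subseteq> {1, 2} \<times> {1, 2}" "3 \<le> u" shows "init_degree E u = 0"
proof -
  have "u \<notin> fst ` set E" "u \<notin> snd ` set E" using assms by fastforce+
  then show ?thesis by (simp add: init_degree_def)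
qed

text \<open>Double counting of the edge ends below \<open>v\<close>.\<close>

lemma graph_weight_all:
  assumes E: "set E \<subseteq> {1, 2} \<times> {1, 2}" and vj: "(v, j) \<in> new_edges m" and x: "valid m v j x"
  shows "graph_weight E m \<delta> x v j {1..<v} = total_weight E m \<delta> v j"
proof -
  let ?F = "edges_before m v j"
  have v: "3 \<le> v" "1 \<le> j" "j \<le> m" using vj by (auto simp: new_edges_def)
  have F: "?F = {3..<v} \<times> {1..m} \<union> {v} \<times> {1..<j}"
    using v by (auto simp: edges_before_def new_edges_def)
  have "(\<Sum>u\<in>{1..<v}. \<Sum>e\<in>?F. of_bool (fst e = u) + of_bool (x e = u)) =
      (\<Sum>e\<in>?F. \<Sum>u\<in>{1..<v}. of_bool (fst e = u) + of_bool (x e = u) :: nat)"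
    by (rule sum.swap)
  \<comment> \<open>An edge of an older vertex has both ends below \<open>v\<close>, an edge of
    \<open>v\<close> only its target; hence the term \<open>j - 1\<close> instead of
    \<open>2 * (j - 1)\<close>.\<close>
  also have "\<dots> = (\<Sum>e\<in>?F. of_bool (fst e < v) + 1)"
  proof (rule sum.cong[OF refl])
    fix e assume e: "e \<in> ?F"
    then have "1 \<le> x e" "x e < fst e" "1 \<le> fst e" "fst e \<le> v"
      using x by (auto simp: valid_def edges_before_def new_edges_def)
    then have "1 \<le> x e" "x e < v" "1 \<le> fst e" by linarith+
    then show "(\<Sum>u\<in>{1..<v}. of_bool (fst e = u) + of_bool (x e = u)) = (of_bool (fst e < v) + 1 :: nat)"
      by (simp add: sum.distrib of_bool_def sum.delta')
  qed
  also have "\<dots> = (\<Sum>e\<in>{3..<v} \<times> {1..m}. of_bool (fst e < v) + 1) + (\<Sum>e\<in>{v} \<times> {1..<j}. of_bool (fst e < v) + 1)"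
    unfolding F by (rule sum.union_disjoint) auto
  also have "\<dots> = (\<Sum>e\<in>{3..<v} \<times> {1..m}. 2) + (\<Sum>e\<in>{v} \<times> {1..<j}. 1)"
    by (intro arg_cong2[where f = "(+)"] sum.cong) auto
  also have "\<dots> = 2 * m * (v - 3) + (j - 1)" by (simp add: card_cartesian_product)
  finally have 1: "(\<Sum>u\<in>{1..<v}. \<Sum>e\<in>?F. of_bool (fst e = u) + of_bool (x e = u)) = 2 * m * (v - 3) + (j - 1)" .
  have "(\<Sum>u\<in>{1..<v}. init_degree E u) = (\<Sum>u\<in>{1, 2}. init_degree E u)"
    using v init_degree_eq_0[OF E] by (intro sum.mono_neutral_right) auto
  then have 2: "(\<Sum>u\<in>{1..<v}. init_degree E u) = init_degree E 1 + init_degree E 2" by simp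
  have "(\<Sum>u\<in>{1..<v}. degree_in E x ?F u) = init_degree E 1 + init_degree E 2 + (2 * m * (v - 3) + (j - 1))"
    unfolding degree_in_def sum.distrib[of "init_degree E"] 1 2 ..
  then have "real (\<Sum>u\<in>{1..<v}. degree_in E x ?F u) =
      real (init_degree E 1 + init_degree E 2) + 2 * real m * (real v - 3) + (real j - 1)"
    using v by (simp add: of_nat_diff)
  then show ?thesis using v
    by (simp add: graph_weight_def total_weight_def sum.distrib of_nat_diff algebra_simps)
qed

lemma degree_of_newest:
  assumes "set E \<subseteq> {1, 2} \<times> {1, 2}" "3 \<le> v" "valid m (Suc v) 1 x"
  shows "degree_in E x (edges_before m (Suc v) 1) v = m"
proof -
  have "(\<Sum>e\<in>edges_before m (Suc v) 1. of_bool (fst e = v) + of_bool (x e = v)) =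
      (\<Sum>e\<in>{v} \<times> {1..m}. 1 :: nat)"
  proof (rule sum.mono_neutral_cong_right)
    show "{v} \<times> {1..m} \<subseteq> edges_before m (Suc v) 1"
      using assms by (auto simp: edges_before_def new_edges_def)
    show "\<forall>e\<in>edges_before m (Suc v) 1 - {v} \<times> {1..m}. of_bool (fst e = v) + of_bool (x e = v) = (0 :: nat)"
    proof
      fix e assume e: "e \<in> edges_before m (Suc v) 1 - {v} \<times> {1..m}"
      then have "fst e < v" by (auto simp: edges_before_def new_edges_def)
      moreover have "x e < fst e" using assms(3) e by (auto simp: valid_def)
      ultimately show "of_bool (fst e = v) + of_bool (x e = v) = (0 :: nat)" by simp
    qed
    show "of_bool (fst e = v) + of_bool (x e = v) = (1 :: nat)" if e: "e \<in> {v} \<times> {1..m}" for e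
    proof -
      have "e \<in> edges_before m (Suc v) 1" using e assms(2) by (auto simp: edges_before_def new_edges_def)
      then have "x e < fst e" using assms(3) by (auto simp: valid_def)
      then show ?thesis using e by auto
    qed
  qed simp
  then show ?thesis using init_degree_eq_0[OF assms(1,2)] by (simp add: degree_in_def)
qed

context pa_setting begin

abbreviation total where "total \<equiv> total_weight E m \<delta>"

lemma slope_pos: "0 < 2 * real m + \<delta>" and mdelta_pos: "0 < real m + \<delta>"
  using delta m_pos by auto

lemma total_pos: "3 \<le> v \<Longrightarrow> 1 \<le> j \<Longrightarrow> 0 < total v j"
proof -
  assume "3 \<le> v" "1 \<le> j"
  then have "0 \<le> (2 * real m + \<delta>) * (real v - 3)" using slope_pos by (intro mult_nonneg_nonneg) auto
  then show ?thesis using init_weight_pos \<open>1 \<le> j\<close> by (simp add: total_weight_def)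
qed

text \<open>Lexicographic induction on \<open>(v, j)\<close>: if all earlier targets are valid, the
  weights below \<open>v\<close> add up to the normalising constant, so the next target lies in
  \<open>{1..<v}\<close> with probability 1.\<close>

lemma valid_AE: "AE \<omega> in M. valid m v j (\<lambda>e. X e \<omega>)"
proof -
  have "AE \<omega> in M. 1 \<le> X (v, j) \<omega> \<and> X (v, j) \<omega> < v" if "(v, j) \<in> new_edges m" for v j
    using that
  proof (induction v arbitrary: j rule: less_induct)
    case (less v)
    note outer = less.IH
    from less.prems show ?case
    proof (induction j rule: less_induct)
      case (less j)
      have v: "3 \<le> v" "1 \<le> j" using less.prems by (auto simp: new_edges_def)
      have "AE \<omega> in M. \<forall>e\<in>edges_before m v j. 1 \<le> X e \<omega> \<and> X e \<omega> < fst e"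
        by (rule AE_finite_allI[OF finite_edges_before])
          (use outer less.IH in \<open>auto simp: edges_before_def\<close>)
      then have AE1: "AE \<omega> in M. valid m v j (\<lambda>e. X e \<omega>)" by (simp add: valid_def)
      have [measurable]: "Measurable.pred M (\<lambda>\<omega>. X (v, j) \<omega> \<in> {1..<v})"
        by (rule X_event[OF less.prems])
      have "prob {\<omega>\<in>space M. X (v, j) \<omega> \<in> {1..<v}} =
          expectation (\<lambda>\<omega>. (1::real) * of_bool (X (v, j) \<omega> \<in> {1..<v} \<and> B (Attached (v, 1)) \<omega> \<in> UNIV))"
      proof -
        have "expectation (\<lambda>\<omega>. (1::real) * of_bool (X (v, j) \<omega> \<in> {1..<v} \<and> B (Attached (v, 1)) \<omega> \<in> UNIV)) =
            expectation (indicator {\<omega>\<in>space M. X (v, j) \<omega> \<in> {1..<v}})"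
          by (rule Bochner_Integration.integral_cong) (auto simp: indicator_def)
        then show ?thesis by (simp add: Int_absorb2 Collect_restrict)
      qed
      also have "\<dots> = prob {\<omega>\<in>space M. B (Attached (v, 1)) \<omega> \<in> UNIV} *
          expectation (\<lambda>\<omega>. 1 * (\<Sum>u\<in>{1..<v}. attach_prob E m \<delta> (\<lambda>e. X e \<omega>) v j u))"
        by (rule expectation_attach[OF less.prems, where f = "\<lambda>_. 1" and S = "\<lambda>_. {1..<v}"]) auto
      also have "expectation (\<lambda>\<omega>. 1 * (\<Sum>u\<in>{1..<v}. attach_prob E m \<delta> (\<lambda>e. X e \<omega>) v j u)) = expectation (\<lambda>\<omega>. 1)"
      proof (rule integral_cong_AE)
        have "determined m v j (\<lambda>p. 1 * (\<Sum>u\<in>{1..<v}. attach_prob E m \<delta> (fst p) v j u))"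
          unfolding determined_def agree_def attach_prob_def degree_in_def by simp
        from determined_measurable[OF this, of borel]
        show "(\<lambda>\<omega>. 1 * (\<Sum>u\<in>{1..<v}. attach_prob E m \<delta> (\<lambda>e. X e \<omega>) v j u)) \<in> borel_measurable M"
          by (simp add: sample_def)
        show "AE \<omega> in M. 1 * (\<Sum>u\<in>{1..<v}. attach_prob E m \<delta> (\<lambda>e. X e \<omega>) v j u) = 1"
          using AE1
        proof eventually_elim
          case (elim \<omega>)
          then show ?case using graph_weight_all[OF init_graph less.prems elim] total_pos[OF v]
            by (simp add: sum_attach_prob)
        qed
      qed simp
      finally have "prob {\<omega>\<in>space M. X (v, j) \<omega> \<in> {1..<v}} = 1" by (simp add: prob_space)
      then have "AE \<omega> in M. \<omega> \<in> {\<omega>\<in>space M. X (v, j) \<omega> \<in> {1..<v}}"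
        by (intro prob_eq_1[THEN iffD1]) measurable
      then show ?case by eventually_elim auto
    qed
  qed
  then show ?thesis unfolding valid_def using edges_before_subset
    by (intro AE_finite_allI[OF finite_edges_before]) (auto simp: edges_before_def)
qed

text \<open>\<open>total 3 1\<close> is the weight of the two initial vertices together.\<close>

definition start_weight :: "nat \<Rightarrow> real" where
  "start_weight u = (if u = 2 then total 3 1 else real m + \<delta>)"

definition hits :: "path \<Rightarrow> nat \<Rightarrow> nat \<Rightarrow> real" where
  "hits p u n = (\<Sum>j\<in>{1..m}. of_bool (fst p (Suc n, j) \<in> cluster p u n))"

definition joins :: "path \<Rightarrow> nat \<Rightarrow> nat \<Rightarrow> real" where
  "joins p u n = of_bool (fst p (Suc n, 1) \<in> cluster p u n \<and> snd p (Suc n))"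

text \<open>Every hit adds one to a degree inside the cluster; a joining vertex also brings its own
  \<open>m\<close> edge ends and its \<delta>.\<close>

definition gain :: "path \<Rightarrow> nat \<Rightarrow> nat \<Rightarrow> real" where
  "gain p u n = hits p u n + (real m + \<delta>) * joins p u n"

text \<open>
  Almost surely this is the sum of \<open>d + \<delta>\<close> over the cluster, see \<open>graph_weight_cluster\<close>.  Defining it
  through its increments makes monotonicity and the bounds on the jumps hold on every path.
\<close>

definition weight :: "path \<Rightarrow> nat \<Rightarrow> nat \<Rightarrow> real" where
  "weight p u n = start_weight u + (\<Sum>k\<in>{u..<n}. gain p u k)"

lemma weight_start [simp]: "weight p u u = start_weight u"
  by (simp add: weight_def)

lemma weight_Suc: "u \<le> n \<Longrightarrow> weight p u (Suc n) = weight p u n + gain p u n"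
  by (simp add: weight_def)

lemma graph_weight_cluster:
  assumes "2 \<le> u" "u \<le> n" "valid m (Suc n) 1 (fst p)"
  shows "graph_weight E m \<delta> (fst p) (Suc n) 1 (cluster p u n) = weight p u n"
  using assms(2,3)
proof (induction n rule: dec_induct)
  case base
  show ?case
  proof (cases "u = 2")
    case True
    have "edges_before m 3 (Suc 0) = {}" by (auto simp: edges_before_def new_edges_def)
    then show ?thesis using True cluster_start[of 2 p]
      by (simp add: root_def graph_weight_def start_weight_def total_weight_def degree_in_def)
  next
    case False
    then show ?thesis using assms(1) base cluster_start[of u p] degree_of_newest[OF init_graph, of u m "fst p"]
      by (simp add: root_def graph_weight_def start_weight_def)
  qed
next
  case (step n)
  have v: "valid m (Suc n) 1 (fst p)" by (rule valid_mono[OF step.prems]) auto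
  let ?S = "cluster p u n" and ?v = "Suc n"
  have S: "?S \<subseteq> {1..<?v}" using cluster_subset[OF assms(1), of p n] by auto
  \<comment> \<open>The moment after the last edge of \<open>Suc n\<close> is the moment before the
    first edge of the next vertex. The old cluster is updated first; \<open>Suc n\<close> itself is
    added to the sum afterwards.\<close>
  have eq: "edges_before m ?v (Suc m) = edges_before m (Suc ?v) 1"
    by (auto simp: edges_before_def new_edges_def)
  have "graph_weight E m \<delta> (fst p) (Suc ?v) 1 ?S = graph_weight E m \<delta> (fst p) ?v (Suc m) ?S"
    by (simp add: graph_weight_def eq)
  also have "\<dots> = weight p u n + hits p u n"
    using graph_weight_extend[OF _ S, of "Suc m" m] step.IH[OF v] step.hyps assms
    by (simp add: hits_def atLeastLessThanSuc_atLeastAtMost)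
  finally have old: "graph_weight E m \<delta> (fst p) (Suc ?v) 1 ?S = weight p u n + hits p u n" .
  have "?v \<notin> ?S" using S by auto
  moreover have "degree_in E (fst p) (edges_before m (Suc ?v) 1) ?v = m"
    using step assms by (intro degree_of_newest[OF init_graph]) auto
  ultimately have "graph_weight E m \<delta> (fst p) (Suc ?v) 1 (insert ?v ?S) = (real m + \<delta>) + (weight p u n + hits p u n)"
    using old unfolding graph_weight_def by (subst sum.insert) auto
  then show ?case using old step.hyps
    by (simp add: cluster_Suc weight_Suc gain_def joins_def)
qed

lemma hits_bounds: "0 \<le> hits p u n" "hits p u n \<le> real m"
proof -
  have "hits p u n \<le> (\<Sum>j\<in>{1..m}. 1)" unfolding hits_def by (intro sum_mono) auto
  then show "hits p u n \<le> real m" by simp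
qed (auto simp: hits_def intro: sum_nonneg)

lemma joins_bounds: "0 \<le> joins p u n" "joins p u n \<le> 1"
  by (auto simp: joins_def)

lemma gain_bounds: "0 \<le> gain p u n" "gain p u n \<le> 2 * real m + \<delta>"
proof -
  have "(real m + \<delta>) * joins p u n \<le> (real m + \<delta>) * 1"
    using joins_bounds mdelta_pos by (intro mult_left_mono) auto
  then show "gain p u n \<le> 2 * real m + \<delta>" using hits_bounds[of p u n] by (simp add: gain_def)
qed (use hits_bounds joins_bounds mdelta_pos in \<open>auto simp: gain_def\<close>)

lemma start_weight_pos: "0 < start_weight u"
  using total_pos[of 3 1] mdelta_pos by (simp add: start_weight_def)

lemma weight_ge_start: "start_weight u \<le> weight p u n"
  using sum_nonneg[of "{u..<n}" "gain p u"] gain_bounds(1) by (simp add: weight_def)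

lemma weight_pos: "0 < weight p u n"
  using weight_ge_start start_weight_pos by (rule less_le_trans[rotated])

lemma weight_mono: "n \<le> n' \<Longrightarrow> weight p u n \<le> weight p u n'"
  unfolding weight_def using gain_bounds by (intro add_left_mono sum_mono2) auto

lemma weight_le: "weight p u n \<le> start_weight u + (2 * real m + \<delta>) * real (n - u)"
proof -
  have "(\<Sum>k\<in>{u..<n}. gain p u k) \<le> (\<Sum>k\<in>{u..<n}. 2 * real m + \<delta>)"
    using gain_bounds by (intro sum_mono) auto
  then show ?thesis by (simp add: weight_def mult.commute)
qed

lemma card_cluster_Suc: "u \<le> n \<Longrightarrow> 2 \<le> u \<Longrightarrow>
    real (card (cluster p u (Suc n))) = real (card (cluster p u n)) + joins p u n"
proof -
  assume "u \<le> n" "2 \<le> u"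
  moreover from this have "Suc n \<notin> cluster p u n" using cluster_subset[of u p n] by auto
  ultimately show ?thesis by (simp add: cluster_Suc joins_def)
qed

lemma card_root_le: "card (root u) \<le> 2"
  by (simp add: root_def card_insert_if)

text \<open>Each member outside the root has contributed m + \<delta> through \<open>joins\<close>;
  the summand 2 covers the root.\<close>

lemma card_cluster_le_weight:
  assumes "2 \<le> u" "u \<le> n"
  shows "real (card (cluster p u n)) \<le> weight p u n / (real m + \<delta>) + 2"
proof -
  have "(real m + \<delta>) * (real (card (cluster p u n)) - 2) \<le> weight p u n" using assms(2)
  proof (induction n rule: dec_induct)
    case base
    have "real (card (cluster p u u)) - 2 \<le> 0"
      using card_root_le[of u] cluster_start[OF assms(1), of p] by simp
    then have "(real m + \<delta>) * (real (card (cluster p u u)) - 2) \<le> 0"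
      using mdelta_pos by (intro mult_nonneg_nonpos) auto
    then show ?case using weight_pos[of p u u] by linarith
  next
    case (step n)
    then show ?case using card_cluster_Suc[OF step.hyps(1) assms(1), of p] hits_bounds[of p u n]
      by (simp add: weight_Suc gain_def algebra_simps)
  qed
  then show ?thesis using mdelta_pos by (simp add: field_simps)
qed

end

section \<open>One step of the weight process\<close>

lemma determinedI: "(\<And>p q. agree m v j p q \<Longrightarrow> f p = f q) \<Longrightarrow> determined m v j f"
  by (simp add: determined_def)

lemma agree_mono: "agree m v j p q \<Longrightarrow> v' < v \<or> v' = v \<and> j' \<le> j \<Longrightarrow> agree m v' j' p q"
  by (auto simp: agree_def edges_before_def)

lemma determined_mono: "determined m v' j' f \<Longrightarrow> v' < v \<or> v' = v \<and> j' \<le> j \<Longrightarrow> determined m v j f"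
  by (meson agree_mono determinedI determinedD)

text \<open>The state after \<open>n\<close> vertices is known just before the first edge of
  \<open>Suc n\<close>; hence the index pair \<open>(Suc n, 1)\<close> for time \<open>n\<close>
  from here on.\<close>

lemma cluster_agree:
  assumes "1 \<le> m" "2 \<le> u" "agree m (Suc n) 1 p q" shows "cluster p u n = cluster q u n"
  using assms(3)
proof (induction n)
  case (Suc n)
  have IH: "cluster p u n = cluster q u n"
    by (rule Suc.IH, rule agree_mono[OF Suc.prems]) simp
  show ?case
  proof (cases "u \<le> n")
    case True
    have "(Suc n, 1) \<in> edges_before m (Suc (Suc n)) 1"
      using True assms by (auto simp: edges_before_def new_edges_def)
    then have "fst p (Suc n, 1) = fst q (Suc n, 1)" "snd p (Suc n) = snd q (Suc n)"
      using Suc.prems True assms by (auto simp: agree_def)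
    then show ?thesis using IH True by (simp add: cluster_Suc)
  next
    case False
    then consider "Suc n < u" | "Suc n = u" by linarith
    then show ?thesis using assms cluster_start[of u p] cluster_start[of u q]
      by cases (auto simp: cluster_before)
  qed
qed simp

context pa_setting begin

lemma gain_agree:
  assumes "2 \<le> u" "u \<le> n" "agree m (Suc (Suc n)) 1 p q"
  shows "gain p u n = gain q u n"
proof -
  have a: "agree m (Suc n) 1 p q" by (rule agree_mono[OF assms(3)]) simp
  have "(Suc n, j) \<in> edges_before m (Suc (Suc n)) 1" if "j \<in> {1..m}" for j
    using that assms by (auto simp: edges_before_def new_edges_def)
  then have e: "fst p (Suc n, j) = fst q (Suc n, j)" if "j \<in> {1..m}" for j
    using that assms(3) by (auto simp: agree_def)
  have "fst p (Suc n, 1) = fst q (Suc n, 1)" by (rule e) (use m_pos in auto)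
  moreover have "snd p (Suc n) = snd q (Suc n)" using assms by (auto simp: agree_def)
  moreover have "hits p u n = hits q u n"
    unfolding hits_def using e cluster_agree[OF m_pos assms(1) a] by (intro sum.cong) auto
  ultimately show ?thesis
    using cluster_agree[OF m_pos assms(1) a] by (simp add: gain_def joins_def)
qed

lemma weight_agree:
  assumes "2 \<le> u" "agree m (Suc n) 1 p q" shows "weight p u n = weight q u n"
proof -
  have "gain p u k = gain q u k" if "k \<in> {u..<n}" for k
    using that by (intro gain_agree[OF assms(1)] agree_mono[OF assms(2)]) auto
  then show ?thesis by (simp add: weight_def)
qed

abbreviation mean :: "(path \<Rightarrow> real) \<Rightarrow> real" where
  "mean f \<equiv> expectation (\<lambda>\<omega>. f (sample \<omega>))"

lemma determined_borel: "determined m v j f \<Longrightarrow> (\<lambda>\<omega>. f (sample \<omega>) :: real) \<in> borel_measurable M"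
  by (rule determined_measurable) auto

lemma determined_integrable:
  assumes "determined m v j f" "\<And>p. \<bar>f p\<bar> \<le> C"
  shows "integrable M (\<lambda>\<omega>. f (sample \<omega>) :: real)"
  by (rule integrable_const_bound[of _ C]) (use assms determined_borel in auto)

text \<open>The degrees on the right include the first \<open>j - 1\<close> edges of
  \<open>Suc n\<close>, so this is not yet \<open>weight p u n\<close>;
  \<open>graph_weight_bounds_AE\<close> compares the two.\<close>

lemma mean_hit:
  assumes f: "determined m (Suc n) 1 f" "\<And>p. 0 \<le> f p" and u: "2 \<le> u" "u \<le> n" and j: "1 \<le> j" "j \<le> m"
  shows "mean (\<lambda>p. f p * of_bool (fst p (Suc n, j) \<in> cluster p u n)) =
      mean (\<lambda>p. f p * graph_weight E m \<delta> (fst p) (Suc n) j (cluster p u n)) / total (Suc n) j"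
    and "mean (\<lambda>p. f p * of_bool (fst p (Suc n, j) \<in> cluster p u n \<and> snd p (Suc n))) =
      \<pi> * mean (\<lambda>p. f p * graph_weight E m \<delta> (fst p) (Suc n) j (cluster p u n)) / total (Suc n) j"
proof -
  have vj: "(Suc n, j) \<in> new_edges m" using u j by (simp add: new_edges_def)
  have f': "determined m (Suc n) j f" by (rule determined_mono[OF f(1)]) (use j in simp)
  have S: "determined m (Suc n) j (\<lambda>p. cluster p u n)" "\<And>p. cluster p u n \<subseteq> {1..<Suc n}"
  proof -
    show "determined m (Suc n) j (\<lambda>p. cluster p u n)"
      by (rule determined_mono[of m "Suc n" 1], rule determinedI, rule cluster_agree[OF m_pos u(1)]) (use j in simp)+
    show "\<And>p. cluster p u n \<subseteq> {1..<Suc n}"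
      using cluster_subset[OF u(1)] by (simp only: atLeastLessThanSuc_atLeastAtMost)
  qed
  have r: "prob {\<omega>\<in>space M. B (Attached (Suc n, 1)) \<omega> \<in> {True}} = \<pi>"
    using retain_prob[OF Attached_in_edges(1)[of "Suc n"]] u by simp
  have eq: "mean (\<lambda>p. f p * (\<Sum>w\<in>cluster p u n. attach_prob E m \<delta> (fst p) (Suc n) j w)) =
      mean (\<lambda>p. f p * graph_weight E m \<delta> (fst p) (Suc n) j (cluster p u n)) / total (Suc n) j"
    by (simp add: sum_attach_prob)
  show "mean (\<lambda>p. f p * of_bool (fst p (Suc n, j) \<in> cluster p u n)) =
      mean (\<lambda>p. f p * graph_weight E m \<delta> (fst p) (Suc n) j (cluster p u n)) / total (Suc n) j"
    using expectation_attach[OF vj f' f(2) S, of UNIV] eq by (simp add: sample_def prob_space)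
  show "mean (\<lambda>p. f p * of_bool (fst p (Suc n, j) \<in> cluster p u n \<and> snd p (Suc n))) =
      \<pi> * mean (\<lambda>p. f p * graph_weight E m \<delta> (fst p) (Suc n) j (cluster p u n)) / total (Suc n) j"
    using expectation_attach[OF vj f' f(2) S, of "{True}"] eq unfolding r by (simp add: sample_def)
qed

text \<open>During the arrival of \<open>Suc n\<close> each earlier edge raises the weight of the
  old cluster by at most 1. For \<open>j = 1\<close> the two bounds coincide.\<close>

lemma graph_weight_bounds_AE:
  assumes u: "2 \<le> u" "u \<le> n" and j: "1 \<le> j" "j \<le> m"
  shows "AE \<omega> in M. weight (sample \<omega>) u n \<le> graph_weight E m \<delta> (fst (sample \<omega>)) (Suc n) j (cluster (sample \<omega>) u n)
    \<and> graph_weight E m \<delta> (fst (sample \<omega>)) (Suc n) j (cluster (sample \<omega>) u n) \<le> weight (sample \<omega>) u n + real (j - 1)"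
  using valid_AE[of "Suc n" 1]
proof eventually_elim
  case (elim \<omega>)
  let ?p = "sample \<omega>"
  have v: "valid m (Suc n) 1 (fst ?p)" using elim by (simp add: sample_def)
  have S: "cluster ?p u n \<subseteq> {1..<Suc n}" using cluster_subset[OF u(1), of ?p n] by auto
  have "graph_weight E m \<delta> (fst ?p) (Suc n) j (cluster ?p u n) =
      weight ?p u n + (\<Sum>i\<in>{1..<j}. of_bool (fst ?p (Suc n, i) \<in> cluster ?p u n))"
    using graph_weight_extend[OF _ S, of j m] graph_weight_cluster[OF u v] u j by simp
  moreover have "0 \<le> (\<Sum>i\<in>{1..<j}. of_bool (fst ?p (Suc n, i) \<in> cluster ?p u n) :: real)"
    by (intro sum_nonneg) auto
  moreover have "(\<Sum>i\<in>{1..<j}. of_bool (fst ?p (Suc n, i) \<in> cluster ?p u n) :: real) \<le> (\<Sum>i\<in>{1..<j}. 1)"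
    by (intro sum_mono) auto
  ultimately show ?case by simp
qed

lemma weight_bounded: "\<bar>weight p u n\<bar> \<le> start_weight u + (2 * real m + \<delta>) * real (n - u)"
  using weight_le[of p u n] weight_pos[of p u n] by simp

lemma weight_determined: "2 \<le> u \<Longrightarrow> n \<le> n' \<Longrightarrow> determined m (Suc n') 1 (\<lambda>p. h (weight p u n))"
  by (rule determined_mono[of m "Suc n" 1], rule determinedI, rule arg_cong[where f = h], rule weight_agree) auto

lemma determined_mult: "determined m v j f \<Longrightarrow> determined m v j g \<Longrightarrow> determined m v j (\<lambda>p. f p * g p)"
  unfolding determined_def by fastforce

section \<open>Conditional means, tested against bounded nonnegative adapted
  \<open>f\<close>\<close>

context
  fixes f :: "path \<Rightarrow> real" and u n :: nat and C :: real
  assumes f: "determined m (Suc n) 1 f" and f0: "\<And>p. 0 \<le> f p" and fC: "\<And>p. f p \<le> C"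
    and u: "2 \<le> u" "u \<le> n"
begin

lemma weighted_integrable:
  "integrable M (\<lambda>\<omega>. f (sample \<omega>) * weight (sample \<omega>) u n)" "integrable M (\<lambda>\<omega>. f (sample \<omega>))"
proof -
  show "integrable M (\<lambda>\<omega>. f (sample \<omega>) * weight (sample \<omega>) u n)"
  proof (rule determined_integrable)
    show "determined m (Suc n) 1 (\<lambda>p. f p * weight p u n)"
      by (rule determined_mult[OF f weight_determined[OF u(1) order.refl]])
    show "\<bar>f p * weight p u n\<bar> \<le> C * (start_weight u + (2 * real m + \<delta>) * real (n - u))" for p
      unfolding abs_mult using f0[of p] fC[of p] by (intro mult_mono weight_bounded) auto
  qed
  show "integrable M (\<lambda>\<omega>. f (sample \<omega>))"
    by (rule determined_integrable[OF f, of C]) (use f0 fC in auto)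
qed

text \<open>The third claim is an equation because no edge of \<open>Suc n\<close> precedes its
  first one.\<close>

lemma mean_hit_bounds:
  assumes j: "1 \<le> j" "j \<le> m"
  shows "mean (\<lambda>p. f p * weight p u n) / total (Suc n) j \<le> mean (\<lambda>p. f p * of_bool (fst p (Suc n, j) \<in> cluster p u n))"
    and "mean (\<lambda>p. f p * of_bool (fst p (Suc n, j) \<in> cluster p u n)) \<le>
      mean (\<lambda>p. f p * (weight p u n + real (j - 1))) / total (Suc n) j"
    and "mean (\<lambda>p. f p * joins p u n) = \<pi> * mean (\<lambda>p. f p * weight p u n) / total (Suc n) 1"
proof -
  let ?g = "\<lambda>j p. graph_weight E m \<delta> (fst p) (Suc n) j (cluster p u n)"
  have T: "0 < total (Suc n) j" using total_pos u j by simp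
  have det: "determined m (Suc n) j (\<lambda>p. f p * ?g j p)" if "1 \<le> j" for j
  proof (rule determinedI)
    fix p q assume a: "agree m (Suc n) j p q"
    have a1: "agree m (Suc n) 1 p q" by (rule agree_mono[OF a]) (use that in simp)
    have "degree_in E (fst p) (edges_before m (Suc n) j) w = degree_in E (fst q) (edges_before m (Suc n) j) w" for w
      using a by (simp add: degree_in_def agree_def)
    then show "f p * ?g j p = f q * ?g j q"
      using determinedD[OF f a1] cluster_agree[OF m_pos u(1) a1] by (simp add: graph_weight_def)
  qed
  have int_g: "integrable M (\<lambda>\<omega>. f (sample \<omega>) * ?g j (sample \<omega>))"
  proof (rule Bochner_Integration.integrable_bound)
    show "integrable M (\<lambda>\<omega>. f (sample \<omega>) * weight (sample \<omega>) u n + f (sample \<omega>) * real (j - 1))"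
      using weighted_integrable by simp
    show "(\<lambda>\<omega>. f (sample \<omega>) * ?g j (sample \<omega>)) \<in> borel_measurable M"
      by (rule determined_borel[OF det]) (use j in simp)
    show "AE \<omega> in M. norm (f (sample \<omega>) * ?g j (sample \<omega>)) \<le>
        norm (f (sample \<omega>) * weight (sample \<omega>) u n + f (sample \<omega>) * real (j - 1))"
      using graph_weight_bounds_AE[OF u j]
    proof eventually_elim
      case (elim \<omega>)
      have "0 \<le> weight (sample \<omega>) u n" using weight_pos less_imp_le by blast
      then show ?case using elim f0[of "sample \<omega>"]
        by (auto simp: abs_mult distrib_left[symmetric] intro!: mult_left_mono)
    qed
  qed
  show "mean (\<lambda>p. f p * weight p u n) / total (Suc n) j \<le> mean (\<lambda>p. f p * of_bool (fst p (Suc n, j) \<in> cluster p u n))"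
  proof -
    have "mean (\<lambda>p. f p * weight p u n) \<le> mean (\<lambda>p. f p * ?g j p)"
    proof (rule integral_mono_AE[OF weighted_integrable(1) int_g])
      show "AE \<omega> in M. f (sample \<omega>) * weight (sample \<omega>) u n \<le> f (sample \<omega>) * ?g j (sample \<omega>)"
        using graph_weight_bounds_AE[OF u j] by eventually_elim (intro mult_left_mono f0, simp)
    qed
    then show ?thesis using T unfolding mean_hit(1)[OF f f0 u j] by (intro divide_right_mono) auto
  qed
  show "mean (\<lambda>p. f p * of_bool (fst p (Suc n, j) \<in> cluster p u n)) \<le>
      mean (\<lambda>p. f p * (weight p u n + real (j - 1))) / total (Suc n) j"
  proof -
    have "mean (\<lambda>p. f p * ?g j p) \<le> mean (\<lambda>p. f p * (weight p u n + real (j - 1)))"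
    proof (rule integral_mono_AE[OF int_g])
      show "integrable M (\<lambda>\<omega>. f (sample \<omega>) * (weight (sample \<omega>) u n + real (j - 1)))"
        using weighted_integrable by (simp add: distrib_left)
      show "AE \<omega> in M. f (sample \<omega>) * ?g j (sample \<omega>) \<le> f (sample \<omega>) * (weight (sample \<omega>) u n + real (j - 1))"
        using graph_weight_bounds_AE[OF u j] by eventually_elim (intro mult_left_mono f0, simp)
    qed
    then show ?thesis using T unfolding mean_hit(1)[OF f f0 u j] by (intro divide_right_mono) auto
  qed
  have "AE \<omega> in M. f (sample \<omega>) * ?g 1 (sample \<omega>) = f (sample \<omega>) * weight (sample \<omega>) u n"
    using graph_weight_bounds_AE[OF u, of 1] m_pos by auto
  then have "mean (\<lambda>p. f p * ?g 1 p) = mean (\<lambda>p. f p * weight p u n)"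
    by (intro integral_cong_AE determined_borel[OF det] borel_measurable_integrable[OF weighted_integrable(1)]) auto
  then show "mean (\<lambda>p. f p * joins p u n) = \<pi> * mean (\<lambda>p. f p * weight p u n) / total (Suc n) 1"
    using mean_hit(2)[OF f f0 u, of 1] m_pos by (simp add: joins_def)
qed

end

definition step_gain :: real where "step_gain = real m + \<pi> * (real m + \<delta>)"

text \<open>The total is taken at \<open>j = m\<close>, the largest of the \<open>m\<close>
  normalisations, so this bounds the relative drift of the weight from below, with equality for
  \<open>m = 1\<close>.\<close>

definition ratio :: "nat \<Rightarrow> real" where "ratio n = step_gain / total (Suc n) m"

lemma total_mono: "j \<le> j' \<Longrightarrow> total v j \<le> total v j'"
  by (simp add: total_weight_def)

lemma step_gain_pos: "0 < step_gain"
  using m_pos mdelta_pos pi_pos by (simp add: step_gain_def add_pos_pos)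

lemma ratio_pos: "2 \<le> n \<Longrightarrow> 0 < ratio n"
  using step_gain_pos total_pos[of "Suc n" m] m_pos by (simp add: ratio_def)

context
  fixes f :: "path \<Rightarrow> real" and u n :: nat and C :: real
  assumes f: "determined m (Suc n) 1 f" and f0: "\<And>p. 0 \<le> f p" and fC: "\<And>p. f p \<le> C"
    and u: "2 \<le> u" "u \<le> n"
begin

lemma hit_borel:
  assumes j: "1 \<le> j" "j \<le> m"
  shows "(\<lambda>\<omega>. of_bool (fst (sample \<omega>) (Suc n, j) \<in> cluster (sample \<omega>) u n) :: real) \<in> borel_measurable M"
proof (rule determined_borel[of "Suc (Suc n)" 1], rule determinedI)
  fix p q :: path assume a: "agree m (Suc (Suc n)) 1 p q"
  have "fst p (Suc n, j) = fst q (Suc n, j)"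
    using a j u by (auto simp: agree_def edges_before_def new_edges_def)
  moreover have "cluster p u n = cluster q u n"
    by (rule cluster_agree[OF m_pos u(1) agree_mono[OF a]]) simp
  ultimately show "of_bool (fst p (Suc n, j) \<in> cluster p u n) = (of_bool (fst q (Suc n, j) \<in> cluster q u n) :: real)"
    by simp
qed

lemma joins_borel: "(\<lambda>\<omega>. joins (sample \<omega>) u n) \<in> borel_measurable M"
proof (rule determined_borel[of "Suc (Suc n)" 1], rule determinedI)
  fix p q assume a: "agree m (Suc (Suc n)) 1 p q"
  have "fst p (Suc n, 1) = fst q (Suc n, 1)" "snd p (Suc n) = snd q (Suc n)"
    using a m_pos u by (auto simp: agree_def edges_before_def new_edges_def)
  moreover have "cluster p u n = cluster q u n"
    by (rule cluster_agree[OF m_pos u(1) agree_mono[OF a]]) simp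
  ultimately show "joins p u n = joins q u n" by (simp add: joins_def)
qed

lemma step_integrable:
  "1 \<le> j \<Longrightarrow> j \<le> m \<Longrightarrow>
    integrable M (\<lambda>\<omega>. f (sample \<omega>) * of_bool (fst (sample \<omega>) (Suc n, j) \<in> cluster (sample \<omega>) u n))"
  "integrable M (\<lambda>\<omega>. f (sample \<omega>) * joins (sample \<omega>) u n)"
proof -
  have C: "0 \<le> C" using f0 fC order_trans by blast
  have b: "norm (f p) \<le> C" for p using f0[of p] fC[of p] by simp
  note [measurable] = determined_borel[OF f]
  show "integrable M (\<lambda>\<omega>. f (sample \<omega>) * of_bool (fst (sample \<omega>) (Suc n, j) \<in> cluster (sample \<omega>) u n))"
    if "1 \<le> j" "j \<le> m"
    by (rule integrable_const_bound[of _ C])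
       (use borel_measurable_times[OF determined_borel[OF f] hit_borel[OF that]] b C in \<open>auto simp: norm_mult\<close>)
  show "integrable M (\<lambda>\<omega>. f (sample \<omega>) * joins (sample \<omega>) u n)"
    by (rule integrable_const_bound[of _ C])
       (use borel_measurable_times[OF determined_borel[OF f] joins_borel] b C in
        \<open>auto simp: norm_mult joins_def[of _ u n]\<close>)
qed

lemma hits_integrable: "integrable M (\<lambda>\<omega>. f (sample \<omega>) * hits (sample \<omega>) u n)"
  unfolding hits_def sum_distrib_left
  by (rule Bochner_Integration.integrable_sum, rule step_integrable(1)) auto

lemma gain_integrable: "integrable M (\<lambda>\<omega>. f (sample \<omega>) * gain (sample \<omega>) u n)"
proof -
  have "integrable M (\<lambda>\<omega>. f (sample \<omega>) * hits (sample \<omega>) u n + (real m + \<delta>) * (f (sample \<omega>) * joins (sample \<omega>) u n))"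
    using hits_integrable step_integrable(2) by simp
  then show ?thesis by (simp add: gain_def algebra_simps)
qed

lemma mean_hits: "mean (\<lambda>p. f p * hits p u n) =
    (\<Sum>j\<in>{1..m}. mean (\<lambda>p. f p * of_bool (fst p (Suc n, j) \<in> cluster p u n)))"
  unfolding hits_def sum_distrib_left
  by (rule Bochner_Integration.integral_sum, rule step_integrable(1)) auto

lemma mean_gain: "mean (\<lambda>p. f p * gain p u n) =
    mean (\<lambda>p. f p * hits p u n) + (real m + \<delta>) * mean (\<lambda>p. f p * joins p u n)"
proof -
  have "mean (\<lambda>p. f p * gain p u n) = mean (\<lambda>p. f p * hits p u n + (real m + \<delta>) * (f p * joins p u n))"
    by (simp add: gain_def algebra_simps)
  then show ?thesis using hits_integrable step_integrable(2) by simp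
qed

lemma mean_weighted_nonneg: "0 \<le> mean (\<lambda>p. f p * weight p u n)"
  using f0 weight_pos by (intro Bochner_Integration.integral_nonneg) (simp add: less_imp_le)

lemma mean_gain_ge: "ratio n * mean (\<lambda>p. f p * weight p u n) \<le> mean (\<lambda>p. f p * gain p u n)"
proof -
  let ?W = "mean (\<lambda>p. f p * weight p u n)"
  have T: "0 < total (Suc n) j" if "1 \<le> j" for j using total_pos u that by simp
  have "(\<Sum>j\<in>{1..m}. ?W / total (Suc n) m) \<le> (\<Sum>j\<in>{1..m}. mean (\<lambda>p. f p * of_bool (fst p (Suc n, j) \<in> cluster p u n)))"
  proof (rule sum_mono)
    fix j assume j: "j \<in> {1..m}"
    have "?W / total (Suc n) m \<le> ?W / total (Suc n) j"
      using j mean_weighted_nonneg T[of j] total_mono[of j m "Suc n"] by (intro divide_left_mono mult_pos_pos) auto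
    then show "?W / total (Suc n) m \<le> mean (\<lambda>p. f p * of_bool (fst p (Suc n, j) \<in> cluster p u n))"
      using mean_hit_bounds(1)[OF f f0 fC u, of j] j by simp
  qed
  then have "real m * (?W / total (Suc n) m) \<le> mean (\<lambda>p. f p * hits p u n)" by (simp add: mean_hits)
  moreover have "(real m + \<delta>) * (\<pi> * ?W / total (Suc n) m) \<le> (real m + \<delta>) * mean (\<lambda>p. f p * joins p u n)"
    unfolding mean_hit_bounds(3)[OF f f0 fC u order.refl m_pos]
    using mean_weighted_nonneg T[of 1] total_mono[of 1 m "Suc n"] mdelta_pos pi_pos m_pos
    by (intro mult_left_mono divide_left_mono mult_nonneg_nonneg mult_pos_pos) auto
  ultimately show ?thesis unfolding mean_gain ratio_def step_gain_def
    by (simp add: add_divide_distrib algebra_simps)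
qed

text \<open>For \<open>m = 1\<close> the lower and upper bounds of \<open>mean_hit_bounds\<close>
  agree.\<close>

lemma mean_gain_eq:
  assumes "m = 1" shows "mean (\<lambda>p. f p * gain p u n) = ratio n * mean (\<lambda>p. f p * weight p u n)"
proof -
  have "mean (\<lambda>p. f p * hits p u n) = mean (\<lambda>p. f p * weight p u n) / total (Suc n) 1"
    unfolding mean_hits using mean_hit_bounds(1,2)[OF f f0 fC u, of 1] assms by simp
  then show ?thesis unfolding mean_gain mean_hit_bounds(3)[OF f f0 fC u order.refl m_pos]
    unfolding ratio_def step_gain_def using assms by (simp add: add_divide_distrib algebra_simps)
qed

text \<open>The surplus \<open>j - 1\<close> is below \<open>m\<close>, and \<open>m\<close> is at
  most \<open>m / d\<close> times the weight, which never falls below \<open>d\<close>. The crude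
  constant only enters the choice of \<open>b\<close> in \<open>size_vs_weight\<close>.\<close>

lemma mean_hits_le:
  assumes d: "0 < d" "d \<le> start_weight u"
  shows "mean (\<lambda>p. f p * hits p u n) \<le> real m * (1 + real m / d) * (mean (\<lambda>p. f p * weight p u n) / total (Suc n) 1)"
proof -
  let ?W = "mean (\<lambda>p. f p * weight p u n)"
  have T: "0 < total (Suc n) j" if "1 \<le> j" for j using total_pos u that by simp
  have "mean (\<lambda>p. f p * hits p u n) \<le> (\<Sum>j\<in>{1..m}. (1 + real m / d) * (?W / total (Suc n) 1))"
    unfolding mean_hits
  proof (rule sum_mono)
    fix j assume j: "j \<in> {1..m}"
    have le: "f p * (weight p u n + real (j - 1)) \<le> (1 + real m / d) * (f p * weight p u n)" for p
    proof -
      have "d \<le> weight p u n" using d weight_ge_start[of u p n] by simp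
      then have "real m \<le> real m / d * weight p u n" using mult_left_mono[of d "weight p u n" "real m"] d by (simp add: field_simps)
      then have "weight p u n + real (j - 1) \<le> (1 + real m / d) * weight p u n"
        using j by (simp add: distrib_right of_nat_diff)
      from mult_left_mono[OF this f0] show ?thesis by (simp add: mult_ac)
    qed
    have "mean (\<lambda>p. f p * (weight p u n + real (j - 1))) \<le> mean (\<lambda>p. (1 + real m / d) * (f p * weight p u n))"
      using weighted_integrable[OF f f0 fC u] le by (intro integral_mono) (auto simp: distrib_left)
    then have "mean (\<lambda>p. f p * (weight p u n + real (j - 1))) / total (Suc n) j \<le> (1 + real m / d) * ?W / total (Suc n) j"
      using T[of j] j by (intro divide_right_mono) auto
    also have "\<dots> \<le> (1 + real m / d) * ?W / total (Suc n) 1"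
      using mean_weighted_nonneg T[of j] T[of 1] total_mono[of 1 j "Suc n"] j d
      by (intro divide_left_mono mult_nonneg_nonneg mult_pos_pos) auto
    finally show "mean (\<lambda>p. f p * of_bool (fst p (Suc n, j) \<in> cluster p u n)) \<le> (1 + real m / d) * (?W / total (Suc n) 1)"
      using mean_hit_bounds(2)[OF f f0 fC u, of j] j by simp
  qed
  then show ?thesis by simp
qed

end

end

section \<open>Supermartingales\<close>

lemma power_upper_step:
  fixes w g s :: real
  assumes w: "0 < w" and g: "0 \<le> g" "g \<le> s"
  shows "(w + g + real k * s) ^ k \<le> (w + real k * s) ^ k * (1 + real k * g / w)"
proof (cases "k = 0")
  case False
  define a where "a = w + real k * s"
  define y where "y = g / a"
  \<comment> \<open>Here the shift by \<open>k s\<close> pays off: even after subtracting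
    \<open>k g\<close> at least \<open>w\<close> is left, so the final bound is linear in
    \<open>g / w\<close>.\<close>
  have a: "0 < a" "a - real k * g \<ge> w"
    using w g mult_left_mono[OF g(2), of "real k"] by (auto simp: a_def intro: add_pos_nonneg)
  have "g \<le> real k * g" using False g by (simp add: mult_le_cancel_right1)
  then have y: "0 \<le> y" "y \<le> 1" "0 < 1 - real k * y" using a w g by (auto simp: y_def field_simps)
  \<comment> \<open>Bernoulli for \<open>1 - y\<close>, together with (1 + y)(1 - y) \<le> 1, bounds
    the \<open>k\<close>-th power of \<open>1 + y\<close> from above by 1 / (1 - k y).\<close>
  have "1 - real k * y \<le> (1 - y) ^ k" using Bernoulli_inequality[of "- y" k] y by simp
  then have "(1 + y) ^ k * (1 - real k * y) \<le> (1 + y) ^ k * (1 - y) ^ k"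
    using y by (intro mult_left_mono) auto
  also have "\<dots> = (1 - y * y) ^ k" by (simp add: power_mult_distrib[symmetric] algebra_simps)
  also have "\<dots> \<le> 1" using y by (intro power_le_one) (auto intro: mult_le_one)
  finally have "(1 + y) ^ k \<le> 1 / (1 - real k * y)" using y by (simp add: field_simps)
  also have "\<dots> = 1 + real k * g / (a - real k * g)" using a w by (simp add: y_def field_simps)
  also have "\<dots> \<le> 1 + real k * g / w" using a w g by (intro add_left_mono divide_left_mono) auto
  finally have "a ^ k * (1 + y) ^ k \<le> a ^ k * (1 + real k * g / w)" using a by (intro mult_left_mono) auto
  moreover have "a * (1 + y) = w + g + real k * s" using a by (simp add: y_def a_def field_simps)
  ultimately show ?thesis by (simp add: power_mult_distrib[symmetric] a_def)
qed simp

text \<open>Mirror image of \<open>power_upper_step\<close>: after the shift downwards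
  \<open>a + k g\<close> is at most \<open>w\<close>, and Bernoulli applies to \<open>1 + y\<close>
  directly.\<close>

lemma power_lower_step:
  fixes w g s :: real
  assumes w: "real k * s < w" and g: "0 \<le> g" "g \<le> s"
  shows "(1 / (w + g - real k * s)) ^ k \<le> (1 / (w - real k * s)) ^ k * (1 - real k * g / w)"
proof -
  define a where "a = w - real k * s"
  define y where "y = g / a"
  have a: "0 < a" "a + real k * g \<le> w" "a \<le> w" using w g by (auto simp: a_def mult_left_mono)
  have y: "0 \<le> y" using a g by (simp add: y_def)
  have "1 + real k * y \<le> (1 + y) ^ k" using y by (intro Bernoulli_inequality) simp
  moreover have "0 < 1 + real k * y" using y by (simp add: add_pos_nonneg)
  ultimately have "1 / (1 + y) ^ k \<le> 1 / (1 + real k * y)" using y by (intro divide_left_mono) auto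
  also have "\<dots> = a / (a + real k * g)"
  proof -
    have "a + real k * g = a * (1 + real k * y)" using a by (simp add: y_def algebra_simps)
    then show ?thesis using a by simp
  qed
  also have "\<dots> = 1 - real k * g / (a + real k * g)"
  proof -
    have "a + real k * g \<noteq> 0" using a g by (simp add: add_pos_nonneg less_imp_neq[symmetric])
    then show ?thesis using diff_divide_distrib[of "a + real k * g" "real k * g" "a + real k * g"] by simp
  qed
  also have "\<dots> \<le> 1 - real k * g / w"
  proof -
    have "0 < a + real k * g" using a g by (simp add: add_pos_nonneg)
    then show ?thesis using a g by (intro diff_left_mono divide_left_mono mult_pos_pos mult_nonneg_nonneg) auto
  qed
  finally have "(1 / a) ^ k * (1 / (1 + y) ^ k) \<le> (1 / a) ^ k * (1 - real k * g / w)"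
    using a by (intro mult_left_mono) auto
  moreover have "(1 / a) * (1 / (1 + y)) = 1 / (w + g - real k * s)"
  proof -
    have "a * (1 + y) = a + g" using a by (simp add: y_def algebra_simps)
    then have "a * (1 + y) = w + g - real k * s" by (simp add: a_def)
    moreover have "(1 / a) * (1 / (1 + y)) = 1 / (a * (1 + y))" by simp
    ultimately show ?thesis by (simp only:)
  qed
  moreover have "(1 / a) ^ k * (1 / (1 + y) ^ k) = ((1 / a) * (1 / (1 + y))) ^ k"
    by (simp only: power_mult_distrib power_one_over[symmetric])
  ultimately show ?thesis by (simp only: a_def)
qed

text \<open>Supplies the condition on \<open>r\<close> in \<open>supermartingale_of_gain\<close> for
  integer powers; \<open>powr_product_le\<close> does so for real ones.\<close>

lemma bernoulli_product_le:
  assumes "0 \<le> (x :: real)" shows "(1 + x) ^ k * (1 - real k * x) \<le> 1"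
proof (cases "0 < 1 - real k * x \<and> k \<noteq> 0")
  case True
  have "x \<le> real k * x" using True assms by (simp add: mult_le_cancel_right1)
  then have x: "x \<le> 1" using True by simp
  have "1 - real k * x \<le> (1 - x) ^ k" using Bernoulli_inequality[of "- x" k] x by simp
  then have "(1 + x) ^ k * (1 - real k * x) \<le> (1 + x) ^ k * (1 - x) ^ k"
    using assms by (intro mult_left_mono) auto
  also have "\<dots> = (1 - x * x) ^ k" by (simp add: power_mult_distrib[symmetric] algebra_simps)
  also have "\<dots> \<le> 1" using x assms by (intro power_le_one) (auto intro: mult_le_one)
  finally show ?thesis .
next
  case False
  then consider "k = 0" | "1 - real k * x \<le> 0" by linarith
  then show ?thesis
  proof cases
    case 2
    then have "(1 + x) ^ k * (1 - real k * x) \<le> 0" using assms by (intro mult_nonneg_nonpos) auto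
    then show ?thesis by simp
  qed simp
qed

lemma powr_product_le:
  assumes "0 \<le> (x :: real)" "0 \<le> q" shows "(1 + x) powr q * (1 - q * x) \<le> 1"
proof (cases "0 < 1 - q * x")
  case True
  have "(1 + x) powr q \<le> exp (q * x)"
    using assms ln_add_one_self_le_self[of x] by (simp add: powr_def mult_left_mono)
  moreover have "1 - q * x \<le> exp (- (q * x))" using exp_ge_add_one_self[of "- (q * x)"] by simp
  ultimately have "(1 + x) powr q * (1 - q * x) \<le> exp (q * x) * exp (- (q * x))"
    using True by (intro mult_mono) auto
  then show ?thesis by (simp add: exp_minus)
next
  case False
  then have "(1 + x) powr q * (1 - q * x) \<le> 0" by (intro mult_nonneg_nonpos) auto
  then show ?thesis by simp
qed

text \<open>w / (w + s) increases in \<open>w\<close>. This explains the exponent \<open>q\<close>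
  in \<open>reciprocal_supermartingale\<close>: its value at the starting weight is the best
  constant for all larger weights.\<close>

lemma quotient_le_reciprocal:
  fixes a s w :: real
  assumes "0 < a" "a \<le> w" "0 < s" shows "a / (a + s) / w \<le> 1 / (w + s)"
proof -
  have p: "0 < (a + s) * w" "0 < w + s" using assms by auto
  have "a * (w + s) \<le> (a + s) * w" using assms by (simp add: algebra_simps)
  then have "a / ((a + s) * w) \<le> 1 / (w + s)"
    using p by (simp add: pos_divide_le_eq pos_le_divide_eq)
  then show ?thesis by simp
qed

section \<open>Supermartingales and the maximal inequality\<close>

context pa_setting begin

text \<open>Integrals over adapted events \<open>A\<close> stand for conditional expectations. The
  bound \<open>C\<close> may depend on \<open>n\<close> and secures integrability.\<close>

definition supermartingale :: "nat \<Rightarrow> (nat \<Rightarrow> path \<Rightarrow> real) \<Rightarrow> bool" where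
  "supermartingale N Y \<longleftrightarrow>
    (\<forall>n\<ge>N. determined m (Suc n) 1 (Y n) \<and> (\<forall>p. 0 \<le> Y n p) \<and> (\<exists>C. \<forall>p. Y n p \<le> C)) \<and>
    (\<forall>n\<ge>N. \<forall>A. determined m (Suc n) 1 A \<longrightarrow>
      mean (\<lambda>p. of_bool (A p) * Y (Suc n) p) \<le> mean (\<lambda>p. of_bool (A p) * Y n p))"

text \<open>Stop when the level \<open>l\<close> is first reached, counting the stopped value as
  \<open>l\<close>: the mean of the stopped process does not increase. \<open>H n\<close> says that
  stopping has happened by time \<open>n\<close>.\<close>

lemma maximal_inequality:
  assumes Y: "supermartingale N Y" and l: "0 < l"
  shows "prob {\<omega>\<in>space M. \<exists>n\<ge>N. l \<le> Y n (sample \<omega>)} \<le> mean (Y N) / l"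
proof -
  have Yd: "determined m (Suc n) 1 (Y n)" and Y0: "\<And>p. 0 \<le> Y n p" and Yb: "\<exists>C. \<forall>p. Y n p \<le> C"
    if "N \<le> n" for n
    using Y that unfolding supermartingale_def by blast+
  define H where "H n p \<longleftrightarrow> (\<exists>k\<in>{N..n}. l \<le> Y k p)" for n p
  have Hd: "determined m (Suc n) 1 (H n)" for n
  proof (rule determinedI)
    fix p q assume a: "agree m (Suc n) 1 p q"
    have "Y k p = Y k q" if "k \<in> {N..n}" for k
      by (rule determinedD[OF Yd agree_mono[OF a]]) (use that in auto)
    then show "H n p = H n q" by (auto simp: H_def)
  qed
  have Hm[measurable]: "Measurable.pred M (\<lambda>\<omega>. H n (sample \<omega>))" for n
    by (rule determined_measurable[OF Hd]) simp
  have int: "integrable M (\<lambda>\<omega>. of_bool (A (sample \<omega>)) * Y n (sample \<omega>))"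
    if "N \<le> n" "determined m (Suc n) 1 A" for A n
  proof -
    obtain C where C: "\<And>p. Y n p \<le> C" using Yb \<open>N \<le> n\<close> by blast
    show ?thesis
      by (rule determined_integrable[of "Suc n" 1 "\<lambda>p. of_bool (A p) * Y n p" C])
        (use C Y0[OF that(1)] order_trans[OF Y0[OF that(1)] C] determinedD[OF that(2)] determinedD[OF Yd[OF that(1)]] in
          \<open>auto intro!: determinedI simp: abs_mult\<close>)
  qed
  have intH: "integrable M (\<lambda>\<omega>. l * of_bool (H n (sample \<omega>)))" for n
    by (rule integrable_const_bound[of _ l]) (use l in auto)
  have notH: "determined m (Suc n) 1 (\<lambda>p. \<not> H n p)" for n
    using Hd[of n] by (auto simp: determined_def)
  have PH: "l * prob {\<omega>\<in>space M. H n (sample \<omega>)} = mean (\<lambda>p. l * of_bool (H n p))" for n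
  proof -
    have "mean (\<lambda>p. of_bool (H n p)) = expectation (indicator {\<omega>\<in>space M. H n (sample \<omega>)})"
      by (rule Bochner_Integration.integral_cong) (auto simp: indicator_def)
    then show ?thesis by (simp add: Int_absorb2 Collect_restrict)
  qed
  have main: "mean (\<lambda>p. l * of_bool (H n p)) + mean (\<lambda>p. of_bool (\<not> H n p) * Y n p) \<le> mean (Y N)" if "N \<le> n" for n
    using that
  proof (induction n rule: dec_induct)
    case base
    have "mean (\<lambda>p. l * of_bool (H N p)) + mean (\<lambda>p. of_bool (\<not> H N p) * Y N p) =
        mean (\<lambda>p. l * of_bool (H N p) + of_bool (\<not> H N p) * Y N p)"
      using intH int[OF order.refl notH] by simp
    also have "\<dots> \<le> mean (Y N)"
    proof (rule integral_mono)
      show "integrable M (\<lambda>\<omega>. l * of_bool (H N (sample \<omega>)) + of_bool (\<not> H N (sample \<omega>)) * Y N (sample \<omega>))"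
        by (rule Bochner_Integration.integrable_add[OF intH int[OF order.refl notH]])
      show "integrable M (\<lambda>\<omega>. Y N (sample \<omega>))"
        using int[OF order.refl determined_const[of _ _ _ True]] by simp
      show "l * of_bool (H N (sample \<omega>)) + of_bool (\<not> H N (sample \<omega>)) * Y N (sample \<omega>) \<le> Y N (sample \<omega>)" for \<omega>
        by (auto simp: H_def)
    qed
    finally show ?case .
  next
    case (step n)
    let ?H = "\<lambda>p. \<not> H n p"
    have d: "determined m (Suc (Suc n)) 1 ?H" by (rule determined_mono[OF notH]) simp
    have "mean (\<lambda>p. l * of_bool (H (Suc n) p)) + mean (\<lambda>p. of_bool (\<not> H (Suc n) p) * Y (Suc n) p) =
        mean (\<lambda>p. l * of_bool (H (Suc n) p) + of_bool (\<not> H (Suc n) p) * Y (Suc n) p)"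
      using intH int[of "Suc n", OF _ notH] step by simp
    also have "\<dots> \<le> mean (\<lambda>p. l * of_bool (H n p) + of_bool (?H p) * Y (Suc n) p)"
    proof (rule integral_mono)
      fix \<omega>
      have "{N..Suc n} = insert (Suc n) {N..n}" using step by auto
      then have "H (Suc n) p \<longleftrightarrow> H n p \<or> l \<le> Y (Suc n) p" for p by (auto simp: H_def)
      then show "l * of_bool (H (Suc n) (sample \<omega>)) + of_bool (\<not> H (Suc n) (sample \<omega>)) * Y (Suc n) (sample \<omega>)
          \<le> l * of_bool (H n (sample \<omega>)) + of_bool (?H (sample \<omega>)) * Y (Suc n) (sample \<omega>)"
        by auto
    next
      have N: "N \<le> Suc n" using step by simp
      show "integrable M (\<lambda>\<omega>. l * of_bool (H (Suc n) (sample \<omega>)) + of_bool (\<not> H (Suc n) (sample \<omega>)) * Y (Suc n) (sample \<omega>))"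
        by (rule Bochner_Integration.integrable_add[OF intH int[OF N notH]])
      show "integrable M (\<lambda>\<omega>. l * of_bool (H n (sample \<omega>)) + of_bool (?H (sample \<omega>)) * Y (Suc n) (sample \<omega>))"
        by (rule Bochner_Integration.integrable_add[OF intH int[OF N d]])
    qed
    also have "\<dots> = mean (\<lambda>p. l * of_bool (H n p)) + mean (\<lambda>p. of_bool (?H p) * Y (Suc n) p)"
      using intH int[of "Suc n", OF _ d] step by simp
    also have "mean (\<lambda>p. of_bool (?H p) * Y (Suc n) p) \<le> mean (\<lambda>p. of_bool (?H p) * Y n p)"
      using Y step notH unfolding supermartingale_def by blast
    finally show ?case using step by simp
  qed
  have bound: "prob {\<omega>\<in>space M. H n (sample \<omega>)} \<le> mean (Y N) / l" if "N \<le> n" for n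
  proof -
    have "0 \<le> mean (\<lambda>p. of_bool (\<not> H n p) * Y n p)"
      using Y0[OF that] by (intro Bochner_Integration.integral_nonneg) auto
    then show ?thesis using main[OF that] l PH[of n] by (simp add: field_simps)
  qed
  have "(\<lambda>n. prob {\<omega>\<in>space M. H n (sample \<omega>)}) \<longlonglongrightarrow> prob (\<Union>n. {\<omega>\<in>space M. H n (sample \<omega>)})"
  proof (rule finite_Lim_measure_incseq)
    have "{\<omega>\<in>space M. H n (sample \<omega>)} \<in> events" for n by measurable
    then show "range (\<lambda>n. {\<omega>\<in>space M. H n (sample \<omega>)}) \<subseteq> events" by blast
  qed (auto simp: incseq_def H_def)
  then have "prob (\<Union>n. {\<omega>\<in>space M. H n (sample \<omega>)}) \<le> mean (Y N) / l"
    by (rule LIMSEQ_le_const2) (use bound in blast)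
  moreover have "(\<Union>n. {\<omega>\<in>space M. H n (sample \<omega>)}) = {\<omega>\<in>space M. \<exists>n\<ge>N. l \<le> Y n (sample \<omega>)}"
    unfolding H_def by (auto, meson atLeastAtMost_iff order_refl)
  ultimately show ?thesis by simp
qed

lemma supermartingale_measurable:
  "supermartingale N Y \<Longrightarrow> N \<le> n \<Longrightarrow> (\<lambda>\<omega>. Y n (sample \<omega>)) \<in> borel_measurable M"
  by (rule determined_borel) (auto simp: supermartingale_def)

lemma AE_not_in_of_prob_tendsto_0:
  assumes "A \<in> events" "\<And>k :: nat. prob A \<le> f k" "f \<longlonglongrightarrow> 0"
  shows "AE \<omega> in M. \<omega> \<notin> A"
proof -
  have "prob A \<le> 0" by (rule LIMSEQ_le_const[OF assms(3)]) (use assms(2) in blast)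
  then show ?thesis using prob_eq_0[OF assms(1)] by (simp add: measure_le_0_iff)
qed

lemma supermartingale_events:
  assumes Y: "supermartingale N Y"
  shows "{\<omega>\<in>space M. \<exists>n\<ge>N. l \<le> Y n (sample \<omega>)} \<in> events"
proof -
  have "{\<omega>\<in>space M. l \<le> Y n (sample \<omega>)} \<in> sets M" if "N \<le> n" for n
    using supermartingale_measurable[OF Y that] by measurable
  then have "(\<Union>n\<in>{N..}. {\<omega>\<in>space M. l \<le> Y n (sample \<omega>)}) \<in> events"
    by (intro sets.countable_UN'') auto
  moreover have "(\<Union>n\<in>{N..}. {\<omega>\<in>space M. l \<le> Y n (sample \<omega>)}) = {\<omega>\<in>space M. \<exists>n\<ge>N. l \<le> Y n (sample \<omega>)}"
    by blast
  ultimately show ?thesis by (simp only:)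
qed

lemma supermartingale_bounded_AE:
  assumes Y: "supermartingale N Y" shows "AE \<omega> in M. \<exists>K. \<forall>n\<ge>N. Y n (sample \<omega>) \<le> K"
proof -
  define A where "A k = {\<omega>\<in>space M. \<exists>n\<ge>N. real (Suc k) \<le> Y n (sample \<omega>)}" for k
  have A: "A k \<in> events" for k unfolding A_def by (rule supermartingale_events[OF Y])
  have "AE \<omega> in M. \<omega> \<notin> (\<Inter>k. A k)"
  proof (rule AE_not_in_of_prob_tendsto_0)
    show "(\<Inter>k. A k) \<in> events" using A by (intro sets.countable_INT) auto
    show "prob (\<Inter>k. A k) \<le> mean (Y N) / real (Suc k)" for k
    proof -
      have "prob (\<Inter>k. A k) \<le> prob (A k)" by (rule finite_measure_mono) (use A in auto)
      also have "\<dots> \<le> mean (Y N) / real (Suc k)" unfolding A_def by (rule maximal_inequality[OF Y]) simp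
      finally show ?thesis .
    qed
    show "(\<lambda>k. mean (Y N) / real (Suc k)) \<longlonglongrightarrow> 0" by (rule LIMSEQ_Suc[OF lim_const_over_n])
  qed
  then show ?thesis using AE_space
  proof eventually_elim
    case (elim \<omega>)
    then obtain k where "\<omega> \<notin> A k" by blast
    then have "\<not> (\<exists>n\<ge>N. real (Suc k) \<le> Y n (sample \<omega>))" using elim by (simp add: A_def)
    then have "\<forall>n\<ge>N. Y n (sample \<omega>) \<le> real (Suc k)" by (meson linear)
    then show ?case ..
  qed
qed

text \<open>If a gain \<open>g\<close> costs \<open>Y\<close> the fraction \<theta> g / W of its
  value, then its mean is multiplied by at most r (1 - \<theta> \<open>ratio\<close>). For \<theta>
  \<ge> 0 a lower bound on the mean gain suffices; a negative \<theta> calls for the exact mean,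
  known for \<open>m = 1\<close>.\<close>

lemma supermartingale_of_gain:
  assumes u: "2 \<le> u" "u \<le> N"
    and Y: "\<And>n. N \<le> n \<Longrightarrow> determined m (Suc n) 1 (Y n)" "\<And>n p. N \<le> n \<Longrightarrow> 0 \<le> Y n p"
      "\<And>n. N \<le> n \<Longrightarrow> \<exists>C. \<forall>p. Y n p \<le> C"
    and step: "\<And>n p. N \<le> n \<Longrightarrow> Y (Suc n) p \<le> r n * (Y n p - \<theta> * (Y n p / weight p u n * gain p u n))"
    and r: "\<And>n. N \<le> n \<Longrightarrow> 0 \<le> r n" "\<And>n. N \<le> n \<Longrightarrow> r n * (1 - \<theta> * ratio n) \<le> 1"
    and \<theta>: "0 \<le> \<theta> \<or> m = 1"
  shows "supermartingale N Y"
  unfolding supermartingale_def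
proof (intro conjI allI impI)
  fix n and A :: "path \<Rightarrow> bool" assume n: "N \<le> n" and A: "determined m (Suc n) 1 A"
  obtain C where C: "\<And>p. Y n p \<le> C" using Y(3)[OF n] by blast
  obtain C' where C': "\<And>p. Y (Suc n) p \<le> C'" using Y(3)[of "Suc n"] n by auto
  have un: "u \<le> n" using u n by simp
  \<comment> \<open>Dividing by the weight makes \<open>f p * weight p u n\<close> equal to
    \<open>Y\<close> on \<open>A\<close>, so the estimates of the mean gain apply to
    \<open>f\<close>.\<close>
  define f where "f p = of_bool (A p) * Y n p / weight p u n" for p
  have f: "determined m (Suc n) 1 f"
    by (rule determinedI) (simp add: f_def determinedD[OF A] determinedD[OF Y(1)[OF n]] weight_agree[OF u(1)])
  have f0: "0 \<le> f p" for p
    using Y(2)[OF n, of p] weight_pos[of p u n] by (simp add: f_def)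
  have fC: "f p \<le> C / start_weight u" for p
  proof -
    have "of_bool (A p) * Y n p \<le> C" using C[of p] Y(2)[OF n, of p] by (cases "A p") auto
    moreover have "0 \<le> C" using C[of p] Y(2)[OF n, of p] by simp
    ultimately show ?thesis unfolding f_def
      using weight_ge_start start_weight_pos Y(2)[OF n, of p] by (intro frac_le) auto
  qed
  have fW: "f p * weight p u n = of_bool (A p) * Y n p" for p
    using weight_pos[of p u n] by (simp add: f_def)
  have int: "integrable M (\<lambda>\<omega>. of_bool (A (sample \<omega>)) * Y n (sample \<omega>))"
    using weighted_integrable(1)[OF f f0 fC u(1) un] by (simp add: fW)
  note intg = gain_integrable[OF f f0 fC u(1) un]
  have "mean (\<lambda>p. of_bool (A p) * Y (Suc n) p) \<le> mean (\<lambda>p. r n * (of_bool (A p) * Y n p - \<theta> * (f p * gain p u n)))"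
  proof (rule integral_mono)
    have A': "determined m (Suc (Suc n)) 1 A" by (rule determined_mono[OF A]) simp
    have "determined m (Suc (Suc n)) 1 (\<lambda>p. of_bool (A p) * Y (Suc n) p)"
      using determinedD[OF A'] determinedD[OF Y(1)[of "Suc n"]] n by (intro determinedI) simp
    moreover have "\<bar>of_bool (A p) * Y (Suc n) p\<bar> \<le> C'" for p
      using C'[of p] Y(2)[of "Suc n" p] n by (auto simp: abs_mult)
    ultimately show "integrable M (\<lambda>\<omega>. of_bool (A (sample \<omega>)) * Y (Suc n) (sample \<omega>))"
      by (rule determined_integrable)
    show "integrable M (\<lambda>\<omega>. r n * (of_bool (A (sample \<omega>)) * Y n (sample \<omega>) - \<theta> * (f (sample \<omega>) * gain (sample \<omega>) u n)))"
      using int intg by simp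
    show "of_bool (A (sample \<omega>)) * Y (Suc n) (sample \<omega>) \<le>
        r n * (of_bool (A (sample \<omega>)) * Y n (sample \<omega>) - \<theta> * (f (sample \<omega>) * gain (sample \<omega>) u n))" for \<omega>
      using step[OF n, of "sample \<omega>"] by (cases "A (sample \<omega>)") (auto simp: f_def)
  qed
  also have "\<dots> = r n * (mean (\<lambda>p. of_bool (A p) * Y n p) - \<theta> * mean (\<lambda>p. f p * gain p u n))"
    using int intg by simp
  also have "\<dots> \<le> r n * (mean (\<lambda>p. of_bool (A p) * Y n p) - \<theta> * (ratio n * mean (\<lambda>p. f p * weight p u n)))"
  proof (cases "0 \<le> \<theta>")
    case True
    then show ?thesis using mean_gain_ge[OF f f0 fC u(1) un] r(1)[OF n]
      by (intro mult_left_mono diff_left_mono) auto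
  next
    case False
    then show ?thesis using mean_gain_eq[OF f f0 fC u(1) un] \<theta> by simp
  qed
  also have "\<dots> = r n * (1 - \<theta> * ratio n) * mean (\<lambda>p. of_bool (A p) * Y n p)"
    by (simp add: fW algebra_simps)
  also have "\<dots> \<le> 1 * mean (\<lambda>p. of_bool (A p) * Y n p)"
    using r(2)[OF n] Y(2)[OF n] by (intro mult_right_mono Bochner_Integration.integral_nonneg) auto
  finally show "mean (\<lambda>p. of_bool (A p) * Y (Suc n) p) \<le> mean (\<lambda>p. of_bool (A p) * Y n p)" by simp
qed (use Y in auto)

text \<open>The product of \<open>1 + ratio k\<close> over 2 \<le> \<open>k\<close> <
  \<open>n\<close>; the factor with index \<open>i\<close> belongs to the arrival of vertex
  \<open>i + 3\<close>.\<close>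

definition growth :: "nat \<Rightarrow> real" where
  "growth n = (\<Prod>i<n - 2. 1 + step_gain / total (i + 3) m)"

lemma growth_Suc: "2 \<le> n \<Longrightarrow> growth (Suc n) = growth n * (1 + ratio n)"
proof -
  assume "2 \<le> n"
  then have "Suc n - 2 = Suc (n - 2)" "n - 2 + 3 = Suc n" by auto
  then show ?thesis by (simp add: growth_def ratio_def)
qed

lemma growth_pos: "0 < growth n"
  unfolding growth_def using step_gain_pos total_pos m_pos by (intro prod_pos) (auto intro!: add_pos_pos)

lemma determined_weight2:
  assumes "2 \<le> u" "N \<le> n" shows "determined m (Suc n) 1 (\<lambda>p. h (weight p u N) (weight p u n))"
proof (rule determinedI)
  fix p q assume a: "agree m (Suc n) 1 p q"
  have "weight p u N = weight q u N"
    by (rule weight_agree[OF assms(1)], rule agree_mono[OF a]) (use assms in auto)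
  then show "h (weight p u N) (weight p u n) = h (weight q u N) (weight q u n)"
    using weight_agree[OF assms(1) a] by simp
qed

section \<open>Supermartingales built from the weight\<close>

abbreviation slope :: real where "slope \<equiv> 2 * real m + \<delta>"

text \<open>\<open>h\<close> leaves room for a normalisation by the weight at the starting time:
  \<open>prob_rise\<close> uses a truncated power of \<open>growth N / w\<close>,
  \<open>prob_tail\<close> the constant 1.\<close>

lemma upper_supermartingale:
  assumes m1: "m = 1" and u: "2 \<le> u" "u \<le> N" and h: "\<And>w. 0 \<le> h w" "\<And>p. h (weight p u N) \<le> R"
  shows "supermartingale N (\<lambda>n p. h (weight p u N) * ((weight p u n + real k * slope) / growth n) ^ k)"
proof (rule supermartingale_of_gain[OF u, where r = "\<lambda>n. 1 / (1 + ratio n) ^ k" and \<theta> = "- real k"])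
  fix n assume n: "N \<le> n"
  then have n2: "2 \<le> n" using u by simp
  show "determined m (Suc n) 1 (\<lambda>p. h (weight p u N) * ((weight p u n + real k * slope) / growth n) ^ k)"
    by (rule determined_weight2[OF u(1) n])
  have base: "0 \<le> (weight p u n + real k * slope) / growth n" for p
    using weight_pos[of p u n] growth_pos[of n] slope_pos by (intro divide_nonneg_nonneg add_nonneg_nonneg) auto
  then show "0 \<le> h (weight p u N) * ((weight p u n + real k * slope) / growth n) ^ k" for p
    using h by simp
  have R: "0 \<le> R" using h order_trans by blast
  show "\<exists>C. \<forall>p. h (weight p u N) * ((weight p u n + real k * slope) / growth n) ^ k \<le> C"
  proof (intro exI allI)
    fix p
    show "h (weight p u N) * ((weight p u n + real k * slope) / growth n) ^ k \<le>
       R * ((start_weight u + slope * real (n - u) + real k * slope) / growth n) ^ k"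
      using h base[of p] growth_pos[of n] weight_le[of p u n] R
      by (intro mult_mono power_mono divide_right_mono add_right_mono) auto
  qed
  show "h (weight p u N) * ((weight p u (Suc n) + real k * slope) / growth (Suc n)) ^ k \<le>
    1 / (1 + ratio n) ^ k * (h (weight p u N) * ((weight p u n + real k * slope) / growth n) ^ k -
      - real k * (h (weight p u N) * ((weight p u n + real k * slope) / growth n) ^ k / weight p u n * gain p u n))" for p
  proof -
    let ?W = "weight p u n" and ?g = "gain p u n"
    have "(?W + ?g + real k * slope) ^ k \<le> (?W + real k * slope) ^ k * (1 + real k * ?g / ?W)"
      by (intro power_upper_step weight_pos gain_bounds)
    then have "h (weight p u N) / (growth n * (1 + ratio n)) ^ k * (?W + ?g + real k * slope) ^ k \<le>
       h (weight p u N) / (growth n * (1 + ratio n)) ^ k * ((?W + real k * slope) ^ k * (1 + real k * ?g / ?W))"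
      using h growth_pos[of n] ratio_pos[OF n2] by (intro mult_left_mono divide_nonneg_nonneg) auto
    moreover have "h (weight p u N) * ((weight p u (Suc n) + real k * slope) / growth (Suc n)) ^ k =
        h (weight p u N) / (growth n * (1 + ratio n)) ^ k * (?W + ?g + real k * slope) ^ k"
      using n u by (simp add: weight_Suc growth_Suc power_divide)
    moreover have "1 / (1 + ratio n) ^ k * (Y - - real k * (Y / ?W * ?g)) = Y / (1 + ratio n) ^ k * (1 + real k * ?g / ?W)" for Y
      by (simp add: distrib_left distrib_right)
    moreover have "h (weight p u N) * (A / growth n) ^ k / (1 + ratio n) ^ k = h (weight p u N) / (growth n * (1 + ratio n)) ^ k * A ^ k" for A
      by (simp add: power_divide power_mult_distrib)
    ultimately show ?thesis by (simp only: mult.assoc)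
  qed
  show "0 \<le> 1 / (1 + ratio n) ^ k" using ratio_pos[OF n2] by simp
  have "1 + real k * ratio n \<le> (1 + ratio n) ^ k" using ratio_pos[OF n2] by (intro Bernoulli_inequality) simp
  then show "1 / (1 + ratio n) ^ k * (1 - - real k * ratio n) \<le> 1" using ratio_pos[OF n2] by (simp add: field_simps)
qed (use m1 in auto)

text \<open>The indicator keeps the shifted weight positive from time \<open>N\<close> on. The
  factor 4 makes the normalised starting value at most (4/3)^k, small against the level 2^k used in
  \<open>prob_drop\<close>.\<close>

lemma lower_supermartingale:
  assumes u: "2 \<le> u" "u \<le> N" and k: "1 \<le> k"
  shows "supermartingale N (\<lambda>n p. of_bool (4 * real k * slope \<le> weight p u N) *
      (weight p u N * growth n / (growth N * (weight p u n - real k * slope))) ^ k)"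
proof (rule supermartingale_of_gain[OF u, where r = "\<lambda>n. (1 + ratio n) ^ k" and \<theta> = "real k"])
  fix n assume n: "N \<le> n"
  then have n2: "2 \<le> n" using u by simp
  let ?Y = "\<lambda>n p. of_bool (4 * real k * slope \<le> weight p u N) *
      (weight p u N * growth n / (growth N * (weight p u n - real k * slope))) ^ k"
  show "determined m (Suc n) 1 (?Y n)"
    by (rule determined_weight2[OF u(1) n])
  have ks: "0 < real k * slope" using k slope_pos by simp
  have base: "0 < weight p u n - real k * slope" "weight p u N \<le> 4 / 3 * (weight p u n - real k * slope)"
    if "4 * real k * slope \<le> weight p u N" for p
    using that weight_mono[OF n, of p u] ks by auto
  show "0 \<le> ?Y n p" for p
    using base(1)[of p] weight_pos[of p u N] growth_pos[of n] growth_pos[of N]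
    by (cases "4 * real k * slope \<le> weight p u N") (auto simp: less_imp_le)
  show "\<exists>C. \<forall>p. ?Y n p \<le> C"
  proof (intro exI allI)
    fix p show "?Y n p \<le> (4 / 3 * growth n / growth N) ^ k"
    proof (cases "4 * real k * slope \<le> weight p u N")
      case True
      have "weight p u N * growth n / (growth N * (weight p u n - real k * slope)) =
         (weight p u N / (weight p u n - real k * slope)) * (growth n / growth N)" by simp
      also have "\<dots> \<le> (4 / 3) * (growth n / growth N)"
        using base[OF True] growth_pos[of n] growth_pos[of N]
        by (intro mult_right_mono) (auto simp: field_simps)
      finally show ?thesis using True base(1)[OF True] weight_pos[of p u N] growth_pos[of n] growth_pos[of N]
        by (simp add: power_mono less_imp_le)
    next
      case False
      then show ?thesis using growth_pos[of n] growth_pos[of N] by (simp add: less_imp_le)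
    qed
  qed
  show "?Y (Suc n) p \<le> (1 + ratio n) ^ k * (?Y n p - real k * (?Y n p / weight p u n * gain p u n))" for p
  proof (cases "4 * real k * slope \<le> weight p u N")
    case True
    let ?W = "weight p u n" and ?g = "gain p u n"
    let ?c = "(weight p u N * (growth n * (1 + ratio n)) / growth N) ^ k"
    have "(1 / (?W + ?g - real k * slope)) ^ k \<le> (1 / (?W - real k * slope)) ^ k * (1 - real k * ?g / ?W)"
      using base(1)[OF True] by (intro power_lower_step gain_bounds) simp
    then have "?c * (1 / (?W + ?g - real k * slope)) ^ k \<le> ?c * ((1 / (?W - real k * slope)) ^ k * (1 - real k * ?g / ?W))"
      using weight_pos[of p u N] growth_pos[of n] growth_pos[of N] ratio_pos[OF n2]
      by (intro mult_left_mono) auto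
    moreover have "?Y (Suc n) p = ?c * (1 / (?W + ?g - real k * slope)) ^ k"
    proof -
      have "weight p u N * growth (Suc n) / (growth N * (weight p u (Suc n) - real k * slope)) =
          weight p u N * (growth n * (1 + ratio n)) / growth N * (1 / (?W + ?g - real k * slope))"
        using n u by (simp add: weight_Suc growth_Suc)
      then show ?thesis using True by (simp only: power_mult_distrib[symmetric] of_bool_eq mult_1)
    qed
    moreover have "(1 + ratio n) ^ k * (?Y n p - real k * (?Y n p / ?W * ?g)) =
        ?c * ((1 / (?W - real k * slope)) ^ k * (1 - real k * ?g / ?W))"
    proof -
      have "weight p u N * (growth n * (1 + ratio n)) / growth N * (1 / (?W - real k * slope)) =
          (1 + ratio n) * (weight p u N * growth n / (growth N * (?W - real k * slope)))" by simp
      then have "?c * (1 / (?W - real k * slope)) ^ k = (1 + ratio n) ^ k * ?Y n p"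
        using True by (simp only: power_mult_distrib[symmetric] of_bool_eq mult_1)
      then have "?c * ((1 / (?W - real k * slope)) ^ k * (1 - real k * ?g / ?W)) =
          (1 + ratio n) ^ k * ?Y n p * (1 - real k * ?g / ?W)" by (simp only: mult.assoc[symmetric])
      moreover have "a * (y - real k * (y / ?W * ?g)) = a * y * (1 - real k * ?g / ?W)" for a y
        by (simp add: right_diff_distrib)
      ultimately show ?thesis by (simp only:)
    qed
    ultimately show ?thesis by simp
  qed simp
  show "0 \<le> (1 + ratio n) ^ k" using ratio_pos[OF n2] by simp
  show "(1 + ratio n) ^ k * (1 - real k * ratio n) \<le> 1"
    using ratio_pos[OF n2] by (intro bernoulli_product_le) simp
qed simp

text \<open>The unshifted reciprocal works from any starting weight, at the price of an exponent
  \<open>q\<close> < 1 on \<open>growth\<close>. It serves to show that the weight becomes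
  large.\<close>

lemma reciprocal_supermartingale:
  assumes u: "2 \<le> u" and q: "q = start_weight u / (start_weight u + slope)"
  shows "supermartingale u (\<lambda>n p. growth n powr q / weight p u n)"
proof (rule supermartingale_of_gain[OF u order.refl, where r = "\<lambda>n. (1 + ratio n) powr q" and \<theta> = q])
  have q0: "0 \<le> q" using start_weight_pos[of u] slope_pos by (simp add: q)
  then show "0 \<le> q \<or> m = 1" ..
  fix n assume n: "u \<le> n"
  then have n2: "2 \<le> n" using u by simp
  show "determined m (Suc n) 1 (\<lambda>p. growth n powr q / weight p u n)"
    by (rule weight_determined[OF u order.refl])
  show "0 \<le> growth n powr q / weight p u n" for p using weight_pos[of p u n] by simp
  show "\<exists>C. \<forall>p. growth n powr q / weight p u n \<le> C"
    using weight_ge_start[of u] start_weight_pos[of u]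
    by (intro exI[of _ "growth n powr q / start_weight u"] allI divide_left_mono) (auto intro!: mult_pos_pos weight_pos)
  show "growth (Suc n) powr q / weight p u (Suc n) \<le> (1 + ratio n) powr q *
     (growth n powr q / weight p u n - q * (growth n powr q / weight p u n / weight p u n * gain p u n))" for p
  proof -
    let ?W = "weight p u n" and ?g = "gain p u n"
    have W: "0 < ?W" "start_weight u \<le> ?W" by (auto intro: weight_pos weight_ge_start)
    have g: "0 \<le> ?g" "?g \<le> slope" by (rule gain_bounds)+
    have "q / ?W \<le> 1 / (?W + slope)"
      unfolding q by (rule quotient_le_reciprocal[OF start_weight_pos W(2) slope_pos])
    also have "\<dots> \<le> 1 / (?W + ?g)" using W g by (intro divide_left_mono) auto
    finally have "q / ?W * ?g \<le> 1 / (?W + ?g) * ?g" using g by (intro mult_right_mono) auto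
    then have "1 - 1 / (?W + ?g) * ?g \<le> 1 - q / ?W * ?g" by simp
    moreover have "1 - 1 / (?W + ?g) * ?g = ?W * (1 / (?W + ?g))" using W g by (simp add: field_simps)
    ultimately have "?W * (1 / (?W + ?g)) \<le> 1 - q / ?W * ?g" by linarith
    then have "1 / (?W + ?g) \<le> (1 - q / ?W * ?g) / ?W"
      by (simp only: pos_le_divide_eq[OF W(1)] mult.commute[of _ ?W])
    then have "growth n powr q * (1 + ratio n) powr q * (1 / (?W + ?g)) \<le>
       growth n powr q * (1 + ratio n) powr q * ((1 - q / ?W * ?g) / ?W)"
      by (intro mult_left_mono) auto
    moreover have "growth (Suc n) powr q = growth n powr q * (1 + ratio n) powr q"
      using growth_pos[of n] ratio_pos[OF n2] n2 by (simp add: growth_Suc powr_mult)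
    ultimately show ?thesis using n
      by (simp add: weight_Suc algebra_simps diff_divide_distrib)
  qed
  show "0 \<le> (1 + ratio n) powr q" by simp
  show "(1 + ratio n) powr q * (1 - q * ratio n) \<le> 1"
    using ratio_pos[OF n2] q0 by (intro powr_product_le) auto
qed

end

section \<open>Growth rate and maximal inequalities\<close>

lemma powr_at_top:
  assumes "0 < (q :: real)" shows "filterlim (\<lambda>x :: real. x powr q) at_top at_top"
proof -
  have "filterlim (\<lambda>x :: real. exp (q * ln x)) at_top at_top"
    by (intro filterlim_compose[OF exp_at_top] filterlim_tendsto_pos_mult_at_top[OF tendsto_const assms ln_at_top])
  moreover have "eventually (\<lambda>x :: real. exp (q * ln x) = x powr q) at_top"
    using eventually_gt_at_top[of 0] by eventually_elim (simp add: powr_def)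
  ultimately show ?thesis by (simp only: filterlim_cong[OF refl refl])
qed

text \<open>Both Pochhammer symbols are denominators in Gamma series; in the quotient the factorials
  and the power of \<open>k\<close> with exponent \<open>z\<close> cancel.\<close>

lemma pochhammer_ratio_asymp:
  fixes z a :: real
  assumes z: "0 < z" and a: "0 < a"
  shows "(\<lambda>k. pochhammer (z + a) k / pochhammer z k / real k powr a) \<longlonglongrightarrow> Gamma z / Gamma (z + a)"
proof -
  have "(\<lambda>k. Gamma_series' z k / Gamma_series' (z + a) k) \<longlonglongrightarrow> Gamma z / Gamma (z + a)"
    using Gamma_real_pos[OF add_pos_pos[OF assms]] by (intro tendsto_divide Gamma_series'_LIMSEQ) auto
  moreover have "eventually (\<lambda>k. Gamma_series' z k / Gamma_series' (z + a) k =
      pochhammer (z + a) k / pochhammer z k / real k powr a) sequentially"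
    using eventually_gt_at_top[of 0]
  proof eventually_elim
    case (elim k)
    have p: "pochhammer z k \<noteq> 0" "pochhammer (z + a) k \<noteq> 0"
      using pochhammer_pos[of z k] pochhammer_pos[of "z + a" k] assms by auto
    have e: "exp ((z + a) * ln (real k)) = exp (z * ln (real k)) * real k powr a"
      using elim by (simp add: powr_def distrib_right exp_add)
    have "F * x / P / (F * (x * A) / Q) = Q / P / A" if "F \<noteq> 0" "x \<noteq> 0" for F x P A Q :: real
      using that by simp
    from this[of "fact (k - 1)" "exp (z * ln (real k))"] show ?case
      unfolding Gamma_series'_def of_real_eq_id id_apply e by simp
  qed
  ultimately show ?thesis by (rule Lim_transform_eventually)
qed

context pa_setting begin

definition exponent :: real where "exponent = step_gain / slope"

lemma exponent_pos: "0 < exponent"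
  using step_gain_pos slope_pos by (simp add: exponent_def)

lemma exponent_eq: "exponent = 1 - chi m \<delta> + \<pi> * chi m \<delta>"
proof -
  have "1 - q / s + \<pi> * (q / s) = (s - q + \<pi> * q) / s" if "s \<noteq> 0" for s q :: real
    using that by (simp add: field_simps)
  from this[of slope "real m + \<delta>"] show ?thesis
    using slope_pos by (simp add: exponent_def step_gain_def chi_def)
qed

text \<open>The totals form an arithmetic progression with difference \<open>slope\<close>, so
  \<open>growth\<close> is a quotient of Pochhammer symbols at \<open>z + exponent\<close> and
  \<open>z\<close>.\<close>

lemma growth_asymp: "\<exists>L>0. (\<lambda>n. growth n / real n powr exponent) \<longlonglongrightarrow> L"
proof -
  define z where "z = total 3 m / slope"
  have z: "0 < z" using total_pos[of 3 m] m_pos slope_pos by (simp add: z_def)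
  have tot: "total (i + 3) m = slope * (z + real i)" for i
    using slope_pos by (simp add: z_def total_weight_def field_simps)
  have growth: "growth (k + 2) = pochhammer (z + exponent) k / pochhammer z k" for k
  proof -
    have "1 + step_gain / total (i + 3) m = (z + exponent + real i) / (z + real i)" for i
    proof -
      have "0 < z + real i" using z by simp
      then show ?thesis unfolding tot exponent_def using slope_pos by (simp add: divide_simps) (simp add: algebra_simps)
    qed
    then show ?thesis by (simp add: growth_def pochhammer_prod atLeast0LessThan prod_dividef)
  qed
  let ?L = "Gamma z / Gamma (z + exponent)"
  have "(\<lambda>k. growth (k + 2) / real k powr exponent) \<longlonglongrightarrow> ?L"
    unfolding growth by (rule pochhammer_ratio_asymp[OF z exponent_pos])
  \<comment> \<open>Changes the denominator from \<open>k\<close> to \<open>k + 2\<close>, as the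
    product \<open>growth\<close> starts at 2.\<close>
  moreover have "(\<lambda>k. (real k / real (k + 2)) powr exponent) \<longlonglongrightarrow> 1 powr exponent"
  proof (rule tendsto_powr)
    have "(\<lambda>k. 1 - 2 / real (k + 2)) \<longlonglongrightarrow> 1 - 0"
      by (intro tendsto_diff tendsto_const LIMSEQ_ignore_initial_segment lim_const_over_n)
    moreover have "1 - 2 / real (k + 2) = real k / real (k + 2)" for k by (simp add: field_simps)
    ultimately show "(\<lambda>k. real k / real (k + 2)) \<longlonglongrightarrow> 1" by simp
  qed simp_all
  ultimately have "(\<lambda>k. growth (k + 2) / real k powr exponent * (real k / real (k + 2)) powr exponent) \<longlonglongrightarrow> ?L * 1 powr exponent"
    by (rule tendsto_mult)
  moreover have "eventually (\<lambda>k. growth (k + 2) / real k powr exponent * (real k / real (k + 2)) powr exponent =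
      growth (k + 2) / real (k + 2) powr exponent) sequentially"
    using eventually_gt_at_top[of 0] by eventually_elim (simp add: powr_divide)
  ultimately have "(\<lambda>k. growth (k + 2) / real (k + 2) powr exponent) \<longlonglongrightarrow> ?L * 1 powr exponent"
    by (rule Lim_transform_eventually)
  then have "(\<lambda>n. growth n / real n powr exponent) \<longlonglongrightarrow> ?L * 1 powr exponent"
    by (rule LIMSEQ_offset)
  moreover have "0 < ?L * 1 powr exponent"
    using Gamma_real_pos[of z] Gamma_real_pos[of "z + exponent"] z exponent_pos by simp
  ultimately show ?thesis by blast
qed

lemma growth_bounds:
  obtains c C where "0 < c" "0 < C" "eventually (\<lambda>n. c * real n powr exponent \<le> growth n \<and>
    growth n \<le> C * real n powr exponent) sequentially"
proof -
  obtain L where L: "0 < L" "(\<lambda>n. growth n / real n powr exponent) \<longlonglongrightarrow> L" using growth_asymp by blast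
  have "eventually (\<lambda>n. growth n / real n powr exponent \<in> {L / 2<..<2 * L}) sequentially"
    by (rule topological_tendstoD[OF L(2)]) (use L(1) in auto)
  then have "eventually (\<lambda>n. L / 2 * real n powr exponent \<le> growth n \<and> growth n \<le> 2 * L * real n powr exponent) sequentially"
    using eventually_gt_at_top[of 0]
  proof eventually_elim
    case (elim n)
    then have "0 < real n powr exponent" by simp
    then show ?case using elim(1) by (auto simp: pos_less_divide_eq pos_divide_less_eq)
  qed
  then show ?thesis using that[of "L / 2" "2 * L"] L(1) by simp
qed

lemma growth_at_top: "filterlim growth at_top sequentially"
proof -
  obtain c C where c: "0 < c" "eventually (\<lambda>n. c * real n powr exponent \<le> growth n \<and> growth n \<le> C * real n powr exponent) sequentially"
    using growth_bounds by blast
  have "filterlim (\<lambda>n. real n powr exponent) at_top sequentially"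
    by (rule filterlim_compose[OF powr_at_top[OF exponent_pos] filterlim_real_sequentially])
  then have "filterlim (\<lambda>n. c * real n powr exponent) at_top sequentially"
    using c(1) by (intro filterlim_tendsto_pos_mult_at_top[OF tendsto_const])
  then show ?thesis by (rule filterlim_at_top_mono) (use c(2) in \<open>auto elim: eventually_mono\<close>)
qed

text \<open>On this event the reciprocal supermartingale reaches \<open>growth N powr q / K\<close>,
  a level that tends to infinity with \<open>N\<close>.\<close>

lemma prob_weight_small:
  assumes u: "2 \<le> u" shows "(\<lambda>N. prob {\<omega>\<in>space M. weight (sample \<omega>) u N < K}) \<longlonglongrightarrow> 0"
proof (cases "0 < K")
  case True
  define q where "q = start_weight u / (start_weight u + slope)"
  have q: "0 < q" using start_weight_pos[of u] slope_pos by (simp add: q_def)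
  let ?Y = "\<lambda>n p. growth n powr q / weight p u n"
  have Y: "supermartingale u ?Y" by (rule reciprocal_supermartingale[OF u q_def])
  have le: "prob {\<omega>\<in>space M. weight (sample \<omega>) u N < K} \<le> mean (?Y u) * K / growth N powr q" if N: "u \<le> N" for N
  proof -
    have g: "0 < growth N powr q" using growth_pos[of N] by simp
    have "prob {\<omega>\<in>space M. weight (sample \<omega>) u N < K} \<le> prob {\<omega>\<in>space M. \<exists>n\<ge>u. growth N powr q / K \<le> ?Y n (sample \<omega>)}"
    proof (rule finite_measure_mono[OF _ supermartingale_events[OF Y]], rule subsetI)
      fix \<omega> assume "\<omega> \<in> {\<omega>\<in>space M. weight (sample \<omega>) u N < K}"
      then have "\<omega> \<in> space M" "weight (sample \<omega>) u N < K" by auto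
      moreover from this have "growth N powr q / K \<le> ?Y N (sample \<omega>)"
        using weight_pos[of "sample \<omega>" u N] True by (intro divide_left_mono) auto
      ultimately show "\<omega> \<in> {\<omega>\<in>space M. \<exists>n\<ge>u. growth N powr q / K \<le> ?Y n (sample \<omega>)}" using N by blast
    qed
    also have "\<dots> \<le> mean (?Y u) / (growth N powr q / K)"
      by (rule maximal_inequality[OF Y]) (use g True in simp)
    finally show ?thesis by simp
  qed
  have "filterlim (\<lambda>N. growth N powr q) at_top sequentially"
    by (rule filterlim_compose[OF powr_at_top[OF q] growth_at_top])
  then have "(\<lambda>N. mean (?Y u) * K / growth N powr q) \<longlonglongrightarrow> 0"
    by (intro tendsto_divide_0[OF tendsto_const] filterlim_at_top_imp_at_infinity)
  then show ?thesis
    by (rule tendsto_sandwich[OF _ _ tendsto_const, rotated 2]) (use le in \<open>auto simp: eventually_sequentially\<close>)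
next
  case False
  have "\<not> weight p u N < K" for p N using weight_pos[of p u N] False by simp
  then show ?thesis by simp
qed

definition scaled :: "path \<Rightarrow> nat \<Rightarrow> nat \<Rightarrow> real" where
  "scaled p u n = weight p u n / growth n"

lemma scaled_pos: "0 < scaled p u n"
  using weight_pos growth_pos by (simp add: scaled_def)

text \<open>A drop to one half pushes the lower supermartingale above 2^k, whereas its initial mean
  is at most (4/3)^k. The bound does not depend on \<open>N\<close>.\<close>

lemma prob_drop:
  assumes u: "2 \<le> u" "u \<le> N" and k: "1 \<le> k"
  shows "prob {\<omega>\<in>space M. 4 * real k * slope \<le> weight (sample \<omega>) u N \<and>
    (\<exists>n\<ge>N. scaled (sample \<omega>) u n \<le> scaled (sample \<omega>) u N / 2)} \<le> (2 / 3) ^ k"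
proof -
  let ?Y = "\<lambda>n p. of_bool (4 * real k * slope \<le> weight p u N) *
      (weight p u N * growth n / (growth N * (weight p u n - real k * slope))) ^ k"
  have Y: "supermartingale N ?Y" by (rule lower_supermartingale[OF u k])
  have ks: "0 < real k * slope" using k slope_pos by simp
  have "prob {\<omega>\<in>space M. 4 * real k * slope \<le> weight (sample \<omega>) u N \<and>
    (\<exists>n\<ge>N. scaled (sample \<omega>) u n \<le> scaled (sample \<omega>) u N / 2)} \<le>
     prob {\<omega>\<in>space M. \<exists>n\<ge>N. 2 ^ k \<le> ?Y n (sample \<omega>)}"
  proof (rule finite_measure_mono[OF _ supermartingale_events[OF Y]], safe)
    fix \<omega> n assume w: "\<omega> \<in> space M" and W: "4 * real k * slope \<le> weight (sample \<omega>) u N"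
      and n: "N \<le> n" and le: "scaled (sample \<omega>) u n \<le> scaled (sample \<omega>) u N / 2"
    let ?W = "\<lambda>n. weight (sample \<omega>) u n"
    have a: "0 < ?W n - real k * slope" using W weight_mono[OF n, of "sample \<omega>" u] ks by auto
    have g: "0 < growth n" "0 < growth N" by (rule growth_pos)+
    have "?W n \<le> ?W N * growth n / (2 * growth N)"
      using le g by (simp add: scaled_def field_simps)
    then have "?W n - real k * slope \<le> ?W N * growth n / (2 * growth N)" using ks by simp
    then have "(?W n - real k * slope) * (2 * growth N) \<le> ?W N * growth n"
      using g by (simp only: pos_le_divide_eq mult_pos_pos zero_less_numeral)
    then have "2 \<le> ?W N * growth n / (growth N * (?W n - real k * slope))"
      using a g by (simp add: pos_le_divide_eq mult_ac)
    then have "2 ^ k \<le> ?Y n (sample \<omega>)" using W by (simp add: power_mono)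
    then show "\<exists>n\<ge>N. 2 ^ k \<le> ?Y n (sample \<omega>)" using n by blast
  qed
  also have "\<dots> \<le> mean (?Y N) / 2 ^ k" by (rule maximal_inequality[OF Y]) simp
  also have "mean (?Y N) \<le> (4 / 3) ^ k"
  proof -
    have "?Y N p \<le> (4 / 3) ^ k" for p
    proof (cases "4 * real k * slope \<le> weight p u N")
      case True
      then have a: "0 < weight p u N - real k * slope" using ks by auto
      have "weight p u N * growth N / (growth N * (weight p u N - real k * slope)) = weight p u N / (weight p u N - real k * slope)"
        using growth_pos[of N] by simp
      also have "\<dots> \<le> 4 / 3" using a True by (simp add: pos_divide_le_eq)
      finally show ?thesis using True a weight_pos[of p u N] growth_pos[of N] by (simp add: power_mono)
    qed simp
    moreover have "integrable M (\<lambda>\<omega>. ?Y N (sample \<omega>))"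
    proof -
      obtain C where "\<And>p. ?Y N p \<le> C" "\<And>p. 0 \<le> ?Y N p" "determined m (Suc N) 1 (?Y N)"
        using Y unfolding supermartingale_def by blast
      then show ?thesis by (intro determined_integrable[of "Suc N" 1 "?Y N" C]) auto
    qed
    ultimately show ?thesis by (intro integral_le_const) auto
  qed
  then have "mean (?Y N) / 2 ^ k \<le> (4 / 3) ^ k / 2 ^ k" by (rule divide_right_mono) simp
  also have "(4 / 3) ^ k / 2 ^ k = ((2 / 3) ^ k :: real)" by (simp add: power_divide[symmetric])
  finally show ?thesis by simp
qed

text \<open>As in \<open>prob_drop\<close>, with initial mean at most (5/4)^k because
  \<open>k s\<close> is at most a quarter of the weight.\<close>

lemma prob_rise:
  assumes m1: "m = 1" and u: "2 \<le> u" "u \<le> N" and k: "1 \<le> k"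
  shows "prob {\<omega>\<in>space M. 4 * real k * slope \<le> weight (sample \<omega>) u N \<and>
    (\<exists>n\<ge>N. 2 * scaled (sample \<omega>) u N \<le> scaled (sample \<omega>) u n)} \<le> (2 / 3) ^ k"
proof -
  define h where "h w = of_bool (4 * real k * slope \<le> w) * (growth N / w) ^ k" for w
  let ?Y = "\<lambda>n p. h (weight p u N) * ((weight p u n + real k * slope) / growth n) ^ k"
  have ks: "0 < real k * slope" using k slope_pos by simp
  have h0: "0 \<le> h w" for w
    using ks growth_pos[of N] by (cases "4 * real k * slope \<le> w") (auto simp: h_def)
  have hR: "h (weight p u N) \<le> (growth N / start_weight u) ^ k" for p
  proof (cases "4 * real k * slope \<le> weight p u N")
    case True
    have "growth N / weight p u N \<le> growth N / start_weight u"
      using growth_pos[of N] weight_ge_start[of u p N] start_weight_pos[of u] weight_pos[of p u N]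
      by (intro divide_left_mono) auto
    then show ?thesis using True growth_pos[of N] weight_pos[of p u N] by (simp add: h_def power_mono)
  next
    case False
    then show ?thesis using growth_pos[of N] start_weight_pos[of u] by (simp add: h_def)
  qed
  have Y: "supermartingale N ?Y" by (rule upper_supermartingale[where h = h, OF m1 u h0 hR])
  have "prob {\<omega>\<in>space M. 4 * real k * slope \<le> weight (sample \<omega>) u N \<and>
    (\<exists>n\<ge>N. 2 * scaled (sample \<omega>) u N \<le> scaled (sample \<omega>) u n)} \<le>
     prob {\<omega>\<in>space M. \<exists>n\<ge>N. 2 ^ k \<le> ?Y n (sample \<omega>)}"
  proof (rule finite_measure_mono[OF _ supermartingale_events[OF Y]], safe)
    fix \<omega> n assume w: "\<omega> \<in> space M" and W: "4 * real k * slope \<le> weight (sample \<omega>) u N"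
      and n: "N \<le> n" and le: "2 * scaled (sample \<omega>) u N \<le> scaled (sample \<omega>) u n"
    let ?W = "\<lambda>n. weight (sample \<omega>) u n"
    have g: "0 < growth n" "0 < growth N" "0 < ?W N" "0 < ?W n" by (auto intro: growth_pos weight_pos)
    have "?W n / growth n \<le> (?W n + real k * slope) / growth n"
      using ks g by (intro divide_right_mono) auto
    then have "2 * (?W N / growth N) \<le> (?W n + real k * slope) / growth n"
      using le unfolding scaled_def by linarith
    then have "(2 * (?W N / growth N)) * (growth N / ?W N) \<le> (?W n + real k * slope) / growth n * (growth N / ?W N)"
      using g by (intro mult_right_mono) auto
    then have "2 \<le> (growth N / ?W N) * ((?W n + real k * slope) / growth n)" using g by (simp add: mult.commute)
    then have "2 ^ k \<le> ((growth N / ?W N) * ((?W n + real k * slope) / growth n)) ^ k" by (intro power_mono) auto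
    then have "2 ^ k \<le> ?Y n (sample \<omega>)" using W unfolding h_def by (simp only: power_mult_distrib of_bool_eq mult_1)
    then show "\<exists>n\<ge>N. 2 ^ k \<le> ?Y n (sample \<omega>)" using n by blast
  qed
  also have "\<dots> \<le> mean (?Y N) / 2 ^ k" by (rule maximal_inequality[OF Y]) simp
  also have "mean (?Y N) \<le> (5 / 4) ^ k"
  proof -
    have "?Y N p \<le> (5 / 4) ^ k" for p
    proof (cases "4 * real k * slope \<le> weight p u N")
      case True
      have g: "0 < growth N" "0 < weight p u N" by (auto intro: growth_pos weight_pos)
      have "growth N / weight p u N * ((weight p u N + real k * slope) / growth N) = 1 + real k * slope / weight p u N"
        using g by (simp add: add_divide_distrib distrib_left)
      also have "\<dots> \<le> 5 / 4" using True g by (simp add: pos_divide_le_eq)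
      finally have "(growth N / weight p u N * ((weight p u N + real k * slope) / growth N)) ^ k \<le> (5 / 4) ^ k"
        using g ks by (intro power_mono) auto
      then show ?thesis using True unfolding h_def by (simp only: power_mult_distrib of_bool_eq mult_1)
    qed (simp add: h_def)
    moreover have "integrable M (\<lambda>\<omega>. ?Y N (sample \<omega>))"
    proof -
      obtain C where "\<And>p. ?Y N p \<le> C" "\<And>p. 0 \<le> ?Y N p" "determined m (Suc N) 1 (?Y N)"
        using Y unfolding supermartingale_def by blast
      then show ?thesis by (intro determined_integrable[of "Suc N" 1 "?Y N" C]) auto
    qed
    ultimately show ?thesis by (intro integral_le_const) auto
  qed
  then have "mean (?Y N) / 2 ^ k \<le> (5 / 4) ^ k / 2 ^ k" by (rule divide_right_mono) simp
  also have "(5 / 4) ^ k / 2 ^ k = ((5 / 8) ^ k :: real)" by (simp add: power_divide[symmetric])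
  also have "\<dots> \<le> (2 / 3) ^ k" by (intro power_mono) auto
  finally show ?thesis by simp
qed

text \<open>At time \<open>u\<close> the weight is deterministic, so the initial mean is known
  exactly. With \<open>k\<close> free, the decay in \<open>growth u\<close> can be made summable
  over the roots.\<close>

lemma prob_tail:
  assumes m1: "m = 1" and u: "2 \<le> u" and l: "0 < l"
  shows "prob {\<omega>\<in>space M. \<exists>n\<ge>u. l \<le> scaled (sample \<omega>) u n} \<le>
    ((start_weight u + real k * slope) / (l * growth u)) ^ k"
proof -
  let ?Y = "\<lambda>n p. 1 * ((weight p u n + real k * slope) / growth n) ^ k"
  have Y: "supermartingale u ?Y"
    by (rule upper_supermartingale[OF m1 u order.refl, where h = "\<lambda>_. 1" and R = 1]) auto
  have "prob {\<omega>\<in>space M. \<exists>n\<ge>u. l \<le> scaled (sample \<omega>) u n} \<le> prob {\<omega>\<in>space M. \<exists>n\<ge>u. l ^ k \<le> ?Y n (sample \<omega>)}"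
  proof (rule finite_measure_mono[OF _ supermartingale_events[OF Y]], safe)
    fix \<omega> n assume n: "u \<le> n" and le: "l \<le> scaled (sample \<omega>) u n"
    have "l \<le> (weight (sample \<omega>) u n + real k * slope) / growth n"
      using le growth_pos[of n] slope_pos by (simp add: scaled_def add_divide_distrib add_increasing2)
    then have "l ^ k \<le> ?Y n (sample \<omega>)" using l by (simp add: power_mono)
    then show "\<exists>n\<ge>u. l ^ k \<le> ?Y n (sample \<omega>)" using n by blast
  qed
  also have "\<dots> \<le> mean (?Y u) / l ^ k" by (rule maximal_inequality[OF Y]) (use l in simp)
  also have "\<dots> = ((start_weight u + real k * slope) / (l * growth u)) ^ k"
    by (simp add: prob_space power_divide power_mult_distrib)
  finally show ?thesis .
qed

end

section \<open>Almost sure behaviour of a single cluster\<close>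

context pa_setting begin

lemma weight_borel [measurable]: "2 \<le> u \<Longrightarrow> (\<lambda>\<omega>. weight (sample \<omega>) u n) \<in> borel_measurable M"
  by (rule determined_borel[OF weight_determined[of u n n "\<lambda>x. x"]]) auto

lemma scaled_borel [measurable]: "2 \<le> u \<Longrightarrow> (\<lambda>\<omega>. scaled (sample \<omega>) u n) \<in> borel_measurable M"
  unfolding scaled_def by measurable

text \<open>The bound \<open>le\<close> is uniform in \<open>N\<close>. For fixed \<open>k\<close>,
  letting \<open>N\<close> grow removes the event of small weight by
  \<open>prob_weight_small\<close>; then \<open>k\<close> grows.\<close>

lemma AE_some_not_bad:
  assumes u: "2 \<le> u" and Bad: "\<And>N. {\<omega>\<in>space M. Bad N \<omega>} \<in> events"
    and le: "\<And>N k. u \<le> N \<Longrightarrow> 1 \<le> k \<Longrightarrow>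
      prob {\<omega>\<in>space M. 4 * real k * slope \<le> weight (sample \<omega>) u N \<and> Bad N \<omega>} \<le> 2 * (2 / 3) ^ k"
  shows "AE \<omega> in M. \<exists>N\<ge>u. \<not> Bad N \<omega>"
proof -
  define A where "A = (\<Inter>N\<in>{u..}. {\<omega>\<in>space M. Bad N \<omega>})"
  have A: "A \<in> events"
    unfolding A_def by (rule sets.countable_INT, rule image_subsetI, rule Bad) simp
  have "AE \<omega> in M. \<omega> \<notin> A"
  proof (rule AE_not_in_of_prob_tendsto_0[OF A])
    have pow: "(\<lambda>k. (2 / 3) ^ k :: real) \<longlonglongrightarrow> 0" by (rule LIMSEQ_realpow_zero) simp_all
    have "(\<lambda>k. 2 * (2 / 3) ^ Suc k :: real) \<longlonglongrightarrow> 2 * 0"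
      by (rule tendsto_mult[OF tendsto_const LIMSEQ_Suc[OF pow]])
    then show "(\<lambda>k. 2 * (2 / 3) ^ Suc k :: real) \<longlonglongrightarrow> 0" by simp
    fix k
    let ?K = "4 * real (Suc k) * slope"
    have "prob A \<le> prob {\<omega>\<in>space M. weight (sample \<omega>) u N < ?K} + 2 * (2 / 3) ^ Suc k" if N: "u \<le> N" for N
    proof -
      let ?S = "{\<omega>\<in>space M. weight (sample \<omega>) u N < ?K}"
        and ?B = "{\<omega>\<in>space M. ?K \<le> weight (sample \<omega>) u N \<and> Bad N \<omega>}"
      note [measurable] = weight_borel[OF u]
      have S: "?S \<in> events" by measurable
      have "?B = {\<omega>\<in>space M. ?K \<le> weight (sample \<omega>) u N} \<inter> {\<omega>\<in>space M. Bad N \<omega>}" by auto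
      moreover have "{\<omega>\<in>space M. ?K \<le> weight (sample \<omega>) u N} \<in> events" by measurable
      ultimately have B: "?B \<in> events" by (simp only: sets.Int Bad)
      have "A \<subseteq> ?S \<union> ?B"
      proof
        fix \<omega> assume "\<omega> \<in> A"
        then have "\<omega> \<in> space M \<and> Bad N \<omega>" using N unfolding A_def by blast
        then show "\<omega> \<in> ?S \<union> ?B" by (cases "weight (sample \<omega>) u N < ?K") (simp, simp add: not_less)
      qed
      then have "prob A \<le> prob (?S \<union> ?B)" by (rule finite_measure_mono) (rule sets.Un[OF S B])
      also have "\<dots> \<le> prob ?S + prob ?B" by (rule measure_Un_le[OF S B])
      also have "prob ?B \<le> 2 * (2 / 3) ^ Suc k" by (rule le[OF N]) simp
      finally show ?thesis by simp
    qed
    moreover have "(\<lambda>N. prob {\<omega>\<in>space M. weight (sample \<omega>) u N < ?K} + 2 * (2 / 3) ^ Suc k) \<longlonglongrightarrow> 0 + 2 * (2 / 3) ^ Suc k"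
      by (rule tendsto_add[OF prob_weight_small[OF u] tendsto_const])
    ultimately have "prob A \<le> 0 + 2 * (2 / 3) ^ Suc k" by - (rule LIMSEQ_le_const, assumption, blast)
    then show "prob A \<le> 2 * (2 / 3) ^ Suc k" by simp
  qed
  then show ?thesis using AE_space
  proof eventually_elim
    case (elim \<omega>)
    then show ?case unfolding A_def by blast
  qed
qed

lemma scaled_bounded_below_AE:
  assumes u: "2 \<le> u"
  shows "AE \<omega> in M. \<exists>N\<ge>u. \<forall>n\<ge>N. scaled (sample \<omega>) u N / 2 < scaled (sample \<omega>) u n"
proof -
  note [measurable] = scaled_borel[OF u]
  have "AE \<omega> in M. \<exists>N\<ge>u. \<not> (\<exists>n\<ge>N. scaled (sample \<omega>) u n \<le> scaled (sample \<omega>) u N / 2)"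
  proof (rule AE_some_not_bad[OF u])
    show "{\<omega>\<in>space M. \<exists>n\<ge>N. scaled (sample \<omega>) u n \<le> scaled (sample \<omega>) u N / 2} \<in> events" for N by measurable
    fix N k :: nat assume "u \<le> N" "1 \<le> k"
    from prob_drop[OF u this]
    show "prob {\<omega>\<in>space M. 4 * real k * slope \<le> weight (sample \<omega>) u N \<and>
      (\<exists>n\<ge>N. scaled (sample \<omega>) u n \<le> scaled (sample \<omega>) u N / 2)} \<le> 2 * (2 / 3) ^ k"
      by (rule order_trans) simp
  qed
  then show ?thesis
  proof eventually_elim
    case (elim \<omega>)
    then obtain N where N: "u \<le> N" "\<And>n. N \<le> n \<Longrightarrow> \<not> scaled (sample \<omega>) u n \<le> scaled (sample \<omega>) u N / 2"
      by blast
    then have "\<forall>n\<ge>N. scaled (sample \<omega>) u N / 2 < scaled (sample \<omega>) u n" unfolding not_le by blast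
    with N(1) show ?case by blast
  qed
qed

lemma scaled_stable_AE:
  assumes u: "2 \<le> u" and m1: "m = 1"
  shows "AE \<omega> in M. \<exists>N\<ge>u. \<forall>n\<ge>N. scaled (sample \<omega>) u N / 2 < scaled (sample \<omega>) u n \<and>
    scaled (sample \<omega>) u n < 2 * scaled (sample \<omega>) u N"
proof -
  note [measurable] = scaled_borel[OF u] weight_borel[OF u]
  let ?D = "\<lambda>N \<omega>. \<exists>n\<ge>N. scaled (sample \<omega>) u n \<le> scaled (sample \<omega>) u N / 2"
    and ?R = "\<lambda>N \<omega>. \<exists>n\<ge>N. 2 * scaled (sample \<omega>) u N \<le> scaled (sample \<omega>) u n"
  have "AE \<omega> in M. \<exists>N\<ge>u. \<not> (?D N \<omega> \<or> ?R N \<omega>)"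
  proof (rule AE_some_not_bad[OF u])
    show "{\<omega>\<in>space M. ?D N \<omega> \<or> ?R N \<omega>} \<in> events" for N by measurable
    fix N k :: nat assume N: "u \<le> N" "1 \<le> k"
    let ?K = "\<lambda>\<omega>. 4 * real k * slope \<le> weight (sample \<omega>) u N"
    have 1: "{\<omega>\<in>space M. ?K \<omega> \<and> ?D N \<omega>} \<in> events" and 2: "{\<omega>\<in>space M. ?K \<omega> \<and> ?R N \<omega>} \<in> events"
      by measurable
    have "{\<omega>\<in>space M. ?K \<omega> \<and> (?D N \<omega> \<or> ?R N \<omega>)} = {\<omega>\<in>space M. ?K \<omega> \<and> ?D N \<omega>} \<union> {\<omega>\<in>space M. ?K \<omega> \<and> ?R N \<omega>}"
      by blast
    then have "prob {\<omega>\<in>space M. ?K \<omega> \<and> (?D N \<omega> \<or> ?R N \<omega>)} \<le>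
      prob {\<omega>\<in>space M. ?K \<omega> \<and> ?D N \<omega>} + prob {\<omega>\<in>space M. ?K \<omega> \<and> ?R N \<omega>}"
      using measure_Un_le[OF 1 2] by simp
    then show "prob {\<omega>\<in>space M. ?K \<omega> \<and> (?D N \<omega> \<or> ?R N \<omega>)} \<le> 2 * (2 / 3) ^ k"
      using prob_drop[OF u N] prob_rise[OF m1 u N] by linarith
  qed
  then show ?thesis
  proof eventually_elim
    case (elim \<omega>)
    then obtain N where N: "u \<le> N" "\<And>n. N \<le> n \<Longrightarrow> \<not> scaled (sample \<omega>) u n \<le> scaled (sample \<omega>) u N / 2"
        "\<And>n. N \<le> n \<Longrightarrow> \<not> 2 * scaled (sample \<omega>) u N \<le> scaled (sample \<omega>) u n"
      by blast
    then have "\<forall>n\<ge>N. scaled (sample \<omega>) u N / 2 < scaled (sample \<omega>) u n \<and> scaled (sample \<omega>) u n < 2 * scaled (sample \<omega>) u N"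
      unfolding not_le by blast
    with N(1) show ?case by blast
  qed
qed

section \<open>Comparison of cluster size and weight\<close>

lemma exp_gain_le:
  assumes b: "0 \<le> b" and a: "a = b * slope + 1"
  shows "exp (b * gain p u n - a * joins p u n) \<le>
    1 + (exp (b * real m) - 1) * hits p u n - (1 - exp (- 1)) * joins p u n"
proof (cases "joins p u n = 0")
  case True
  have "exp (b * hits p u n) \<le> 1 + (exp (b * real m) - 1) * hits p u n"
  proof (cases "hits p u n < 1")
    case True
    \<comment> \<open>\<open>hits\<close> is a count, so a value below 1 is 0.\<close>
    have "hits p u n = real (card ({1..m} \<inter> {j. fst p (Suc n, j) \<in> cluster p u n}))"
      by (simp add: hits_def)
    then have "hits p u n = 0" using True by simp
    then show ?thesis by simp
  next
    case False
    have "exp (b * hits p u n) \<le> exp (b * real m)"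
      using b hits_bounds(2)[of p u n] by (simp add: mult_left_mono)
    moreover have "(exp (b * real m) - 1) * 1 \<le> (exp (b * real m) - 1) * hits p u n"
      using b False by (intro mult_left_mono) auto
    moreover have "exp (b * real m) = 1 + (exp (b * real m) - 1) * 1" by simp
    ultimately show ?thesis by (metis add_left_mono order_trans)
  qed
  then show ?thesis using True by (simp add: gain_def)
next
  case False
  then have J: "joins p u n = 1" by (simp add: joins_def of_bool_def split: if_splits)
  \<comment> \<open>\<open>a\<close> exceeds the largest possible value of
    \<open>b * gain p u n\<close> by 1, so a joining vertex multiplies the exponential by at most
    \<open>exp (- 1)\<close>.\<close>
  have "b * gain p u n \<le> b * slope" using b gain_bounds(2) by (intro mult_left_mono)
  then have "exp (b * gain p u n - a * joins p u n) \<le> exp (- 1)" using J a by simp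
  moreover have "0 \<le> (exp (b * real m) - 1) * hits p u n"
    using b hits_bounds(1)[of p u n] by (intro mult_nonneg_nonneg) auto
  moreover have "x \<le> 1 + y - (1 - e) * 1" if "x \<le> e" "0 \<le> y" for x y e :: real
    using that by simp
  ultimately show ?thesis unfolding J by blast
qed

text \<open>Hits raise the exponential and joins lower it. Up to a common factor their means are at
  most \<open>m * (1 + m / d)\<close> and exactly \<pi>, and the hypothesis \<open>le\<close> says
  that the joins win.\<close>

lemma exp_supermartingale:
  assumes u: "2 \<le> u" and d: "0 < d" "d \<le> start_weight u" and b: "0 \<le> b" and a: "a = b * slope + 1"
    and le: "(exp (b * real m) - 1) * (real m * (1 + real m / d)) \<le> (1 - exp (- 1)) * \<pi>"
  shows "supermartingale u (\<lambda>n p. exp (b * weight p u n - a * real (card (cluster p u n))))"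
    (is "supermartingale u ?Y")
  unfolding supermartingale_def
proof (intro conjI allI impI)
  have a0: "0 \<le> a" using a b slope_pos by (simp add: add_nonneg_nonneg)
  show det: "determined m (Suc n) 1 (?Y n)" for n
    using weight_agree[OF u] cluster_agree[OF m_pos u] by (intro determinedI) presburger
  show "0 \<le> ?Y n p" for n p by simp
  have bd: "?Y n p \<le> exp (b * (start_weight u + slope * real (n - u)))" for n p
  proof -
    have "b * weight p u n \<le> b * (start_weight u + slope * real (n - u))"
      using b weight_le by (intro mult_left_mono)
    moreover have "0 \<le> a * real (card (cluster p u n))" using a0 by simp
    ultimately show ?thesis by simp
  qed
  then show "\<exists>C. \<forall>p. ?Y n p \<le> C" for n by blast
  fix n and A :: "path \<Rightarrow> bool" assume n: "u \<le> n" and A: "determined m (Suc n) 1 A"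
  define f where "f p = of_bool (A p) * ?Y n p" for p
  have f: "determined m (Suc n) 1 f"
    by (rule determinedI) (simp only: f_def determinedD[OF A] determinedD[OF det])
  have f0: "0 \<le> f p" for p by (simp add: f_def)
  have fC: "f p \<le> exp (b * (start_weight u + slope * real (n - u)))" for p
    using bd[of p n] by (cases "A p") (auto simp: f_def)
  note int = weighted_integrable(2)[OF f f0 fC u n] hits_integrable[OF f f0 fC u n] step_integrable(2)[OF f f0 fC u n]
  let ?e = "exp (b * real m) - 1" and ?i = "1 - exp (- 1) :: real"
  let ?F = "mean (\<lambda>p. f p * weight p u n) / total (Suc n) 1"
  have F: "0 \<le> ?F"
    using mean_weighted_nonneg[OF f f0 fC u n] total_pos[of "Suc n" 1] u n by simp
  have "mean (\<lambda>p. of_bool (A p) * ?Y (Suc n) p) \<le> mean (\<lambda>p. f p + ?e * (f p * hits p u n) - ?i * (f p * joins p u n))"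
  proof (rule integral_mono)
    have A': "determined m (Suc (Suc n)) 1 A" by (rule determined_mono[OF A]) simp
    have "determined m (Suc (Suc n)) 1 (\<lambda>p. of_bool (A p) * ?Y (Suc n) p)"
      by (rule determinedI) (simp only: determinedD[OF A'] determinedD[OF det])
    moreover have "\<bar>of_bool (A p) * ?Y (Suc n) p\<bar> \<le> exp (b * (start_weight u + slope * real (Suc n - u)))" for p
      using bd[of p "Suc n"] by (cases "A p") auto
    ultimately show "integrable M (\<lambda>\<omega>. of_bool (A (sample \<omega>)) * ?Y (Suc n) (sample \<omega>))"
      by (rule determined_integrable)
    show "integrable M (\<lambda>\<omega>. f (sample \<omega>) + ?e * (f (sample \<omega>) * hits (sample \<omega>) u n) - ?i * (f (sample \<omega>) * joins (sample \<omega>) u n))"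
      using int by (intro Bochner_Integration.integrable_diff Bochner_Integration.integrable_add integrable_mult_right)
    fix \<omega> :: 'w
    let ?p = "sample \<omega>"
    have "?Y (Suc n) ?p = ?Y n ?p * exp (b * gain ?p u n - a * joins ?p u n)"
      using card_cluster_Suc[OF n u, of ?p] n
      by (simp add: weight_Suc exp_add[symmetric] algebra_simps)
    also have "\<dots> \<le> ?Y n ?p * (1 + ?e * hits ?p u n - ?i * joins ?p u n)"
      by (intro mult_left_mono exp_gain_le[OF b a]) simp
    finally have "?Y (Suc n) ?p \<le> ?Y n ?p * (1 + ?e * hits ?p u n - ?i * joins ?p u n)" .
    then have "of_bool (A ?p) * ?Y (Suc n) ?p \<le> of_bool (A ?p) * (?Y n ?p * (1 + ?e * hits ?p u n - ?i * joins ?p u n))"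
      by (rule mult_left_mono) simp
    also have "\<dots> = f ?p * (1 + ?e * hits ?p u n - ?i * joins ?p u n)" by (simp only: f_def mult.assoc)
    also have "\<dots> = f ?p + ?e * (f ?p * hits ?p u n) - ?i * (f ?p * joins ?p u n)"
      by (simp only: distrib_left right_diff_distrib mult_1_right mult.left_commute)
    finally show "of_bool (A ?p) * ?Y (Suc n) ?p \<le> f ?p + ?e * (f ?p * hits ?p u n) - ?i * (f ?p * joins ?p u n)" .
  qed
  also have "\<dots> = mean f + ?e * mean (\<lambda>p. f p * hits p u n) - ?i * mean (\<lambda>p. f p * joins p u n)"
    using int by (simp del: left_diff_distrib)
  also have "\<dots> \<le> mean f + ?e * (real m * (1 + real m / d) * ?F) - ?i * (\<pi> * ?F)"
    using mean_hits_le[OF f f0 fC u n d] mean_hit_bounds(3)[OF f f0 fC u n order.refl m_pos] b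
    by (intro diff_mono add_mono mult_left_mono) auto
  also have "\<dots> = mean f + (?e * (real m * (1 + real m / d)) - ?i * \<pi>) * ?F"
    by (simp only: left_diff_distrib mult.assoc add_diff_eq)
  also have "\<dots> \<le> mean f + 0"
    by (intro add_left_mono mult_nonpos_nonneg F) (use le in simp)
  also have "\<dots> = mean f" by simp
  finally show "mean (\<lambda>p. of_bool (A p) * ?Y (Suc n) p) \<le> mean (\<lambda>p. of_bool (A p) * ?Y n p)"
    by (simp only: f_def)
qed

text \<open>\<open>a\<close> and \<open>b\<close> are the same for all roots and outcomes, only
  \<open>K\<close> is random; this later makes the constant \<open>C\<close> for trees
  nonrandom.\<close>

lemma size_vs_weight:
  obtains a b where "0 < a" "0 < b" "\<And>u. 2 \<le> u \<Longrightarrow>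
    AE \<omega> in M. \<exists>K. \<forall>n\<ge>u. b * weight (sample \<omega>) u n \<le> a * real (card (cluster (sample \<omega>) u n)) + K"
proof -
  \<comment> \<open>Only two starting weights occur, one for the index 2 and one for all later
    roots; \<open>d\<close> is their minimum.\<close>
  define d where "d = min (total 3 1) (real m + \<delta>)"
  have d: "0 < d" "d \<le> start_weight u" for u
    using total_pos[of 3 1] mdelta_pos by (auto simp: d_def start_weight_def)
  define k where "k = real m * (1 + real m / d)"
  have k: "0 < k" using m_pos d(1) by (auto simp: k_def intro!: mult_pos_pos add_pos_nonneg)
  \<comment> \<open>\<open>t\<close>, and with it \<open>b\<close>, is chosen so that the hypothesis
    \<open>le\<close> of \<open>exp_supermartingale\<close> holds with equality.\<close>
  define t where "t = (1 - exp (- 1)) * \<pi> / k"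
  have "exp (- 1) < (1 :: real)" by simp
  then have t: "0 < t" using k pi_pos by (simp add: t_def)
  define b where "b = ln (1 + t) / real m"
  define a where "a = b * slope + 1"
  have b: "0 < b" using t m_pos by (simp add: b_def ln_gt_zero)
  have a: "0 < a" using b slope_pos by (simp add: a_def add_pos_pos)
  have "b * real m = ln (1 + t)" using m_pos by (simp add: b_def)
  then have "exp (b * real m) - 1 = t" using t by (simp only: exp_ln_iff) simp
  then have le: "(exp (b * real m) - 1) * k \<le> (1 - exp (- 1)) * \<pi>" using k by (simp add: t_def)
  have "AE \<omega> in M. \<exists>K. \<forall>n\<ge>u. b * weight (sample \<omega>) u n \<le> a * real (card (cluster (sample \<omega>) u n)) + K"
    if u: "2 \<le> u" for u
    using supermartingale_bounded_AE[OF exp_supermartingale[OF u d(1) d(2) less_imp_le[OF b] a_def le[unfolded k_def]]]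
  proof eventually_elim
    case (elim \<omega>)
    then obtain K where K: "\<And>n. u \<le> n \<Longrightarrow> exp (b * weight (sample \<omega>) u n - a * real (card (cluster (sample \<omega>) u n))) \<le> K"
      by blast
    have "0 < K" using K[OF order.refl] exp_gt_zero by (rule less_le_trans[rotated])
    have "b * weight (sample \<omega>) u n \<le> a * real (card (cluster (sample \<omega>) u n)) + ln K" if "u \<le> n" for n
    proof -
      have "b * weight (sample \<omega>) u n - a * real (card (cluster (sample \<omega>) u n)) \<le> ln K"
        using K[OF that] \<open>0 < K\<close> by (simp only: ln_ge_iff)
      then show ?thesis by simp
    qed
    then show ?case by blast
  qed
  with a b that show ?thesis by blast
qed

text \<open>All roots \<open>u\<close> \<ge> 3 have the same starting weight, so
  \<open>prob_tail\<close> decays like \<open>u\<close> to the power \<open>- k * exponent\<close>,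
  and Borel-Cantelli leaves finitely many roots.\<close>

lemma scaled_tail_AE:
  assumes m1: "m = 1" and l: "0 < l"
  shows "AE \<omega> in M. eventually (\<lambda>u. \<forall>n\<ge>u. scaled (sample \<omega>) u n < l) sequentially"
proof -
  define A where "A u = (if 2 \<le> u then {\<omega>\<in>space M. \<exists>n\<ge>u. l \<le> scaled (sample \<omega>) u n} else {})" for u
  have A: "A u \<in> events" for u
  proof (cases "2 \<le> u")
    case True
    note [measurable] = scaled_borel[OF True]
    show ?thesis unfolding A_def using True by simp measurable
  qed (simp add: A_def)
  obtain c C where c: "0 < c" and gr: "eventually (\<lambda>n. c * real n powr exponent \<le> growth n \<and>
    growth n \<le> C * real n powr exponent) sequentially" using growth_bounds by blast
  \<comment> \<open>Any \<open>k * exponent\<close> above 1 gives a convergent sum; 2 leaves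
    room.\<close>
  obtain k :: nat where k: "2 / exponent < real k" using reals_Archimedean2 by blast
  have k1: "2 < real k * exponent" using k exponent_pos by (simp add: pos_divide_less_eq)
  define D where "D = ((real m + \<delta> + real k * slope) / (l * c)) ^ k"
  have "summable (\<lambda>u. prob (A u))"
  proof (rule summable_comparison_test_ev)
    show "eventually (\<lambda>u. norm (prob (A u)) \<le> D * real u powr (- (real k * exponent))) sequentially"
      using gr eventually_ge_at_top[of 3]
    proof eventually_elim
      case (elim u)
      then have u: "2 \<le> u" "u \<noteq> 2" by auto
      have up: "0 < real u powr exponent" using u by simp
      have num: "0 \<le> real m + \<delta> + real k * slope"
      proof -
        have "0 \<le> real k * slope" using slope_pos by (intro mult_nonneg_nonneg) auto
        then show ?thesis using mdelta_pos by linarith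
      qed
      have "prob (A u) \<le> ((real m + \<delta> + real k * slope) / (l * growth u)) ^ k"
        using prob_tail[OF m1 u(1) l, of k] u by (simp add: A_def start_weight_def)
      also have "\<dots> \<le> ((real m + \<delta> + real k * slope) / (l * (c * real u powr exponent))) ^ k"
        using elim(1) l c up num growth_pos[of u]
        by (intro power_mono divide_left_mono mult_left_mono mult_pos_pos divide_nonneg_nonneg mult_nonneg_nonneg) auto
      also have "\<dots> = ((real m + \<delta> + real k * slope) / (l * c) * real u powr (- exponent)) ^ k"
        by (simp add: powr_minus field_simps)
      also have "\<dots> = D * real u powr (- (real k * exponent))"
        using u by (simp only: power_mult_distrib D_def) (simp add: powr_power mult.commute)
      finally show ?case by simp
    qed
    show "summable (\<lambda>u. D * real u powr (- (real k * exponent)))"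
      using k1 by (intro summable_mult) (simp add: summable_real_powr_iff)
  qed
  then have "AE \<omega> in M. eventually (\<lambda>u. \<omega> \<in> space M - A u) sequentially"
    by (intro borel_cantelli_AE1[OF A]) (simp_all add: emeasure_eq_measure)
  then show ?thesis using AE_space
  proof eventually_elim
    case (elim \<omega>)
    from elim(1) eventually_ge_at_top[of 2] show ?case
    proof eventually_elim
      case (elim u)
      with \<open>\<omega> \<in> space M\<close> have "\<not> (\<exists>n\<ge>u. l \<le> scaled (sample \<omega>) u n)" by (simp add: A_def)
      then show ?case by (meson not_le)
    qed
  qed
qed

end

section \<open>The largest component\<close>

lemma liminf_real_between:
  fixes g :: "nat \<Rightarrow> real"
  assumes "eventually (\<lambda>n. l \<le> g n \<and> g n \<le> h) sequentially"
  shows "l \<le> real_of_ereal (liminf (\<lambda>n. ereal (g n)))" "real_of_ereal (liminf (\<lambda>n. ereal (g n))) \<le> h"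
proof -
  have 1: "ereal l \<le> liminf (\<lambda>n. ereal (g n))"
    by (rule Liminf_bounded) (use assms in \<open>auto elim: eventually_mono\<close>)
  have "liminf (\<lambda>n. ereal (g n)) \<le> limsup (\<lambda>n. ereal (g n))"
    by (rule Liminf_le_Limsup) simp
  also have "\<dots> \<le> ereal h"
    by (rule Limsup_bounded) (use assms in \<open>auto elim: eventually_mono\<close>)
  finally have 2: "liminf (\<lambda>n. ereal (g n)) \<le> ereal h" .
  from 1 2 show "l \<le> real_of_ereal (liminf (\<lambda>n. ereal (g n)))" "real_of_ereal (liminf (\<lambda>n. ereal (g n))) \<le> h"
    by (cases "liminf (\<lambda>n. ereal (g n))"; simp)+
qed

context pa_setting begin

abbreviation largest :: "'w \<Rightarrow> nat \<Rightarrow> nat" where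
  "largest \<omega> n \<equiv> largest_component E m (\<lambda>e. X e \<omega>) (\<lambda>e. B e \<omega>) n"

lemma cluster_le_largest: "2 \<le> u \<Longrightarrow> u \<le> n \<Longrightarrow> card (cluster (sample \<omega>) u n) \<le> 2 * largest \<omega> n"
  unfolding sample_def by (rule card_cluster_le_largest[OF m_pos])

text \<open>The cluster with index 2 is large enough: its size is bounded below by its weight, its
  weight by \<open>growth\<close>.\<close>

lemma largest_lower_AE: "AE \<omega> in M. \<exists>\<kappa>>0. eventually (\<lambda>n. \<kappa> * real n powr exponent \<le> real (largest \<omega> n)) sequentially"
proof -
  obtain a b where ab: "0 < a" "0 < b" and size: "\<And>u. 2 \<le> u \<Longrightarrow>
    AE \<omega> in M. \<exists>K. \<forall>n\<ge>u. b * weight (sample \<omega>) u n \<le> a * real (card (cluster (sample \<omega>) u n)) + K"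
    using size_vs_weight by blast
  obtain c C where c: "0 < c" and gr: "eventually (\<lambda>n. c * real n powr exponent \<le> growth n \<and>
    growth n \<le> C * real n powr exponent) sequentially" using growth_bounds by blast
  from size[OF order.refl] scaled_bounded_below_AE[OF order.refl] show ?thesis
  proof eventually_elim
    case (elim \<omega>)
    obtain K where K: "\<And>n. 2 \<le> n \<Longrightarrow> b * weight (sample \<omega>) 2 n \<le> a * real (card (cluster (sample \<omega>) 2 n)) + K"
      using elim by blast
    obtain N where N: "2 \<le> N" "\<And>n. N \<le> n \<Longrightarrow> scaled (sample \<omega>) 2 N / 2 < scaled (sample \<omega>) 2 n"
      using elim by blast
    define s where "s = scaled (sample \<omega>) 2 N / 2"
    have s: "0 < s" using scaled_pos by (simp add: s_def)
    have "filterlim (\<lambda>n. (b * s / 2) * growth n) at_top sequentially"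
      using ab s by (intro filterlim_tendsto_pos_mult_at_top[OF tendsto_const _ growth_at_top]) simp
    then have "eventually (\<lambda>n. K \<le> (b * s / 2) * growth n) sequentially"
      by (simp add: filterlim_at_top)
    \<comment> \<open>In the 4, one factor 2 is spent on absorbing the random \<open>K\<close>, the
      other on \<open>cluster_le_largest\<close>.\<close>
    then have "eventually (\<lambda>n. b * s * c / (4 * a) * real n powr exponent \<le> real (largest \<omega> n)) sequentially"
      using gr eventually_ge_at_top[of N]
    proof eventually_elim
      case (elim n)
      have n: "2 \<le> n" using N elim by simp
      have "s * growth n \<le> weight (sample \<omega>) 2 n"
      proof -
        have "s < scaled (sample \<omega>) 2 n" unfolding s_def by (rule N(2)[OF elim(3)])
        then show ?thesis using growth_pos[of n] by (simp add: scaled_def pos_less_divide_eq)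
      qed
      then have "b * (s * growth n) \<le> b * weight (sample \<omega>) 2 n" using ab by simp
      also have "\<dots> \<le> a * real (card (cluster (sample \<omega>) 2 n)) + K" by (rule K[OF n])
      also have "a * real (card (cluster (sample \<omega>) 2 n)) \<le> a * (2 * real (largest \<omega> n))"
        using cluster_le_largest[of 2 n \<omega>] n ab by (intro mult_left_mono) linarith+
      finally have 1: "b * s / 2 * growth n \<le> a * 2 * real (largest \<omega> n)" using elim(1) by (simp add: algebra_simps)
      have "b * s / 2 * (c * real n powr exponent) \<le> b * s / 2 * growth n"
        using elim ab s by (intro mult_left_mono) auto
      with 1 have "b * s * c * real n powr exponent \<le> (4 * a) * real (largest \<omega> n)" by (simp add: algebra_simps)
      then show ?case using ab by (simp add: pos_divide_le_eq mult.commute)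
    qed
    moreover have "0 < b * s * c / (4 * a)" using ab s c by simp
    ultimately show ?case by blast
  qed
qed

text \<open>A proxy for the largest component. It depends on the \<open>path\<close> alone and not
  on the retention of the initial edges, so it is adapted; for \<open>m = 1\<close> the two agree
  almost surely up to a factor 2.\<close>

definition max_cluster :: "path \<Rightarrow> nat \<Rightarrow> nat" where
  "max_cluster p n = Max ((\<lambda>u. card (cluster p u n)) ` {2..n})"

lemma max_cluster_borel: "(\<lambda>\<omega>. real (max_cluster (sample \<omega>) n)) \<in> borel_measurable M"
proof (rule determined_borel[of "Suc n" 1], rule determinedI)
  fix p q assume a: "agree m (Suc n) 1 p q"
  have "(\<lambda>u. card (cluster p u n)) ` {2..n} = (\<lambda>u. card (cluster q u n)) ` {2..n}"
    by (rule image_cong) (use cluster_agree[OF m_pos _ a] in auto)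
  then show "real (max_cluster p n) = real (max_cluster q n)" by (simp add: max_cluster_def)
qed

lemma cluster_le_max: "2 \<le> u \<Longrightarrow> u \<le> n \<Longrightarrow> card (cluster p u n) \<le> max_cluster p n"
  unfolding max_cluster_def by (rule Max_ge) auto

lemma max_cluster_attained: "2 \<le> n \<Longrightarrow> \<exists>u\<in>{2..n}. max_cluster p n = card (cluster p u n)"
proof -
  assume "2 \<le> n"
  then have "max_cluster p n \<in> (\<lambda>u. card (cluster p u n)) ` {2..n}"
    unfolding max_cluster_def by (intro Max_in) auto
  then show ?thesis by auto
qed

lemma max_cluster_le_largest: "2 \<le> n \<Longrightarrow> max_cluster (sample \<omega>) n \<le> 2 * largest \<omega> n"
  using max_cluster_attained[of n "sample \<omega>"] cluster_le_largest[of _ n \<omega>] by auto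

lemma largest_le_max_cluster_AE:
  assumes m1: "m = 1" shows "AE \<omega> in M. \<forall>n\<ge>2. largest \<omega> n \<le> max_cluster (sample \<omega>) n"
proof -
  have "AE \<omega> in M. \<forall>v. valid m v 1 (\<lambda>e. X e \<omega>)"
    using valid_AE by (simp add: AE_all_countable)
  then show ?thesis
  proof eventually_elim
    case (elim \<omega>)
    show ?case
    proof (intro allI impI)
      fix n :: nat assume n: "2 \<le> n"
      have "1 \<le> X (v, 1) \<omega> \<and> X (v, 1) \<omega> < v" if "3 \<le> v" "v \<le> n" for v
      proof -
        have "(v, 1) \<in> edges_before m (Suc v) 1" using that m_pos by (auto simp: edges_before_def new_edges_def)
        then show ?thesis using elim[rule_format, of "Suc v"] by (auto simp: valid_def)
      qed
      from largest_le_cluster[of E n "\<lambda>e. X e \<omega>" "\<lambda>e. B e \<omega>", OF init_graph this n]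
      obtain u where "u \<in> {2..n}" "largest \<omega> n \<le> card (cluster (sample \<omega>) u n)"
        unfolding m1 sample_def by auto
      then show "largest \<omega> n \<le> max_cluster (sample \<omega>) n" using cluster_le_max[of u n "sample \<omega>"] by simp
    qed
  qed
qed

text \<open>The level \<open>l\<close> is random, the ratio \<open>C\<close> is not. Finitely many
  roots up to \<open>V\<close> each stay within a factor 2 of a value \<open>s u\<close>, and all
  later roots stay below \<open>s 2\<close>; so the largest \<open>s u\<close> with \<open>u\<close>
  \<le> \<open>V\<close> governs the maximum.\<close>

lemma max_cluster_bounds_AE:
  assumes m1: "m = 1"
  obtains C where "0 < C" "AE \<omega> in M. \<exists>l>0. eventually (\<lambda>n.
    l \<le> real (max_cluster (sample \<omega>) n) / real n powr exponent \<and>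
    real (max_cluster (sample \<omega>) n) / real n powr exponent \<le> C * l) sequentially"
proof -
  obtain a b where ab: "0 < a" "0 < b" and size: "\<And>u. 2 \<le> u \<Longrightarrow>
    AE \<omega> in M. \<exists>K. \<forall>n\<ge>u. b * weight (sample \<omega>) u n \<le> a * real (card (cluster (sample \<omega>) u n)) + K"
    using size_vs_weight by blast
  obtain c c' where c: "0 < c" "0 < c'" and gr: "eventually (\<lambda>n. c * real n powr exponent \<le> growth n \<and>
    growth n \<le> c' * real n powr exponent) sequentially" using growth_bounds by blast
  define q where "q = real m + \<delta>"
  have q: "0 < q" using mdelta_pos by (simp add: q_def)
  \<comment> \<open>The quotient of the upper constant \<open>3 * S * c' / q\<close> and the lower
    one \<open>l = b * S * c / (4 * a)\<close>; the random \<open>S\<close> cancels.\<close>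
  define C where "C = 12 * c' * a / (q * b * c)"
  have C: "0 < C" using ab c q by (simp add: C_def)
  have AE1: "AE \<omega> in M. \<forall>u\<in>{2..}. \<exists>K. \<forall>n\<ge>u. b * weight (sample \<omega>) u n \<le> a * real (card (cluster (sample \<omega>) u n)) + K"
    by (subst AE_ball_countable) (use size in auto)
  have AE2: "AE \<omega> in M. \<forall>u\<in>{2..}. \<exists>N\<ge>u. \<forall>n\<ge>N. scaled (sample \<omega>) u N / 2 < scaled (sample \<omega>) u n \<and>
    scaled (sample \<omega>) u n < 2 * scaled (sample \<omega>) u N"
    by (subst AE_ball_countable) (use scaled_stable_AE[OF _ m1] in auto)
  have "AE \<omega> in M. \<forall>i. eventually (\<lambda>u. \<forall>n\<ge>u. scaled (sample \<omega>) u n < 1 / real (Suc i)) sequentially"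
    by (subst AE_all_countable) (use scaled_tail_AE[OF m1] in auto)
  with AE1 AE2 have "AE \<omega> in M. \<exists>l>0. eventually (\<lambda>n.
    l \<le> real (max_cluster (sample \<omega>) n) / real n powr exponent \<and>
    real (max_cluster (sample \<omega>) n) / real n powr exponent \<le> C * l) sequentially"
  proof eventually_elim
    case (elim \<omega>)
    let ?p = "sample \<omega>"
    from elim(2) obtain N where N: "\<And>u n. 2 \<le> u \<Longrightarrow> N u \<le> n \<Longrightarrow>
        scaled ?p u (N u) / 2 < scaled ?p u n \<and> scaled ?p u n < 2 * scaled ?p u (N u)"
      and Nu: "\<And>u. 2 \<le> u \<Longrightarrow> u \<le> N u"
      unfolding Ball_def atLeast_iff by metis
    define s where "s u = scaled ?p u (N u)" for u
    have s: "0 < s u" for u unfolding s_def by (rule scaled_pos)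
    \<comment> \<open>The tail estimate holds simultaneously for countably many levels
      \<open>1 / real (Suc i)\<close>; one of them lies below the random \<open>s 2\<close>.\<close>
    obtain i where i: "1 / real (Suc i) < s 2"
      using reals_Archimedean[OF s[of 2]] by (auto simp: inverse_eq_divide)
    obtain V0 where V0: "\<And>u n. V0 \<le> u \<Longrightarrow> u \<le> n \<Longrightarrow> scaled ?p u n < 1 / real (Suc i)"
      using elim(3)[rule_format, of i] by (auto simp: eventually_sequentially)
    define V where "V = max V0 2"
    define S where "S = Max (s ` {2..V})"
    have "S \<in> s ` {2..V}" unfolding S_def by (rule Max_in) (auto simp: V_def)
    then obtain u0 where u0: "2 \<le> u0" "u0 \<le> V" "S = s u0" by auto
    have S: "s u \<le> S" if "2 \<le> u" "u \<le> V" for u unfolding S_def using that by (intro Max_ge) auto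
    have S0: "0 < S" using u0 s by simp
    define N1 where "N1 = Max (N ` {2..V})"
    have N1: "N u \<le> N1" if "2 \<le> u" "u \<le> V" for u unfolding N1_def using that by (intro Max_ge) auto
    have upper: "scaled ?p u n \<le> 2 * S" if "2 \<le> u" "u \<le> n" "N1 \<le> n" for u n
    proof (cases "u \<le> V")
      case True
      then have "scaled ?p u n < 2 * s u"
        using N[OF that(1), of n] N1[OF that(1) True] that unfolding s_def by simp
      then show ?thesis using S[OF that(1) True] by simp
    next
      case False
      then have "V0 \<le> u" by (simp add: V_def)
      then have "scaled ?p u n < s 2" using V0[of u n] that i by linarith
      also have "s 2 \<le> S" by (rule S) (auto simp: V_def)
      finally show ?thesis using S0 by simp
    qed
    obtain K where K: "\<And>n. u0 \<le> n \<Longrightarrow> b * weight ?p u0 n \<le> a * real (card (cluster ?p u0 n)) + K"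
      using elim(1) u0(1) by auto
    define l where "l = b * S * c / (4 * a)"
    have l: "0 < l" using ab S0 c by (simp add: l_def)
    have Cl: "C * l = 3 * S * c' / q" using ab c q S0 by (simp add: C_def l_def)
    have big: "eventually (\<lambda>n. z \<le> y * growth n) sequentially" if "0 < y" for y z
    proof -
      have "filterlim (\<lambda>n. y * growth n) at_top sequentially"
        by (rule filterlim_tendsto_pos_mult_at_top[OF tendsto_const that growth_at_top])
      then show ?thesis by (simp add: filterlim_at_top)
    qed
    have "0 < b * S / 4" "0 < S / q" using ab S0 q by simp_all
    from big[OF this(1), of K] big[OF this(2), of 2] gr eventually_ge_at_top[of "max (max N1 u0) (max (N u0) 2)"]
    have "eventually (\<lambda>n. l \<le> real (max_cluster ?p n) / real n powr exponent \<and>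
        real (max_cluster ?p n) / real n powr exponent \<le> C * l) sequentially"
    proof eventually_elim
      case (elim n)
      have n: "N1 \<le> n" "u0 \<le> n" "N u0 \<le> n" "2 \<le> n" using elim(4) by auto
      have np: "0 < real n powr exponent" using n by simp
      have "S / 2 * growth n \<le> weight ?p u0 n"
        using N[OF u0(1) n(3)] growth_pos[of n] by (simp add: scaled_def u0(3) s_def pos_less_divide_eq)
      then have "b * (S / 2 * growth n) \<le> b * weight ?p u0 n" using ab by (intro mult_left_mono) auto
      also have "\<dots> \<le> a * real (card (cluster ?p u0 n)) + K" by (rule K[OF n(2)])
      finally have "b * S / 4 * growth n \<le> a * real (card (cluster ?p u0 n))" using elim(1) by simp
      also have "\<dots> \<le> a * real (max_cluster ?p n)"
        using cluster_le_max[OF u0(1) n(2), of ?p] ab by (intro mult_left_mono) auto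
      finally have 1: "b * S / 4 * growth n \<le> a * real (max_cluster ?p n)" .
      have "b * S / 4 * (c * real n powr exponent) \<le> b * S / 4 * growth n"
        using elim(3) ab S0 by (intro mult_left_mono) auto
      then have "l * real n powr exponent * a \<le> real (max_cluster ?p n) * a"
        using 1 ab by (simp add: l_def mult_ac)
      then have low: "l * real n powr exponent \<le> real (max_cluster ?p n)"
        using ab by (simp only: mult_le_cancel_right_pos)
      obtain u where u: "u \<in> {2..n}" "max_cluster ?p n = card (cluster ?p u n)"
        using max_cluster_attained[OF n(4)] by blast
      have "real (max_cluster ?p n) \<le> weight ?p u n / q + 2"
        using card_cluster_le_weight[of u n ?p] u by (simp add: q_def)
      also have "weight ?p u n \<le> 2 * S * growth n"
        using upper[of u n] u n growth_pos[of n] by (simp add: scaled_def pos_divide_le_eq)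
      then have "weight ?p u n / q \<le> 2 * S * growth n / q" using q by (intro divide_right_mono) auto
      \<comment> \<open>The 2 coming from the root is absorbed by a third multiple of
        \<open>S / q * growth n\<close>.\<close>
      also have "2 * S * growth n / q + 2 \<le> 3 * S / q * growth n"
      proof -
        have "3 * S / q * growth n = 2 * S * growth n / q + S / q * growth n"
          by (simp add: divide_inverse algebra_simps)
        then show ?thesis using elim(2) by linarith
      qed
      also have "\<dots> \<le> 3 * S / q * (c' * real n powr exponent)"
        using elim(3) S0 q by (intro mult_left_mono) auto
      finally have "real (max_cluster ?p n) \<le> C * l * real n powr exponent" by (simp add: Cl)
      with low show ?case using np by (simp add: pos_le_divide_eq pos_divide_le_eq)
    qed
    with l show ?case by blast
  qed
  with C that show ?thesis by blast
qed

text \<open>The factor \<kappa> of \<open>largest_lower_AE\<close> is random, but \<epsilon> must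
  not be. The correction of the exponent amounts to a factor \<open>1 / ln (real n)\<close>, which
  eventually falls below every \<kappa>.\<close>

lemma lower_bound_AE:
  "AE \<omega> in M. eventually (\<lambda>n. real n powr (exponent + - ln (ln (real n)) / ln (real n)) \<le> real (largest \<omega> n)) sequentially"
  using largest_lower_AE
proof eventually_elim
  case (elim \<omega>)
  then obtain \<kappa> where \<kappa>: "0 < \<kappa>" "eventually (\<lambda>n. \<kappa> * real n powr exponent \<le> real (largest \<omega> n)) sequentially" by blast
  have "filterlim (\<lambda>n. ln (real n)) at_top sequentially"
    by (rule filterlim_compose[OF ln_at_top filterlim_real_sequentially])
  then have "eventually (\<lambda>n. 1 / \<kappa> \<le> ln (real n)) sequentially" by (simp add: filterlim_at_top)
  from \<kappa>(2) this eventually_gt_at_top[of 1] show ?case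
  proof eventually_elim
    case (elim n)
    have ln: "0 < ln (real n)" using elim by simp
    have "real n powr (exponent + - ln (ln (real n)) / ln (real n)) = real n powr exponent * (1 / ln (real n))"
    proof -
      have "(exponent + - ln (ln (real n)) / ln (real n)) * ln (real n) = exponent * ln (real n) - ln (ln (real n))"
        using ln by (simp add: left_diff_distrib)
      moreover have "real n \<noteq> 0" using elim by simp
      ultimately show ?thesis using ln by (simp only: powr_def if_False exp_diff exp_ln) simp
    qed
    also have "\<dots> \<le> real n powr exponent * \<kappa>"
      using elim(2) ln \<kappa>(1) by (intro mult_left_mono) (auto simp: field_simps)
    finally show ?case using elim(1) by (simp add: mult.commute)
  qed
qed

lemma ln_ln_over_ln_tendsto_0: "(\<lambda>n. - ln (ln (real n)) / ln (real n)) \<longlonglongrightarrow> 0"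
proof -
  have "filterlim (\<lambda>n. ln (real n)) at_top sequentially"
    by (rule filterlim_compose[OF ln_at_top filterlim_real_sequentially])
  from filterlim_compose[OF ln_x_over_x_tendsto_0 this] show ?thesis
    using tendsto_minus by fastforce
qed

text \<open>The scaled maximum need not be known to converge: its liminf lies between
  \<open>l\<close> and \<open>C * l\<close>, which suffices for nonrandom constants.\<close>

lemma tree_bounds:
  assumes m1: "m = 1"
  shows "\<exists>W :: 'w \<Rightarrow> real. W \<in> borel_measurable M \<and> (AE \<omega> in M. W \<omega> > 0) \<and>
    (\<exists>c>0. \<exists>C>0. AE \<omega> in M. eventually (\<lambda>n.
      c * (W \<omega> * real n powr exponent) \<le> real (largest \<omega> n) \<and>
      real (largest \<omega> n) \<le> C * (W \<omega> * real n powr exponent)) sequentially)"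
proof -
  let ?g = "\<lambda>\<omega> n. real (max_cluster (sample \<omega>) n) / real n powr exponent"
  \<comment> \<open>\<open>real_of_ereal\<close> makes \<open>W\<close> finite everywhere; its
    convention for infinite values matters on a null set only.\<close>
  define W where "W \<omega> = real_of_ereal (liminf (\<lambda>n. ereal (?g \<omega> n)))" for \<omega>
  obtain C where C: "0 < C" and AE: "AE \<omega> in M. \<exists>l>0. eventually (\<lambda>n. l \<le> ?g \<omega> n \<and> ?g \<omega> n \<le> C * l) sequentially"
    using max_cluster_bounds_AE[OF m1] by blast
  have W_meas: "W \<in> borel_measurable M"
  proof -
    have [measurable]: "(\<lambda>\<omega>. ?g \<omega> n) \<in> borel_measurable M" for n
      by (rule borel_measurable_divide[OF max_cluster_borel borel_measurable_const])
    show ?thesis unfolding W_def by measurable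
  qed
  have AE': "AE \<omega> in M. 0 < W \<omega> \<and> eventually (\<lambda>n.
      1 / (2 * C) * (W \<omega> * real n powr exponent) \<le> real (largest \<omega> n) \<and>
      real (largest \<omega> n) \<le> C * (W \<omega> * real n powr exponent)) sequentially"
    using AE largest_le_max_cluster_AE[OF m1]
  proof eventually_elim
    case (elim \<omega>)
    then obtain l where l: "0 < l" "eventually (\<lambda>n. l \<le> ?g \<omega> n \<and> ?g \<omega> n \<le> C * l) sequentially" by blast
    have W: "l \<le> W \<omega>" "W \<omega> \<le> C * l"
      unfolding W_def using liminf_real_between[OF l(2)] by auto
    from l(2) eventually_ge_at_top[of 2] have "eventually (\<lambda>n.
      1 / (2 * C) * (W \<omega> * real n powr exponent) \<le> real (largest \<omega> n) \<and>
      real (largest \<omega> n) \<le> C * (W \<omega> * real n powr exponent)) sequentially"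
    proof eventually_elim
      case (elim n)
      let ?r = "real n powr exponent" and ?m = "real (max_cluster (sample \<omega>) n)"
      have r: "0 < ?r" using elim by simp
      have m: "l * ?r \<le> ?m" "?m \<le> C * l * ?r" using elim(1) r by (auto simp: pos_le_divide_eq pos_divide_le_eq)
      have "W \<omega> * ?r \<le> C * l * ?r" using W(2) r by (intro mult_right_mono) auto
      also have "\<dots> = C * (l * ?r)" by simp
      also have "\<dots> \<le> C * ?m" using m(1) C by (intro mult_left_mono) auto
      also have "\<dots> \<le> C * (2 * real (largest \<omega> n))"
        using max_cluster_le_largest[OF elim(2), of \<omega>] C by (intro mult_left_mono) linarith+
      finally have 1: "1 / (2 * C) * (W \<omega> * ?r) \<le> real (largest \<omega> n)" using C by (simp add: field_simps)
      have "real (largest \<omega> n) \<le> ?m" using \<open>\<forall>n\<ge>2. largest \<omega> n \<le> max_cluster (sample \<omega>) n\<close> elim(2) by simp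
      also have "\<dots> \<le> C * (l * ?r)" using m(2) by simp
      also have "\<dots> \<le> C * (W \<omega> * ?r)" using W(1) C r by (intro mult_left_mono mult_right_mono) auto
      finally show ?case using 1 by simp
    qed
    with l(1) W(1) show ?case by simp
  qed
  have c: "0 < 1 / (2 * C)" using C by simp
  have "AE \<omega> in M. W \<omega> > 0" using AE' by eventually_elim simp
  moreover have "AE \<omega> in M. eventually (\<lambda>n.
      1 / (2 * C) * (W \<omega> * real n powr exponent) \<le> real (largest \<omega> n) \<and>
      real (largest \<omega> n) \<le> C * (W \<omega> * real n powr exponent)) sequentially"
    using AE' by eventually_elim simp
  ultimately show ?thesis using W_meas c C by blast
qed

end

theorem mainTheorem10:
  fixes M :: "'w measure" and E :: "(nat \<times> nat) list" and m :: nat and \<delta> \<pi> :: real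
    and X :: "nat \<times> nat \<Rightarrow> 'w \<Rightarrow> nat" and B :: "edge \<Rightarrow> 'w \<Rightarrow> bool"
  assumes "m \<ge> 1" and "\<delta> > - real m" and "0 < \<pi>" and "\<pi> \<le> 1"
    and "percolated_pa M E m \<delta> \<pi> X B"
  shows "(\<exists>c>0. \<exists>\<epsilon> :: nat \<Rightarrow> real. \<epsilon> \<longlonglongrightarrow> 0 \<and>
            (AE \<omega> in M. \<forall>\<^sub>F n in sequentially.
               c * real n powr (1 - chi m \<delta> + \<pi> * chi m \<delta> + \<epsilon> n)
                 \<le> real (largest_component E m (\<lambda>e. X e \<omega>) (\<lambda>e. B e \<omega>) n)))
       \<and> (m = 1 \<longrightarrow>
           (\<exists>W :: 'w \<Rightarrow> real. W \<in> borel_measurable M \<and> (AE \<omega> in M. W \<omega> > 0) \<and>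
             (\<exists>c>0. \<exists>C>0. \<exists>\<epsilon> :: nat \<Rightarrow> real. \<epsilon> \<longlonglongrightarrow> 0 \<and>
               (AE \<omega> in M. \<forall>\<^sub>F n in sequentially.
                  c * (W \<omega> * real n powr (1 - chi m \<delta> + \<pi> * chi m \<delta> + \<epsilon> n))
                    \<le> real (largest_component E m (\<lambda>e. X e \<omega>) (\<lambda>e. B e \<omega>) n) \<and>
                  real (largest_component E m (\<lambda>e. X e \<omega>) (\<lambda>e. B e \<omega>) n)
                    \<le> C * (W \<omega> * real n powr (1 - chi m \<delta> + \<pi> * chi m \<delta> + \<epsilon> n))))))"
proof -
  interpret percolated_pa M E m \<delta> \<pi> X B by (fact assms(5))
  interpret pa_setting M E m \<delta> \<pi> X B by unfold_locales (use assms in auto)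
  show ?thesis
  proof (intro conjI impI)
    show "\<exists>c>0. \<exists>\<epsilon> :: nat \<Rightarrow> real. \<epsilon> \<longlonglongrightarrow> 0 \<and>
            (AE \<omega> in M. \<forall>\<^sub>F n in sequentially.
               c * real n powr (1 - chi m \<delta> + \<pi> * chi m \<delta> + \<epsilon> n) \<le> real (largest \<omega> n))"
      using ln_ln_over_ln_tendsto_0 lower_bound_AE unfolding exponent_eq
      by (intro exI[of _ 1] conjI exI[of _ "\<lambda>n. - ln (ln (real n)) / ln (real n)"]) simp_all
    assume "m = 1"
    from tree_bounds[OF this] obtain W :: "'w \<Rightarrow> real" and c C where W: "W \<in> borel_measurable M" "AE \<omega> in M. W \<omega> > 0"
      "0 < c" "0 < C" "AE \<omega> in M. eventually (\<lambda>n.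
      c * (W \<omega> * real n powr exponent) \<le> real (largest \<omega> n) \<and>
      real (largest \<omega> n) \<le> C * (W \<omega> * real n powr exponent)) sequentially" by blast
    show "\<exists>W :: 'w \<Rightarrow> real. W \<in> borel_measurable M \<and> (AE \<omega> in M. W \<omega> > 0) \<and>
             (\<exists>c>0. \<exists>C>0. \<exists>\<epsilon> :: nat \<Rightarrow> real. \<epsilon> \<longlonglongrightarrow> 0 \<and>
               (AE \<omega> in M. \<forall>\<^sub>F n in sequentially.
                  c * (W \<omega> * real n powr (1 - chi m \<delta> + \<pi> * chi m \<delta> + \<epsilon> n)) \<le> real (largest \<omega> n) \<and>
                  real (largest \<omega> n) \<le> C * (W \<omega> * real n powr (1 - chi m \<delta> + \<pi> * chi m \<delta> + \<epsilon> n))))"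
    proof (rule exI[of _ W], intro conjI)
      \<comment> \<open>For trees \<epsilon> = 0 works, since the fluctuations are taken up by
        \<open>W\<close> and the two constants.\<close>
      show "\<exists>c>0. \<exists>C>0. \<exists>\<epsilon> :: nat \<Rightarrow> real. \<epsilon> \<longlonglongrightarrow> 0 \<and>
               (AE \<omega> in M. \<forall>\<^sub>F n in sequentially.
                  c * (W \<omega> * real n powr (1 - chi m \<delta> + \<pi> * chi m \<delta> + \<epsilon> n)) \<le> real (largest \<omega> n) \<and>
                  real (largest \<omega> n) \<le> C * (W \<omega> * real n powr (1 - chi m \<delta> + \<pi> * chi m \<delta> + \<epsilon> n)))"
        using W(3-5) unfolding exponent_eq
        by (intro exI[of _ c] exI[of _ C] exI[of _ "\<lambda>_. 0"] conjI) simp_all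
    qed (use W in auto)
  qed
qed

end
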